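(* Let $P$ be a separable II$_1$ factor and let $M\subseteq N\subseteq P^\mathcal U$ be separable subalgebras (II$_1$ factors) such that $M$ is an elementary subalgebra of $P^\mathcal U$ ($M\preceq P^\mathcal U$) and the relative commutant $N'\cap P^\mathcal U$ is a factor. Then $M'\cap P^\mathcal U$ is a factor.
   Context: Standing assumptions: Continuum Hypothesis; $\mathcal U$ a fixed nonprincipal ultrafilter on $\mathbb N$; $P^\mathcal U$ the tracial ultrapower. In continuous first-order logic for tracial von Neumann algebras (formulae built from real/imaginary parts of $\tau(p(x))$, $p$ a $*$-polynomial, by continuous functions $\mathbb R^n\to\mathbb R$ and quantifiers $\sup,\inf$ over operator-norm balls), a subalgebra $M\subseteq Q$ is elementary, written $M\preceq Q$, if $\varphi(a)^M=\varphi(a)^Q$ for every formula $\varphi(x)$ and every tuple $a$ from $M$. For $S\subseteq Q$, $S'\cap Q=\{x\in Q: xs=sx\ \forall s\in S\}$. *)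

theory Defs
  imports "HOL-Analysis.Analysis"
begin

record 'a tralg =
  tcarrier :: "'a set"
  tzero :: 'a
  tone :: 'a
  tadd :: "'a \<Rightarrow> 'a \<Rightarrow> 'a"
  tmul :: "'a \<Rightarrow> 'a \<Rightarrow> 'a"
  tsmult :: "complex \<Rightarrow> 'a \<Rightarrow> 'a"
  tstar :: "'a \<Rightarrow> 'a"
  tnorm :: "'a \<Rightarrow> real"
  ttr :: "'a \<Rightarrow> complex"

definition tsub :: "'a tralg \<Rightarrow> 'a \<Rightarrow> 'a \<Rightarrow> 'a" where
  "tsub Q x y = tadd Q x (tsmult Q (-1) y)"

definition n2 :: "'a tralg \<Rightarrow> 'a \<Rightarrow> real" where
  "n2 Q x = sqrt (Re (ttr Q (tmul Q (tstar Q x) x)))"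

text \<open>Tracial von Neumann algebra, in the standard abstract form
 (Farah--Hart--Sherman): a unital C*-algebra with a faithful tracial state
 whose operator-norm unit ball is complete for the 2-norm.\<close>
definition tvna :: "'a tralg \<Rightarrow> bool" where
  "tvna Q \<longleftrightarrow> (let C = tcarrier Q; add = tadd Q; mul = tmul Q; sm = tsmult Q;
      st = tstar Q; nm = tnorm Q; tr = ttr Q; z = tzero Q; e = tone Q in
    z \<in> C \<and> e \<in> C \<and>
    (\<forall>x\<in>C. \<forall>y\<in>C. add x y \<in> C \<and> mul x y \<in> C) \<and>
    (\<forall>c. \<forall>x\<in>C. sm c x \<in> C) \<and> (\<forall>x\<in>C. st x \<in> C) \<and>
    \<comment> \<open>complex vector space\<close>
    (\<forall>x\<in>C. \<forall>y\<in>C. add x y = add y x) \<and>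
    (\<forall>x\<in>C. \<forall>y\<in>C. \<forall>w\<in>C. add (add x y) w = add x (add y w)) \<and>
    (\<forall>x\<in>C. add z x = x) \<and>
    (\<forall>x\<in>C. add x (sm (-1) x) = z) \<and>
    (\<forall>x\<in>C. sm 1 x = x) \<and>
    (\<forall>a b. \<forall>x\<in>C. sm a (sm b x) = sm (a * b) x) \<and>
    (\<forall>a b. \<forall>x\<in>C. sm (a + b) x = add (sm a x) (sm b x)) \<and>
    (\<forall>a. \<forall>x\<in>C. \<forall>y\<in>C. sm a (add x y) = add (sm a x) (sm a y)) \<and>
    \<comment> \<open>unital associative algebra\<close>
    (\<forall>x\<in>C. \<forall>y\<in>C. \<forall>w\<in>C. mul (mul x y) w = mul x (mul y w)) \<and>
    (\<forall>x\<in>C. mul e x = x \<and> mul x e = x) \<and>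
    (\<forall>x\<in>C. \<forall>y\<in>C. \<forall>w\<in>C. mul x (add y w) = add (mul x y) (mul x w)
                       \<and> mul (add y w) x = add (mul y x) (mul w x)) \<and>
    (\<forall>a. \<forall>x\<in>C. \<forall>y\<in>C. mul (sm a x) y = sm a (mul x y) \<and> mul x (sm a y) = sm a (mul x y)) \<and>
    \<comment> \<open>involution\<close>
    (\<forall>x\<in>C. st (st x) = x) \<and>
    (\<forall>x\<in>C. \<forall>y\<in>C. st (add x y) = add (st x) (st y) \<and> st (mul x y) = mul (st y) (st x)) \<and>
    (\<forall>a. \<forall>x\<in>C. st (sm a x) = sm (cnj a) (st x)) \<and>
    \<comment> \<open>C*-norm, complete\<close>
    (\<forall>x\<in>C. nm x \<ge> 0 \<and> (nm x = 0 \<longleftrightarrow> x = z)) \<and>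
    (\<forall>x\<in>C. \<forall>y\<in>C. nm (add x y) \<le> nm x + nm y \<and> nm (mul x y) \<le> nm x * nm y) \<and>
    (\<forall>a. \<forall>x\<in>C. nm (sm a x) = cmod a * nm x) \<and>
    (\<forall>x\<in>C. nm (mul (st x) x) = (nm x)\<^sup>2) \<and>
    (\<forall>f. (\<forall>n. f n \<in> C) \<longrightarrow>
       (\<forall>\<epsilon>>0. \<exists>N. \<forall>m\<ge>N. \<forall>n\<ge>N. nm (tsub Q (f m) (f n)) < \<epsilon>) \<longrightarrow>
       (\<exists>x\<in>C. (\<lambda>n. nm (tsub Q (f n) x)) \<longlonglongrightarrow> 0)) \<and>
    \<comment> \<open>faithful tracial state\<close>
    (\<forall>x\<in>C. \<forall>y\<in>C. tr (add x y) = tr x + tr y) \<and>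
    (\<forall>a. \<forall>x\<in>C. tr (sm a x) = a * tr x) \<and>
    tr e = 1 \<and>
    (\<forall>x\<in>C. \<forall>y\<in>C. tr (mul x y) = tr (mul y x)) \<and>
    (\<forall>x\<in>C. Im (tr (mul (st x) x)) = 0 \<and> Re (tr (mul (st x) x)) \<ge> 0) \<and>
    (\<forall>x\<in>C. tr (mul (st x) x) = 0 \<longrightarrow> x = z) \<and>
    \<comment> \<open>unit ball complete in the 2-norm\<close>
    (\<forall>f. (\<forall>n. f n \<in> C \<and> nm (f n) \<le> 1) \<longrightarrow>
       (\<forall>\<epsilon>>0. \<exists>N. \<forall>m\<ge>N. \<forall>n\<ge>N. n2 Q (tsub Q (f m) (f n)) < \<epsilon>) \<longrightarrow>
       (\<exists>x\<in>C. nm x \<le> 1 \<and> (\<lambda>n. n2 Q (tsub Q (f n) x)) \<longlonglongrightarrow> 0)))"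

definition restr :: "'a tralg \<Rightarrow> 'a set \<Rightarrow> 'a tralg" where
  "restr Q S = Q\<lparr>tcarrier := S\<rparr>"

definition vsub :: "'a tralg \<Rightarrow> 'a set \<Rightarrow> bool" where
  "vsub Q S \<longleftrightarrow> S \<subseteq> tcarrier Q \<and> tvna (restr Q S)"

definition center :: "'a tralg \<Rightarrow> 'a set" where
  "center Q = {x \<in> tcarrier Q. \<forall>y\<in>tcarrier Q. tmul Q x y = tmul Q y x}"

definition factor :: "'a tralg \<Rightarrow> bool" where
  "factor Q \<longleftrightarrow> tvna Q \<and> center Q = {tsmult Q c (tone Q) | c. True}"

primrec lincomb :: "'a tralg \<Rightarrow> (complex \<times> 'a) list \<Rightarrow> 'a" where
  "lincomb Q [] = tzero Q"
| "lincomb Q (p # ps) = tadd Q (tsmult Q (fst p) (snd p)) (lincomb Q ps)"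

definition findim :: "'a tralg \<Rightarrow> bool" where
  "findim Q \<longleftrightarrow> (\<exists>xs. set xs \<subseteq> tcarrier Q \<and>
     (\<forall>y\<in>tcarrier Q. \<exists>cs. length cs = length xs \<and> y = lincomb Q (zip cs xs)))"

definition II1_factor :: "'a tralg \<Rightarrow> bool" where
  "II1_factor Q \<longleftrightarrow> factor Q \<and> \<not> findim Q"

text \<open>Separable: separable in the 2-norm topology (equivalently, separable predual).\<close>
definition separable :: "'a tralg \<Rightarrow> bool" where
  "separable Q \<longleftrightarrow> (\<exists>D. countable D \<and> D \<subseteq> tcarrier Q \<and>
     (\<forall>x\<in>tcarrier Q. \<forall>\<epsilon>>0. \<exists>d\<in>D. n2 Q (tsub Q x d) < \<epsilon>))"

definition relcomm :: "'a tralg \<Rightarrow> 'a set \<Rightarrow> 'a set" where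
  "relcomm Q S = {x \<in> tcarrier Q. \<forall>s\<in>S. tmul Q x s = tmul Q s x}"

definition nonprincipal_ultrafilter :: "nat filter \<Rightarrow> bool" where
  "nonprincipal_ultrafilter U \<longleftrightarrow> U \<noteq> bot \<and>
     (\<forall>A. eventually (\<lambda>n. n \<in> A) U \<or> eventually (\<lambda>n. n \<notin> A) U) \<and>
     (\<forall>k. eventually (\<lambda>n. n \<noteq> k) U)"

definition bseq :: "'a tralg \<Rightarrow> (nat \<Rightarrow> 'a) set" where
  "bseq P = {f. (\<forall>n. f n \<in> tcarrier P) \<and> (\<exists>B. \<forall>n. tnorm P (f n) \<le> B)}"

definition ucls :: "'a tralg \<Rightarrow> nat filter \<Rightarrow> (nat \<Rightarrow> 'a) \<Rightarrow> (nat \<Rightarrow> 'a) set" where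
  "ucls P U f = {g \<in> bseq P. ((\<lambda>n. n2 P (tsub P (f n) (g n))) \<longlongrightarrow> 0) U}"

definition urep :: "(nat \<Rightarrow> 'a) set \<Rightarrow> nat \<Rightarrow> 'a" where
  "urep X = (SOME f. f \<in> X)"

definition ultrapower :: "'a tralg \<Rightarrow> nat filter \<Rightarrow> ((nat \<Rightarrow> 'a) set) tralg" where
  "ultrapower P U = \<lparr>
     tcarrier = ucls P U ` bseq P,
     tzero = ucls P U (\<lambda>n. tzero P),
     tone = ucls P U (\<lambda>n. tone P),
     tadd = (\<lambda>X Y. ucls P U (\<lambda>n. tadd P (urep X n) (urep Y n))),
     tmul = (\<lambda>X Y. ucls P U (\<lambda>n. tmul P (urep X n) (urep Y n))),
     tsmult = (\<lambda>c X. ucls P U (\<lambda>n. tsmult P c (urep X n))),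
     tstar = (\<lambda>X. ucls P U (\<lambda>n. tstar P (urep X n))),
     tnorm = (\<lambda>X. Inf ((\<lambda>f. Lim U (\<lambda>n. tnorm P (f n))) ` X)),
     ttr = (\<lambda>X. Lim U (\<lambda>n. ttr P (urep X n))) \<rparr>"

datatype spoly = PVar nat | PConst complex | PAdd spoly spoly | PMul spoly spoly | PStar spoly

primrec peval :: "spoly \<Rightarrow> 'a tralg \<Rightarrow> (nat \<Rightarrow> 'a) \<Rightarrow> 'a" where
  "peval (PVar i) Q a = a i"
| "peval (PConst c) Q a = tsmult Q c (tone Q)"
| "peval (PAdd p q) Q a = tadd Q (peval p Q a) (peval q Q a)"
| "peval (PMul p q) Q a = tmul Q (peval p Q a) (peval q Q a)"
| "peval (PStar p) Q a = tstar Q (peval p Q a)"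

datatype formula = FRe spoly | FIm spoly
  | FConn "(nat \<Rightarrow> real) \<Rightarrow> real" "formula list"
  | FSup nat real formula | FInf nat real formula

definition vecof :: "real list \<Rightarrow> nat \<Rightarrow> real" where
  "vecof xs i = (if i < length xs then xs ! i else 0)"

primrec feval :: "formula \<Rightarrow> 'a tralg \<Rightarrow> (nat \<Rightarrow> 'a) \<Rightarrow> real" where
  "feval (FRe p) Q a = Re (ttr Q (peval p Q a))"
| "feval (FIm p) Q a = Im (ttr Q (peval p Q a))"
| "feval (FConn f \<phi>s) Q a = f (vecof (map (\<lambda>\<phi>. feval \<phi> Q a) \<phi>s))"
| "feval (FSup i r \<phi>) Q a =
     (SUP x\<in>{x\<in>tcarrier Q. tnorm Q x \<le> r}. feval \<phi> Q (a(i := x)))"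
| "feval (FInf i r \<phi>) Q a =
     (INF x\<in>{x\<in>tcarrier Q. tnorm Q x \<le> r}. feval \<phi> Q (a(i := x)))"

text \<open>Admissible formulas: connectives are continuous functions R^n \<rightarrow> R, where
 R^n is identified with the subspace of nat \<Rightarrow> real vanishing from n on.\<close>
inductive adm :: "formula \<Rightarrow> bool" where
  "adm (FRe p)"
| "adm (FIm p)"
| "continuous_on {v. \<forall>i\<ge>length \<phi>s. v i = 0} f \<Longrightarrow> (\<forall>\<phi>\<in>set \<phi>s. adm \<phi>) \<Longrightarrow> adm (FConn f \<phi>s)"
| "adm \<phi> \<Longrightarrow> adm (FSup i r \<phi>)"
| "adm \<phi> \<Longrightarrow> adm (FInf i r \<phi>)"

definition elementary :: "'a set \<Rightarrow> 'a tralg \<Rightarrow> bool" where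
  "elementary M Q \<longleftrightarrow> (\<forall>\<phi> a. adm \<phi> \<longrightarrow> range a \<subseteq> M \<longrightarrow>
       feval \<phi> (restr Q M) a = feval \<phi> Q a)"

definition CH :: bool where
  "CH \<longleftrightarrow> (\<forall>A :: real set. countable A \<or> (\<exists>f. bij_betw f A (UNIV :: real set)))"

end

theory Submission
  imports Defs
begin

text \<open>Write \<open>Q\<close> for the ultrapower. It is again a tracial von Neumann algebra; the point is the
  C*-identity for the quotient norm, which amounts to cutting an element \<open>f\<close> down to norm \<open>r\<close> at small
  cost in the 2-norm when \<open>f\<^sup>\<star> f\<close> is 2-norm close to the ball of radius \<open>r\<^sup>2\<close>. All functional
  calculus needed for this comes from square roots \<open>sqrt (1 - k)\<close> and the faithful trace.

  Suppose \<open>x\<close> is a nonzero trace-zero element of the center of \<open>M' \<inter> Q\<close>. By countable saturation,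
  commuting with \<open>M' \<inter> Q\<close> is witnessed by countably many conditions of the form
  \<open>\<parallel>[x, y]\<parallel>\<^sup>2 \<le> 1/k + K \<Sum>\<^sub>i\<^sub><\<^sub>K \<parallel>[y, a\<^sub>i]\<parallel>\<^sup>2\<close> for all \<open>y\<close> in the unit ball, with parameters \<open>a\<^sub>i\<close>
  from a dense sequence of \<open>M\<close>. As \<open>x\<close> commutes with every tuple \<open>c\<close> from \<open>M\<close>, the statement
  "for every tuple \<open>c\<close> there is such an \<open>x\<close> commuting with \<open>c\<close>" holds in \<open>M\<close>, hence, by elementarity, in
  \<open>Q\<close>. Applying it to a dense sequence of \<open>N\<close> and saturating once more produces an element of \<open>N' \<inter> Q\<close>
  with the same properties. It commutes with \<open>N' \<inter> Q\<close> because \<open>a\<^sub>i \<in> M \<subseteq> N\<close>, and it is not a scalar, so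
  \<open>N' \<inter> Q\<close> is not a factor.\<close>

section \<open>Tracial algebras\<close>

text \<open>Membership in a relative commutant is not expressed by a formula, so centrality cannot
  be transferred as it stands. The inequality with a penalty term replaces it: for fixed
  \<open>k\<close> it is a single supremum over the unit ball with finitely many parameters from
  \<open>M\<close>, and the penalty vanishes on everything that commutes with the
  \<open>a i\<close>. The integers \<open>K k\<close> are found for \<open>x\<close> first and then
  frozen in the formula, so that the new element obeys the same inequalities. Two further conditions
  keep it nonscalar: trace zero, and squared 2-norm at least \<open>s\<close>, the value at
  \<open>x\<close>. A scalar of trace zero is zero. An infimum yields only approximate solutions of
  finitely many conditions, hence the second use of saturation. For the ultrapower axioms the
  obstacle is that the norm is an infimum, over representatives, of ultralimits. The decisive fact
  is that this infimum is attained by a representative bounded by it in every coordinate.\<close>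

locale tracial_algebra =
  fixes P :: "'a tralg" (structure)
  assumes zero_closed: "tzero P \<in> tcarrier P"
    and one_closed: "tone P \<in> tcarrier P"
    and add_mul_closed: "\<forall>x\<in>tcarrier P. \<forall>y\<in>tcarrier P. tadd P x y \<in> tcarrier P \<and> tmul P x y \<in> tcarrier P"
    and smult_closed_ax: "\<forall>c. \<forall>x\<in>tcarrier P. tsmult P c x \<in> tcarrier P"
    and star_closed_ax: "\<forall>x\<in>tcarrier P. tstar P x \<in> tcarrier P"
    and add_comm_ax: "\<forall>x\<in>tcarrier P. \<forall>y\<in>tcarrier P. tadd P x y = tadd P y x"
    and add_assoc_ax: "\<forall>x\<in>tcarrier P. \<forall>y\<in>tcarrier P. \<forall>w\<in>tcarrier P.
      tadd P (tadd P x y) w = tadd P x (tadd P y w)"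
    and zero_add_ax: "\<forall>x\<in>tcarrier P. tadd P (tzero P) x = x"
    and add_inverse_ax: "\<forall>x\<in>tcarrier P. tadd P x (tsmult P (-1) x) = tzero P"
    and one_smult_ax: "\<forall>x\<in>tcarrier P. tsmult P 1 x = x"
    and smult_smult_ax: "\<forall>a b. \<forall>x\<in>tcarrier P. tsmult P a (tsmult P b x) = tsmult P (a * b) x"
    and add_smult_ax: "\<forall>a b. \<forall>x\<in>tcarrier P. tsmult P (a + b) x = tadd P (tsmult P a x) (tsmult P b x)"
    and smult_add_ax: "\<forall>a. \<forall>x\<in>tcarrier P. \<forall>y\<in>tcarrier P.
      tsmult P a (tadd P x y) = tadd P (tsmult P a x) (tsmult P a y)"
    and mul_assoc_ax: "\<forall>x\<in>tcarrier P. \<forall>y\<in>tcarrier P. \<forall>w\<in>tcarrier P.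
      tmul P (tmul P x y) w = tmul P x (tmul P y w)"
    and one_mul_ax: "\<forall>x\<in>tcarrier P. tmul P (tone P) x = x \<and> tmul P x (tone P) = x"
    and distrib_ax: "\<forall>x\<in>tcarrier P. \<forall>y\<in>tcarrier P. \<forall>w\<in>tcarrier P.
      tmul P x (tadd P y w) = tadd P (tmul P x y) (tmul P x w)
      \<and> tmul P (tadd P y w) x = tadd P (tmul P y x) (tmul P w x)"
    and smult_mul_ax: "\<forall>a. \<forall>x\<in>tcarrier P. \<forall>y\<in>tcarrier P.
      tmul P (tsmult P a x) y = tsmult P a (tmul P x y) \<and> tmul P x (tsmult P a y) = tsmult P a (tmul P x y)"
    and star_star_ax: "\<forall>x\<in>tcarrier P. tstar P (tstar P x) = x"
    and star_add_mul_ax: "\<forall>x\<in>tcarrier P. \<forall>y\<in>tcarrier P.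
      tstar P (tadd P x y) = tadd P (tstar P x) (tstar P y)
      \<and> tstar P (tmul P x y) = tmul P (tstar P y) (tstar P x)"
    and star_smult_ax: "\<forall>a. \<forall>x\<in>tcarrier P. tstar P (tsmult P a x) = tsmult P (cnj a) (tstar P x)"
    and norm_zero_ax: "\<forall>x\<in>tcarrier P. tnorm P x \<ge> 0 \<and> (tnorm P x = 0 \<longleftrightarrow> x = tzero P)"
    and norm_add_mul_ax: "\<forall>x\<in>tcarrier P. \<forall>y\<in>tcarrier P.
      tnorm P (tadd P x y) \<le> tnorm P x + tnorm P y \<and> tnorm P (tmul P x y) \<le> tnorm P x * tnorm P y"
    and norm_smult_ax: "\<forall>a. \<forall>x\<in>tcarrier P. tnorm P (tsmult P a x) = cmod a * tnorm P x"
    and cstar_ax: "\<forall>x\<in>tcarrier P. tnorm P (tmul P (tstar P x) x) = (tnorm P x)\<^sup>2"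
    and norm_complete: "\<forall>f. (\<forall>n. f n \<in> tcarrier P) \<longrightarrow>
       (\<forall>\<epsilon>>0. \<exists>N. \<forall>m\<ge>N. \<forall>n\<ge>N. tnorm P (tsub P (f m) (f n)) < \<epsilon>) \<longrightarrow>
       (\<exists>x\<in>tcarrier P. (\<lambda>n. tnorm P (tsub P (f n) x)) \<longlonglongrightarrow> 0)"
    and tr_add_ax: "\<forall>x\<in>tcarrier P. \<forall>y\<in>tcarrier P. ttr P (tadd P x y) = ttr P x + ttr P y"
    and tr_smult_ax: "\<forall>a. \<forall>x\<in>tcarrier P. ttr P (tsmult P a x) = a * ttr P x"
    and tr_one: "ttr P (tone P) = 1"
    and tr_comm_ax: "\<forall>x\<in>tcarrier P. \<forall>y\<in>tcarrier P. ttr P (tmul P x y) = ttr P (tmul P y x)"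
    and tr_pos_ax: "\<forall>x\<in>tcarrier P. Im (ttr P (tmul P (tstar P x) x)) = 0
      \<and> Re (ttr P (tmul P (tstar P x) x)) \<ge> 0"
    and tr_faithful_ax: "\<forall>x\<in>tcarrier P. ttr P (tmul P (tstar P x) x) = 0 \<longrightarrow> x = tzero P"
    and ball_complete: "\<forall>f. (\<forall>n. f n \<in> tcarrier P \<and> tnorm P (f n) \<le> 1) \<longrightarrow>
       (\<forall>\<epsilon>>0. \<exists>N. \<forall>m\<ge>N. \<forall>n\<ge>N. n2 P (tsub P (f m) (f n)) < \<epsilon>) \<longrightarrow>
       (\<exists>x\<in>tcarrier P. tnorm P x \<le> 1 \<and> (\<lambda>n. n2 P (tsub P (f n) x)) \<longlonglongrightarrow> 0)"

text \<open>The locale assumptions list the conjuncts of \<open>tvna_def\<close> in the same order,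
  so both sides unfold to the same term.\<close>

lemma tvna_iff_tracial_algebra: "tvna P \<longleftrightarrow> tracial_algebra P"
  unfolding tvna_def tracial_algebra_def Let_def conj_assoc by (rule refl)

context tracial_algebra
begin

abbreviation carr ("\<C>") where "\<C> \<equiv> tcarrier P"
abbreviation zer ("\<zero>") where "\<zero> \<equiv> tzero P"
abbreviation uno ("\<one>") where "\<one> \<equiv> tone P"
abbreviation plu (infixl "\<oplus>" 65) where "x \<oplus> y \<equiv> tadd P x y"
abbreviation minu (infixl "\<ominus>" 65) where "x \<ominus> y \<equiv> tsub P x y"
abbreviation tims (infixr "\<otimes>" 70) where "x \<otimes> y \<equiv> tmul P x y"
abbreviation scal (infixr "\<odot>" 75) where "c \<odot> x \<equiv> tsmult P c x"
abbreviation adj ("_\<^sup>\<star>" [1000] 999) where "x\<^sup>\<star> \<equiv> tstar P x"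
abbreviation nm ("\<nu>") where "\<nu> \<equiv> tnorm P"
abbreviation trac ("\<tau>") where "\<tau> \<equiv> ttr P"
abbreviation l2 ("\<rho>") where "\<rho> \<equiv> n2 P"

section \<open>Algebraic identities\<close>

lemma closed [simp]:
  "\<zero> \<in> \<C>" "\<one> \<in> \<C>"
  "x \<in> \<C> \<Longrightarrow> y \<in> \<C> \<Longrightarrow> x \<oplus> y \<in> \<C>"
  "x \<in> \<C> \<Longrightarrow> y \<in> \<C> \<Longrightarrow> x \<otimes> y \<in> \<C>"
  "x \<in> \<C> \<Longrightarrow> c \<odot> x \<in> \<C>"
  "x \<in> \<C> \<Longrightarrow> x\<^sup>\<star> \<in> \<C>"
  "x \<in> \<C> \<Longrightarrow> y \<in> \<C> \<Longrightarrow> x \<ominus> y \<in> \<C>"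
  by (simp_all add: tsub_def zero_closed one_closed add_mul_closed smult_closed_ax star_closed_ax)

lemma unit_laws [simp]:
  "x \<in> \<C> \<Longrightarrow> \<zero> \<oplus> x = x" "x \<in> \<C> \<Longrightarrow> 1 \<odot> x = x"
  "x \<in> \<C> \<Longrightarrow> \<one> \<otimes> x = x" "x \<in> \<C> \<Longrightarrow> x \<otimes> \<one> = x"
  "x \<in> \<C> \<Longrightarrow> (x\<^sup>\<star>)\<^sup>\<star> = x" "x \<in> \<C> \<Longrightarrow> a \<odot> b \<odot> x = (a * b) \<odot> x"
  by (simp_all add: zero_add_ax one_smult_ax one_mul_ax star_star_ax smult_smult_ax)

lemma add_zero [simp]: "x \<in> \<C> \<Longrightarrow> x \<oplus> \<zero> = x"
  using add_comm_ax[rule_format, of x "\<zero>"] by simp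

lemma minus_self [simp]: "x \<in> \<C> \<Longrightarrow> x \<ominus> x = \<zero>"
  using add_inverse_ax by (simp add: tsub_def)

lemma smult_zero [simp]: "x \<in> \<C> \<Longrightarrow> 0 \<odot> x = \<zero>" "c \<odot> \<zero> = \<zero>"
proof -
  show 1: "0 \<odot> x = \<zero>" if "x \<in> \<C>" for x
  proof -
    have "0 \<odot> x = (1 + (-1)) \<odot> x" by simp
    also have "\<dots> = 1 \<odot> x \<oplus> (-1) \<odot> x" using add_smult_ax that by blast
    also have "\<dots> = \<zero>" using that add_inverse_ax by simp
    finally show ?thesis .
  qed
  have "c \<odot> \<zero> = (c * 0) \<odot> \<zero>" using 1[OF closed(1)] unit_laws(6)[OF closed(1)] by metis
  thus "c \<odot> \<zero> = \<zero>" using 1[OF closed(1)] by simp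
qed

lemma star_laws:
  "x \<in> \<C> \<Longrightarrow> y \<in> \<C> \<Longrightarrow> (x \<oplus> y)\<^sup>\<star> = x\<^sup>\<star> \<oplus> y\<^sup>\<star>"
  "x \<in> \<C> \<Longrightarrow> y \<in> \<C> \<Longrightarrow> (x \<otimes> y)\<^sup>\<star> = y\<^sup>\<star> \<otimes> x\<^sup>\<star>"
  "x \<in> \<C> \<Longrightarrow> (c \<odot> x)\<^sup>\<star> = cnj c \<odot> x\<^sup>\<star>"
  "x \<in> \<C> \<Longrightarrow> y \<in> \<C> \<Longrightarrow> (x \<ominus> y)\<^sup>\<star> = x\<^sup>\<star> \<ominus> y\<^sup>\<star>"
  by (simp_all add: tsub_def star_add_mul_ax star_smult_ax)

lemma star_unit [simp]: "\<one>\<^sup>\<star> = \<one>" "\<zero>\<^sup>\<star> = \<zero>"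
proof -
  show "\<one>\<^sup>\<star> = \<one>"
    using star_laws(2)[of "\<one>" "\<one>\<^sup>\<star>"] by simp
  show "\<zero>\<^sup>\<star> = \<zero>"
    using star_laws(3)[of "\<zero>" 0] by simp
qed

lemma mul_zero [simp]: "x \<in> \<C> \<Longrightarrow> x \<otimes> \<zero> = \<zero>" "x \<in> \<C> \<Longrightarrow> \<zero> \<otimes> x = \<zero>"
  using smult_mul_ax[rule_format, of x "\<zero>" 0] smult_mul_ax[rule_format, of "\<zero>" x 0] by simp_all

lemma mul_laws:
  "x \<in> \<C> \<Longrightarrow> y \<in> \<C> \<Longrightarrow> w \<in> \<C> \<Longrightarrow> (x \<otimes> y) \<otimes> w = x \<otimes> (y \<otimes> w)"
  "x \<in> \<C> \<Longrightarrow> y \<in> \<C> \<Longrightarrow> w \<in> \<C> \<Longrightarrow> x \<otimes> (y \<oplus> w) = x \<otimes> y \<oplus> x \<otimes> w"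
  "x \<in> \<C> \<Longrightarrow> y \<in> \<C> \<Longrightarrow> w \<in> \<C> \<Longrightarrow> (y \<oplus> w) \<otimes> x = y \<otimes> x \<oplus> w \<otimes> x"
  "x \<in> \<C> \<Longrightarrow> y \<in> \<C> \<Longrightarrow> (c \<odot> x) \<otimes> y = c \<odot> (x \<otimes> y)"
  "x \<in> \<C> \<Longrightarrow> y \<in> \<C> \<Longrightarrow> x \<otimes> (c \<odot> y) = c \<odot> (x \<otimes> y)"
  "x \<in> \<C> \<Longrightarrow> y \<in> \<C> \<Longrightarrow> w \<in> \<C> \<Longrightarrow> x \<otimes> (y \<ominus> w) = x \<otimes> y \<ominus> x \<otimes> w"
  "x \<in> \<C> \<Longrightarrow> y \<in> \<C> \<Longrightarrow> w \<in> \<C> \<Longrightarrow> (y \<ominus> w) \<otimes> x = y \<otimes> x \<ominus> w \<otimes> x"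
  by (simp_all add: tsub_def mul_assoc_ax distrib_ax smult_mul_ax)

lemma tr_laws:
  "x \<in> \<C> \<Longrightarrow> y \<in> \<C> \<Longrightarrow> \<tau> (x \<oplus> y) = \<tau> x + \<tau> y"
  "x \<in> \<C> \<Longrightarrow> \<tau> (c \<odot> x) = c * \<tau> x"
  "x \<in> \<C> \<Longrightarrow> y \<in> \<C> \<Longrightarrow> \<tau> (x \<ominus> y) = \<tau> x - \<tau> y"
  "\<tau> \<one> = 1"
  by (simp_all add: tsub_def tr_add_ax tr_smult_ax tr_one)

lemma tr_zero [simp]: "\<tau> \<zero> = 0"
  using tr_laws(2)[of "\<zero>" 0] by simp

lemma tr_comm: "x \<in> \<C> \<Longrightarrow> y \<in> \<C> \<Longrightarrow> \<tau> (x \<otimes> y) = \<tau> (y \<otimes> x)"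
  using tr_comm_ax by blast

lemma tr_pos: "x \<in> \<C> \<Longrightarrow> Re (\<tau> (x\<^sup>\<star> \<otimes> x)) \<ge> 0" "x \<in> \<C> \<Longrightarrow> Im (\<tau> (x\<^sup>\<star> \<otimes> x)) = 0"
  using tr_pos_ax by auto

lemma tr_faithful: "x \<in> \<C> \<Longrightarrow> Re (\<tau> (x\<^sup>\<star> \<otimes> x)) \<le> 0 \<Longrightarrow> x = \<zero>"
  using tr_faithful_ax tr_pos by (metis complex_eq_iff order_antisym zero_complex.sel)

lemma diff_eq_zero: assumes "x \<in> \<C>" "y \<in> \<C>" "x \<ominus> y = \<zero>" shows "x = y"
proof -
  have "y = \<zero> \<oplus> y" using assms by simp
  also have "\<dots> = x \<oplus> ((-1) \<odot> y \<oplus> y)" using assms add_assoc_ax by (metis closed(5) tsub_def)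
  also have "(-1) \<odot> y \<oplus> y = \<zero>" using assms add_inverse_ax add_comm_ax by (metis closed(5))
  finally show ?thesis using assms by simp
qed

text \<open>Testing against the trace turns an identity of the algebra into an identity of complex
  numbers, which the simplifier can decide.\<close>
lemma tr_eqI:
  assumes "x \<in> \<C>" "y \<in> \<C>" "\<And>w. w \<in> \<C> \<Longrightarrow> \<tau> (w \<otimes> x) = \<tau> (w \<otimes> y)"
  shows "x = y"
proof -
  have "\<tau> ((x \<ominus> y)\<^sup>\<star> \<otimes> (x \<ominus> y)) = 0"
    using assms(1,2) assms(3)[of "(x \<ominus> y)\<^sup>\<star>"] by (simp add: mul_laws(6) tr_laws)
  thus ?thesis using assms(1,2) tr_faithful[of "x \<ominus> y"] diff_eq_zero[of x y] by simp
qed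

lemmas alg = star_laws mul_laws tr_laws algebra_simps

text \<open>Polarization: the traces of the squares of \<open>1 + x\<close> and
  \<open>1 + i x\<close> are real. The first fact fixes the imaginary part of the trace of the
  adjoint, the second its real part.\<close>

lemma tr_star: assumes x: "x \<in> \<C>" shows "\<tau> (x\<^sup>\<star>) = cnj (\<tau> x)"
proof -
  have "Im (\<tau> ((\<one> \<oplus> x)\<^sup>\<star> \<otimes> (\<one> \<oplus> x))) = 0" "Im (\<tau> ((\<one> \<oplus> \<i> \<odot> x)\<^sup>\<star> \<otimes> (\<one> \<oplus> \<i> \<odot> x))) = 0"
    using x by (simp_all add: tr_pos)
  thus ?thesis using tr_pos(2)[OF x] x by (simp add: alg complex_eq_iff)
qed

section \<open>The 2-norm\<close>

lemma n2_sq: "x \<in> \<C> \<Longrightarrow> (\<rho> x)\<^sup>2 = Re (\<tau> (x\<^sup>\<star> \<otimes> x))"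
  by (simp add: n2_def tr_pos)

lemma n2_nonneg [simp]: "x \<in> \<C> \<Longrightarrow> \<rho> x \<ge> 0"
  by (simp add: n2_def tr_pos)

lemma n2_zero_iff: "x \<in> \<C> \<Longrightarrow> \<rho> x = 0 \<longleftrightarrow> x = \<zero>"
  using n2_sq[of x] tr_faithful[of x] by (auto simp: n2_def)

lemma n2_zero [simp]: "\<rho> \<zero> = 0"
  by (simp add: n2_zero_iff)

lemma Cauchy_Schwarz:
  assumes x: "x \<in> \<C>" and y: "y \<in> \<C>"
  shows "cmod (\<tau> (x\<^sup>\<star> \<otimes> y)) \<le> \<rho> x * \<rho> y"
proof (cases "x = \<zero>")
  case True thus ?thesis using y by simp
next
  case False
  define A b where "A = Re (\<tau> (x\<^sup>\<star> \<otimes> x))" and "b = \<tau> (x\<^sup>\<star> \<otimes> y)"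
  have A: "A > 0" using False tr_faithful[OF x] unfolding A_def by linarith
  have ay: "\<tau> (y\<^sup>\<star> \<otimes> x) = cnj b" using tr_star[of "x\<^sup>\<star> \<otimes> y"] x y by (simp add: b_def star_laws)
  have ax: "\<tau> (x\<^sup>\<star> \<otimes> x) = of_real A" using tr_pos[OF x] by (simp add: A_def complex_eq_iff)
  \<comment> \<open>This coefficient minimizes the squared 2-norm of \<open>c x + y\<close>;
    nonnegativity at the minimum is the claim.\<close>
  define c where "c = - b / of_real A"
  have cA: "c * of_real A = -b" using A by (simp add: c_def)
  have "0 \<le> Re (\<tau> ((c \<odot> x \<oplus> y)\<^sup>\<star> \<otimes> (c \<odot> x \<oplus> y)))" using x y by (simp add: tr_pos)
  also have "\<tau> ((c \<odot> x \<oplus> y)\<^sup>\<star> \<otimes> (c \<odot> x \<oplus> y))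
      = cnj c * (c * of_real A) + cnj c * b + c * cnj b + \<tau> (y\<^sup>\<star> \<otimes> y)"
    using x y by (simp add: alg ay ax flip: b_def)
  also have "\<dots> = c * cnj b + \<tau> (y\<^sup>\<star> \<otimes> y)" unfolding cA by simp
  also have "Re \<dots> = - (cmod b)\<^sup>2 / A + (\<rho> y)\<^sup>2"
    using y by (simp add: c_def n2_sq complex_mult_cnj cmod_power2)
      (simp add: power2_eq_square add_divide_distrib diff_divide_distrib)
  finally have "(cmod b)\<^sup>2 \<le> A * (\<rho> y)\<^sup>2" using A by (simp add: field_simps)
  also have "\<dots> = (\<rho> x * \<rho> y)\<^sup>2" using x by (simp add: A_def n2_sq power_mult_distrib)
  finally show ?thesis unfolding b_def by (rule power2_le_imp_le) (use x y in simp)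
qed

lemma n2_smult: "x \<in> \<C> \<Longrightarrow> \<rho> (c \<odot> x) = cmod c * \<rho> x"
proof -
  assume x: "x \<in> \<C>"
  have "(\<rho> (c \<odot> x))\<^sup>2 = (cmod c * \<rho> x)\<^sup>2"
  proof -
    have "\<tau> ((c \<odot> x)\<^sup>\<star> \<otimes> (c \<odot> x)) = (c * cnj c) * \<tau> (x\<^sup>\<star> \<otimes> x)"
      using x by (simp add: alg)
    also have "Re \<dots> = (cmod c)\<^sup>2 * Re (\<tau> (x\<^sup>\<star> \<otimes> x))"
      by (simp add: complex_mult_cnj cmod_power2)
    finally show ?thesis using x by (simp add: n2_sq power_mult_distrib)
  qed
  thus ?thesis by (rule power2_eq_imp_eq) (use x in simp_all)
qed

lemma n2_add: "x \<in> \<C> \<Longrightarrow> y \<in> \<C> \<Longrightarrow> \<rho> (x \<oplus> y) \<le> \<rho> x + \<rho> y"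
proof -
  assume x: "x \<in> \<C>" and y: "y \<in> \<C>"
  have ay: "\<tau> (y\<^sup>\<star> \<otimes> x) = cnj (\<tau> (x\<^sup>\<star> \<otimes> y))" using tr_star[of "x\<^sup>\<star> \<otimes> y"] x y by (simp add: star_laws)
  have "(\<rho> (x \<oplus> y))\<^sup>2 = (\<rho> x)\<^sup>2 + 2 * Re (\<tau> (x\<^sup>\<star> \<otimes> y)) + (\<rho> y)\<^sup>2"
    using x y by (simp add: n2_sq alg ay)
  also have "Re (\<tau> (x\<^sup>\<star> \<otimes> y)) \<le> \<rho> x * \<rho> y"
    using Cauchy_Schwarz[OF x y] complex_Re_le_cmod order_trans by blast
  finally have "(\<rho> (x \<oplus> y))\<^sup>2 \<le> (\<rho> x + \<rho> y)\<^sup>2" by (simp add: power2_sum)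
  thus ?thesis by (rule power2_le_imp_le) (use x y in simp)
qed

lemma n2_minus_commute: "x \<in> \<C> \<Longrightarrow> y \<in> \<C> \<Longrightarrow> \<rho> (x \<ominus> y) = \<rho> (y \<ominus> x)"
proof -
  assume "x \<in> \<C>" "y \<in> \<C>"
  moreover from this have "y \<ominus> x = (-1) \<odot> (x \<ominus> y)" by (intro tr_eqI) (simp_all add: alg)
  ultimately show ?thesis by (simp add: n2_smult)
qed

lemma n2_diff_triangle:
  "x \<in> \<C> \<Longrightarrow> y \<in> \<C> \<Longrightarrow> w \<in> \<C> \<Longrightarrow> \<rho> (x \<ominus> w) \<le> \<rho> (x \<ominus> y) + \<rho> (y \<ominus> w)"
proof -
  assume a: "x \<in> \<C>" "y \<in> \<C>" "w \<in> \<C>"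
  hence "x \<ominus> w = (x \<ominus> y) \<oplus> (y \<ominus> w)" by (intro tr_eqI) (simp_all add: alg)
  thus ?thesis using a by (simp add: n2_add)
qed

lemma n2_star: "x \<in> \<C> \<Longrightarrow> \<rho> (x\<^sup>\<star>) = \<rho> x"
  using tr_comm[of x "x\<^sup>\<star>"] by (simp add: n2_def)

section \<open>The operator norm\<close>

lemma norm_nonneg [simp]: "x \<in> \<C> \<Longrightarrow> \<nu> x \<ge> 0"
  using norm_zero_ax by blast

lemma norm_zero_iff: "x \<in> \<C> \<Longrightarrow> \<nu> x = 0 \<longleftrightarrow> x = \<zero>"
  using norm_zero_ax by blast

lemma norm_zero [simp]: "\<nu> \<zero> = 0"
  by (simp add: norm_zero_iff)

lemma norm_laws:
  "x \<in> \<C> \<Longrightarrow> y \<in> \<C> \<Longrightarrow> \<nu> (x \<oplus> y) \<le> \<nu> x + \<nu> y"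
  "x \<in> \<C> \<Longrightarrow> y \<in> \<C> \<Longrightarrow> \<nu> (x \<otimes> y) \<le> \<nu> x * \<nu> y"
  "x \<in> \<C> \<Longrightarrow> \<nu> (c \<odot> x) = cmod c * \<nu> x"
  "x \<in> \<C> \<Longrightarrow> y \<in> \<C> \<Longrightarrow> \<nu> (x \<ominus> y) \<le> \<nu> x + \<nu> y"
proof -
  show 1: "\<nu> (x \<oplus> y) \<le> \<nu> x + \<nu> y" if "x \<in> \<C>" "y \<in> \<C>" for x y
    using norm_add_mul_ax that by blast
  show "x \<in> \<C> \<Longrightarrow> y \<in> \<C> \<Longrightarrow> \<nu> (x \<otimes> y) \<le> \<nu> x * \<nu> y"
    using norm_add_mul_ax by blast
  show 2: "\<nu> (c \<odot> x) = cmod c * \<nu> x" if "x \<in> \<C>" for c x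
    using norm_smult_ax that by blast
  show "x \<in> \<C> \<Longrightarrow> y \<in> \<C> \<Longrightarrow> \<nu> (x \<ominus> y) \<le> \<nu> x + \<nu> y"
    using 1[of x "(-1) \<odot> y"] 2[of y "-1"] by (simp add: tsub_def)
qed

lemma norm_cstar: "x \<in> \<C> \<Longrightarrow> \<nu> (x\<^sup>\<star> \<otimes> x) = (\<nu> x)\<^sup>2"
  using cstar_ax by blast

text \<open>The C*-identity and submultiplicativity bound the square of the norm of \<open>x\<close>
  by the product of the norms of \<open>x\<close> and its adjoint; dividing gives one inequality,
  and applying it to the adjoint gives the other.\<close>

lemma norm_star: assumes "x \<in> \<C>" shows "\<nu> (x\<^sup>\<star>) = \<nu> x"
proof -
  have "\<nu> x \<le> \<nu> (x\<^sup>\<star>)" if x: "x \<in> \<C>" for x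
  proof (cases "\<nu> x = 0")
    case False
    have "\<nu> x * \<nu> x \<le> \<nu> (x\<^sup>\<star>) * \<nu> x"
      using norm_laws(2)[of "x\<^sup>\<star>" x] norm_cstar[OF x] x by (simp add: power2_eq_square)
    moreover have "\<nu> x > 0" using False norm_nonneg[OF x] by linarith
    ultimately show ?thesis by simp
  qed (use x in simp)
  from this[OF assms] this[of "x\<^sup>\<star>"] assms show ?thesis by simp
qed

lemma norm_one [simp]: "\<nu> \<one> = 1"
proof -
  have "\<one> \<noteq> \<zero>" using tr_one tr_zero by fastforce
  hence "\<nu> \<one> \<noteq> 0" by (simp add: norm_zero_iff)
  moreover have "\<nu> \<one> * \<nu> \<one> = \<nu> \<one>" using norm_cstar[of "\<one>"] by (simp add: power2_eq_square)
  ultimately show ?thesis by simp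
qed

lemma norm_diff_triangle:
  "x \<in> \<C> \<Longrightarrow> y \<in> \<C> \<Longrightarrow> w \<in> \<C> \<Longrightarrow> \<nu> (x \<ominus> w) \<le> \<nu> (x \<ominus> y) + \<nu> (y \<ominus> w)"
proof -
  assume a: "x \<in> \<C>" "y \<in> \<C>" "w \<in> \<C>"
  hence "x \<ominus> w = (x \<ominus> y) \<oplus> (y \<ominus> w)" by (intro tr_eqI) (simp_all add: alg)
  thus ?thesis using a by (simp add: norm_laws)
qed

lemma norm_minus_commute: "x \<in> \<C> \<Longrightarrow> y \<in> \<C> \<Longrightarrow> \<nu> (x \<ominus> y) = \<nu> (y \<ominus> x)"
proof -
  assume "x \<in> \<C>" "y \<in> \<C>"
  moreover from this have "y \<ominus> x = (-1) \<odot> (x \<ominus> y)" by (intro tr_eqI) (simp_all add: alg)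
  ultimately show ?thesis by (simp add: norm_laws)
qed

subsection \<open>Square roots\<close>

lemma norm_limit_unique:
  assumes "x \<in> \<C>" "y \<in> \<C>" "\<And>n. f n \<in> \<C>"
    and "(\<lambda>n. \<nu> (f n \<ominus> x)) \<longlonglongrightarrow> 0" "(\<lambda>n. \<nu> (f n \<ominus> y)) \<longlonglongrightarrow> 0"
  shows "x = y"
proof -
  have "(\<lambda>n. \<nu> (f n \<ominus> x) + \<nu> (f n \<ominus> y)) \<longlonglongrightarrow> 0 + 0" by (intro tendsto_add assms)
  moreover have "\<nu> (x \<ominus> y) \<le> \<nu> (f n \<ominus> x) + \<nu> (f n \<ominus> y)" for n
    using norm_diff_triangle[of x "f n" y] norm_minus_commute[of x "f n"] assms by simp
  ultimately have "\<nu> (x \<ominus> y) \<le> 0 + 0" by (intro tendsto_lowerbound[where F = sequentially]) auto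
  hence "\<nu> (x \<ominus> y) = 0" by (intro antisym norm_nonneg) (use assms in simp_all)
  thus ?thesis using assms diff_eq_zero[of x y] by (simp add: norm_zero_iff)
qed

text \<open>Majorant method: telescoping turns the bound on single increments into a bound of all
  differences of \<open>f\<close> by those of \<open>c\<close>. It serves the square root iteration
  and, later, a Neumann series.\<close>

lemma convergent_if_dominated:
  assumes f: "\<And>n. f n \<in> \<C>" and d: "\<And>n. \<nu> (f (Suc n) \<ominus> f n) \<le> c (Suc n) - c n"
    and c: "convergent (c :: nat \<Rightarrow> real)"
  obtains x where "x \<in> \<C>" "(\<lambda>n. \<nu> (f n \<ominus> x)) \<longlonglongrightarrow> 0"
proof -
  have 1: "\<nu> (f (n + k) \<ominus> f n) \<le> c (n + k) - c n" for n k
  proof (induction k)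
    case 0 thus ?case using f by simp
  next
    case (Suc k)
    have "\<nu> (f (n + Suc k) \<ominus> f n) \<le> \<nu> (f (Suc (n + k)) \<ominus> f (n + k)) + \<nu> (f (n + k) \<ominus> f n)"
      using norm_diff_triangle f by simp
    thus ?case using Suc d[of "n + k"] by simp
  qed
  have 2: "\<nu> (f m \<ominus> f n) \<le> \<bar>c m - c n\<bar>" for m n
  proof (cases "n \<le> m")
    case True thus ?thesis using 1[of n "m - n"] by simp
  next
    case False thus ?thesis using 1[of m "n - m"] norm_minus_commute[OF f f, of m n] by simp
  qed
  have "\<forall>\<epsilon>>0. \<exists>N. \<forall>m\<ge>N. \<forall>n\<ge>N. \<nu> (f m \<ominus> f n) < \<epsilon>"
  proof (intro allI impI)
    fix \<epsilon> :: real assume "\<epsilon> > 0"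
    then obtain N where "\<forall>m\<ge>N. \<forall>n\<ge>N. \<bar>c m - c n\<bar> < \<epsilon>"
      using convergent_Cauchy[OF c] by (auto simp: Cauchy_def dist_real_def)
    thus "\<exists>N. \<forall>m\<ge>N. \<forall>n\<ge>N. \<nu> (f m \<ominus> f n) < \<epsilon>" using 2 le_less_trans by blast
  qed
  thus ?thesis using norm_complete f that by blast
qed

lemma norm_mul_diff:
  assumes "x \<in> \<C>" "y \<in> \<C>" "x' \<in> \<C>" "y' \<in> \<C>"
  shows "\<nu> (x \<otimes> y \<ominus> x' \<otimes> y') \<le> \<nu> x * \<nu> (y \<ominus> y') + \<nu> (x \<ominus> x') * \<nu> y'"
proof -
  have "x \<otimes> y \<ominus> x' \<otimes> y' = x \<otimes> (y \<ominus> y') \<oplus> (x \<ominus> x') \<otimes> y'"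
    using assms by (intro tr_eqI) (simp_all add: alg)
  thus ?thesis using assms norm_laws(1)[of "x \<otimes> (y \<ominus> y')" "(x \<ominus> x') \<otimes> y'"]
      norm_laws(2)[of x "y \<ominus> y'"] norm_laws(2)[of "x \<ominus> x'" y'] by simp
qed

text \<open>Both facts follow from norm continuity of the operations and uniqueness of limits. They
  carry self-adjointness and commutation from the iterates of an iteration to its limit.\<close>

lemma norm_limit_star_commute:
  assumes f: "\<And>n. f n \<in> \<C>" and y: "y \<in> \<C>" and lim: "(\<lambda>n. \<nu> (f n \<ominus> y)) \<longlonglongrightarrow> 0"
  shows "(\<And>n. (f n)\<^sup>\<star> = f n) \<Longrightarrow> y\<^sup>\<star> = y"
    and "w \<in> \<C> \<Longrightarrow> (\<And>n. w \<otimes> f n = f n \<otimes> w) \<Longrightarrow> w \<otimes> y = y \<otimes> w"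
proof -
  assume sa: "\<And>n. (f n)\<^sup>\<star> = f n"
  have "\<nu> (f n \<ominus> y\<^sup>\<star>) = \<nu> (f n \<ominus> y)" for n
    using norm_star[of "f n \<ominus> y"] f y sa by (simp add: star_laws)
  thus "y\<^sup>\<star> = y" using norm_limit_unique[of "y\<^sup>\<star>" y f] f y lim by simp
next
  assume w: "w \<in> \<C>" and c: "\<And>n. w \<otimes> f n = f n \<otimes> w"
  have "(\<lambda>n. \<nu> (w \<otimes> f n \<ominus> w \<otimes> y)) \<longlonglongrightarrow> 0"
  proof (rule tendsto_sandwich[OF _ _ tendsto_const])
    show "(\<lambda>n. \<nu> w * \<nu> (f n \<ominus> y)) \<longlonglongrightarrow> 0" using lim by (rule tendsto_mult_right_zero)
    show "\<forall>\<^sub>F n in sequentially. \<nu> (w \<otimes> f n \<ominus> w \<otimes> y) \<le> \<nu> w * \<nu> (f n \<ominus> y)"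
      using norm_laws(2)[OF w, of "f _ \<ominus> y"] f y w by (simp add: mul_laws)
  qed (use f y w in simp)
  moreover have "(\<lambda>n. \<nu> (f n \<otimes> w \<ominus> y \<otimes> w)) \<longlonglongrightarrow> 0"
  proof (rule tendsto_sandwich[OF _ _ tendsto_const])
    show "(\<lambda>n. \<nu> (f n \<ominus> y) * \<nu> w) \<longlonglongrightarrow> 0" using lim by (rule tendsto_mult_left_zero)
    show "\<forall>\<^sub>F n in sequentially. \<nu> (f n \<otimes> w \<ominus> y \<otimes> w) \<le> \<nu> (f n \<ominus> y) * \<nu> w"
      using norm_laws(2)[of "f _ \<ominus> y" w] f y w by (simp add: mul_laws)
  qed (use f y w in simp)
  ultimately show "w \<otimes> y = y \<otimes> w"
    using norm_limit_unique[of "w \<otimes> y" "y \<otimes> w" "\<lambda>n. w \<otimes> f n"] f y w c by simp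
qed

primrec sqrt_iter :: "'a \<Rightarrow> nat \<Rightarrow> 'a" where
  "sqrt_iter k 0 = \<zero>"
| "sqrt_iter k (Suc n) = (1/2) \<odot> (k \<oplus> sqrt_iter k n \<otimes> sqrt_iter k n)"

text \<open>The iteration \<open>y \<mapsto> (k + y\<^sup>2) / 2\<close> converges to \<open>1 - sqrt (1 - k)\<close>; it is dominated
  by the scalar iteration for \<open>k = 1\<close>.\<close>
lemma sqrt_one_minus:
  assumes k: "k \<in> \<C>" "k\<^sup>\<star> = k" "\<nu> k \<le> 1"
  obtains s where "s \<in> \<C>" "s\<^sup>\<star> = s" "s \<otimes> s = \<one> \<ominus> k" "\<nu> (\<one> \<ominus> s) \<le> 1"
    "\<And>w. w \<in> \<C> \<Longrightarrow> w \<otimes> k = k \<otimes> w \<Longrightarrow> w \<otimes> s = s \<otimes> w"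
proof -
  define y where "y = sqrt_iter k"
  define c where "c = rec_nat (0::real) (\<lambda>_ r. (1 + r\<^sup>2) / 2)"
  have y_rec: "y 0 = \<zero>" "y (Suc n) = (1/2) \<odot> (k \<oplus> y n \<otimes> y n)" for n by (simp_all add: y_def)
  have c_rec: "c 0 = 0" "c (Suc n) = (1 + (c n)\<^sup>2) / 2" for n by (simp_all add: c_def)
  have y: "y n \<in> \<C>" for n by (induction n) (use k in \<open>simp_all add: y_rec\<close>)
  have c01: "0 \<le> c n \<and> c n \<le> 1" for n
    by (induction n) (simp_all add: c_rec power_le_one)
  have c_mono: "c n \<le> c (Suc n)" for n
    using sum_squares_bound[of "c n" 1] by (simp add: c_rec)
  have yn: "\<nu> (y n) \<le> c n" for n
  proof (induction n)
    case (Suc n)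
    have "\<nu> (y (Suc n)) \<le> (1/2) * (\<nu> k + \<nu> (y n \<otimes> y n))"
      using norm_laws(1)[of k "y n \<otimes> y n"] k y by (simp add: y_rec norm_laws(3))
    also have "\<nu> (y n \<otimes> y n) \<le> \<nu> (y n) * \<nu> (y n)" using y by (simp add: norm_laws(2))
    also have "\<dots> \<le> c n * c n" using Suc y c01 by (intro mult_mono) auto
    finally show ?case using k by (simp add: c_rec power2_eq_square)
  qed (simp add: y_rec c_rec)
  have d: "\<nu> (y (Suc n) \<ominus> y n) \<le> c (Suc n) - c n" for n
  proof (induction n)
    case 0
    have "y (Suc 0) \<ominus> y 0 = (1/2) \<odot> k" using k y by (intro tr_eqI) (simp_all add: y_rec alg)
    thus ?case using k by (simp add: norm_laws c_rec)
  next
    case (Suc n)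
    let ?u = "y (Suc n)" and ?v = "y n"
    \<comment> \<open>The recursion is unfolded by exactly one level on each side; otherwise the
      factor \<open>y (Suc n)\<close> in the square would be expanded as well.\<close>
    have "y (Suc (Suc n)) \<ominus> y (Suc n) = (1/2) \<odot> (?u \<otimes> ?u \<ominus> ?v \<otimes> ?v)"
      unfolding arg_cong2[OF y_rec(2)[of "Suc n"] y_rec(2)[of n], of "tsub P"] using k y
      by (intro tr_eqI) (simp_all add: alg)
    hence "\<nu> (y (Suc (Suc n)) \<ominus> y (Suc n)) = (1/2) * \<nu> (?u \<otimes> ?u \<ominus> ?v \<otimes> ?v)"
      using y by (simp add: norm_laws(3))
    also have "\<dots> \<le> (1/2) * (\<nu> ?u * \<nu> (?u \<ominus> ?v) + \<nu> (?u \<ominus> ?v) * \<nu> ?v)"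
      using norm_mul_diff[of ?u ?u ?v ?v] y by simp
    also have "\<dots> \<le> (1/2) * (c (Suc n) * (c (Suc n) - c n) + (c (Suc n) - c n) * c n)"
      using Suc yn[of n] yn[of "Suc n"] y c01[of n] c01[of "Suc n"] c_mono[of n]
      by (intro mult_left_mono add_mono mult_mono) auto
    also have "\<dots> = ((c (Suc n))\<^sup>2 - (c n)\<^sup>2) / 2" by (simp add: field_simps power2_eq_square)
    also have "\<dots> = c (Suc (Suc n)) - c (Suc n)"
      unfolding arg_cong2[OF c_rec(2)[of "Suc n"] c_rec(2)[of n], of minus] by (simp add: field_simps)
    finally show ?case .
  qed
  have "convergent c"
    using c01 c_mono by (intro Bseq_mono_convergent BseqI'[of _ 1]) (auto simp: incseq_SucI incseqD)
  then obtain l where l: "l \<in> \<C>" "(\<lambda>n. \<nu> (y n \<ominus> l)) \<longlonglongrightarrow> 0"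
    using convergent_if_dominated[of y c, OF y d] by blast
  have nl: "\<nu> l \<le> 1"
  proof (rule tendsto_lowerbound[where F = sequentially])
    show "(\<lambda>n. 1 + \<nu> (y n \<ominus> l)) \<longlonglongrightarrow> 1" using tendsto_add[OF tendsto_const l(2), of 1] by simp
    have "\<nu> l \<le> 1 + \<nu> (y n \<ominus> l)" for n
    proof -
      have "l = y n \<oplus> (l \<ominus> y n)" using l y by (intro tr_eqI) (simp_all add: alg)
      hence "\<nu> l \<le> \<nu> (y n) + \<nu> (l \<ominus> y n)" using norm_laws(1)[of "y n" "l \<ominus> y n"] l y by simp
      thus ?thesis using yn[of n] c01[of n] norm_minus_commute[of l "y n"] l y by simp
    qed
    thus "\<forall>\<^sub>F n in sequentially. \<nu> l \<le> 1 + \<nu> (y n \<ominus> l)" by simp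
  qed simp
  \<comment> \<open>The iteration map is 1-Lipschitz on the unit ball, so the shifted sequence tends
    both to \<open>l\<close> and to the image of \<open>l\<close>. The fixed point equation says
    that the square of \<open>l\<close> is \<open>2 l - k\<close>, hence \<open>1 - l\<close>
    squares to \<open>1 - k\<close>.\<close>
  have fix_l: "l = (1/2) \<odot> (k \<oplus> l \<otimes> l)"
  proof (rule norm_limit_unique[of _ _ "\<lambda>n. y (Suc n)"])
    show "(\<lambda>n. \<nu> (y (Suc n) \<ominus> l)) \<longlonglongrightarrow> 0" using l(2) by (rule LIMSEQ_Suc)
    show "(\<lambda>n. \<nu> (y (Suc n) \<ominus> (1/2) \<odot> (k \<oplus> l \<otimes> l))) \<longlonglongrightarrow> 0"
    proof (rule tendsto_sandwich[OF _ _ tendsto_const l(2)])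
      have "\<nu> (y (Suc n) \<ominus> (1/2) \<odot> (k \<oplus> l \<otimes> l)) \<le> \<nu> (y n \<ominus> l)" for n
      proof -
        have "y (Suc n) \<ominus> (1/2) \<odot> (k \<oplus> l \<otimes> l) = (1/2) \<odot> (y n \<otimes> y n \<ominus> l \<otimes> l)"
          unfolding y_rec using k y l by (intro tr_eqI) (simp_all add: alg)
        hence "\<nu> (y (Suc n) \<ominus> (1/2) \<odot> (k \<oplus> l \<otimes> l)) = (1/2) * \<nu> (y n \<otimes> y n \<ominus> l \<otimes> l)"
          using y l by (simp add: norm_laws(3))
        also have "\<dots> \<le> (1/2) * (\<nu> (y n) * \<nu> (y n \<ominus> l) + \<nu> (y n \<ominus> l) * \<nu> l)"
          using norm_mul_diff[of "y n" "y n" l l] y l by simp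
        also have "\<dots> \<le> (1/2) * (1 * \<nu> (y n \<ominus> l) + \<nu> (y n \<ominus> l) * 1)"
          using yn[of n] c01[of n] nl y l by (intro mult_left_mono add_mono mult_right_mono) auto
        finally show ?thesis by simp
      qed
      thus "\<forall>\<^sub>F n in sequentially. \<nu> (y (Suc n) \<ominus> (1/2) \<odot> (k \<oplus> l \<otimes> l)) \<le> \<nu> (y n \<ominus> l)" by simp
    qed (use k y l in simp)
  qed (use k y l in simp_all)
  have "l\<^sup>\<star> = l"
  proof (rule norm_limit_star_commute(1)[OF y l])
    show "(y n)\<^sup>\<star> = y n" for n by (induction n) (use k y in \<open>simp_all add: y_rec star_laws\<close>)
  qed
  moreover have "w \<otimes> l = l \<otimes> w" if w: "w \<in> \<C>" "w \<otimes> k = k \<otimes> w" for w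
  proof (rule norm_limit_star_commute(2)[OF y l w(1)])
    show "w \<otimes> y n = y n \<otimes> w" for n
    proof (induction n)
      case (Suc n)
      have "w \<otimes> (y n \<otimes> y n) = (y n \<otimes> y n) \<otimes> w" using Suc y w by (metis mul_laws(1))
      thus ?case using w k y by (simp add: y_rec mul_laws)
    qed (use w in \<open>simp add: y_rec\<close>)
  qed
  moreover have "(\<one> \<ominus> l) \<otimes> (\<one> \<ominus> l) = \<one> \<ominus> k"
  proof -
    have ll: "\<tau> (w \<otimes> (l \<otimes> l)) = 2 * \<tau> (w \<otimes> l) - \<tau> (w \<otimes> k)" if "w \<in> \<C>" for w
      using arg_cong[OF fix_l, of "\<lambda>x. \<tau> (w \<otimes> x)"] that l k by (simp add: alg)
    show ?thesis using l k by (intro tr_eqI) (simp_all add: ll alg)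
  qed
  moreover have "\<one> \<ominus> (\<one> \<ominus> l) = l" using l by (intro tr_eqI) (simp_all add: alg)
  ultimately show ?thesis using that[of "\<one> \<ominus> l"] l nl by (simp add: star_laws mul_laws)
qed

text \<open>After scaling, \<open>k\<close> has norm at most 1, so \<open>1 - k\<close> is the
  square of a self-adjoint \<open>s\<close>. The squared 2-norm of \<open>s y\<close> is
  nonnegative, and it is the difference of the two sides, squared and scaled.\<close>

lemma n2_mul_left:
  assumes x: "x \<in> \<C>" and y: "y \<in> \<C>"
  shows "\<rho> (x \<otimes> y) \<le> \<nu> x * \<rho> y"
proof (cases "\<nu> x = 0")
  case True
  thus ?thesis using x y by (simp add: norm_zero_iff)
next
  case False
  define r where "r = \<nu> x"
  have r: "r > 0" using False norm_nonneg[OF x] unfolding r_def by linarith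
  define k where "k = of_real (1 / r\<^sup>2) \<odot> (x\<^sup>\<star> \<otimes> x)"
  have k: "k \<in> \<C>" "k\<^sup>\<star> = k" using x by (simp_all add: k_def star_laws)
  have "\<nu> k \<le> 1" using x r norm_cstar[OF x] by (simp add: k_def norm_laws r_def norm_divide norm_power)
  then obtain s where s: "s \<in> \<C>" "s\<^sup>\<star> = s" "s \<otimes> s = \<one> \<ominus> k"
    using sqrt_one_minus[OF k] by metis
  have "0 \<le> Re (\<tau> ((s \<otimes> y)\<^sup>\<star> \<otimes> (s \<otimes> y)))" using s y by (simp add: tr_pos)
  also have "(s \<otimes> y)\<^sup>\<star> \<otimes> (s \<otimes> y) = y\<^sup>\<star> \<otimes> (s \<otimes> s) \<otimes> y" using s(1,2) y by (simp add: star_laws mul_laws)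
  also have "\<tau> \<dots> = \<tau> (y\<^sup>\<star> \<otimes> y) - of_real (1 / r\<^sup>2) * \<tau> ((x \<otimes> y)\<^sup>\<star> \<otimes> (x \<otimes> y))"
    unfolding s(3) using x y by (simp add: k_def alg)
  also have "Re \<dots> = (\<rho> y)\<^sup>2 - (1 / r\<^sup>2) * (\<rho> (x \<otimes> y))\<^sup>2" using x y by (simp add: n2_sq Re_divide_of_real)
  finally have "(\<rho> (x \<otimes> y))\<^sup>2 \<le> (r * \<rho> y)\<^sup>2" using r by (simp add: field_simps power_mult_distrib)
  thus ?thesis unfolding r_def by (rule power2_le_imp_le) (use x y in simp)
qed

lemma n2_mul_right:
  assumes x: "x \<in> \<C>" and y: "y \<in> \<C>"
  shows "\<rho> (x \<otimes> y) \<le> \<rho> x * \<nu> y"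
  using n2_mul_left[of "y\<^sup>\<star>" "x\<^sup>\<star>"] x y n2_star[of "x \<otimes> y"]
  by (simp add: star_laws norm_star n2_star mult.commute)

lemma n2_le_norm: "x \<in> \<C> \<Longrightarrow> \<rho> x \<le> \<nu> x"
  using n2_mul_left[of x "\<one>"] by (simp add: n2_def tr_one)

lemma cmod_tr_le_n2: "x \<in> \<C> \<Longrightarrow> cmod (\<tau> x) \<le> \<rho> x"
  using Cauchy_Schwarz[of "\<one>" x] by (simp add: n2_def tr_one)

text \<open>The triangle inequality would only give 2. Writing \<open>s\<close> for the square root
  of \<open>1 - a a\<close>, the element \<open>u = a + i s\<close> is unitary, and
  \<open>4 (1 - a a)\<close> equals \<open>2\<close> minus the sum of the squares of
  \<open>u\<close> and its adjoint; the norm of that is at most 4. This makes \<open>1 - a a\<close>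
  admissible for \<open>sqrt_one_minus\<close>.\<close>

lemma norm_one_minus_square:
  assumes a: "a \<in> \<C>" "a\<^sup>\<star> = a" "\<nu> a \<le> 1"
  shows "\<nu> (\<one> \<ominus> a \<otimes> a) \<le> 1"
proof -
  have aa: "\<nu> (a \<otimes> a) \<le> 1" using norm_cstar[OF a(1)] a by (simp add: power_le_one)
  have aC: "a \<otimes> a \<in> \<C>" and aS: "(a \<otimes> a)\<^sup>\<star> = a \<otimes> a" using a by (simp_all add: star_laws)
  obtain s where s: "s \<in> \<C>" "s\<^sup>\<star> = s" "s \<otimes> s = \<one> \<ominus> a \<otimes> a"
    and comm: "\<And>w. w \<in> \<C> \<Longrightarrow> w \<otimes> (a \<otimes> a) = (a \<otimes> a) \<otimes> w \<Longrightarrow> w \<otimes> s = s \<otimes> w"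
    using sqrt_one_minus[OF aC aS aa] by blast
  have as: "a \<otimes> s = s \<otimes> a" using comm[of a] a by (simp add: mul_laws)
  have ss: "\<tau> (w \<otimes> s \<otimes> s) = \<tau> w - \<tau> (w \<otimes> a \<otimes> a)" if "w \<in> \<C>" for w
    using that a s by (simp add: alg)
  define u where "u = a \<oplus> \<i> \<odot> s"
  have u: "u \<in> \<C>" using a s by (simp add: u_def)
  have uu: "u\<^sup>\<star> \<otimes> u = \<one>"
    using a s unfolding u_def by (intro tr_eqI) (simp_all add: alg as ss)
  have nu: "\<nu> u = 1"
    using norm_cstar[OF u] norm_nonneg[OF u] unfolding uu by (simp add: power2_eq_1_iff)
  have "4 \<odot> (\<one> \<ominus> a \<otimes> a) = 2 \<odot> \<one> \<ominus> (u \<otimes> u \<oplus> u\<^sup>\<star> \<otimes> u\<^sup>\<star>)"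
    using a s unfolding u_def by (intro tr_eqI) (simp_all add: alg as ss)
  moreover have "\<nu> (2 \<odot> \<one> \<ominus> (u \<otimes> u \<oplus> u\<^sup>\<star> \<otimes> u\<^sup>\<star>)) \<le> 2 + (1 + 1)"
  proof -
    have "\<nu> (2 \<odot> \<one> \<ominus> (u \<otimes> u \<oplus> u\<^sup>\<star> \<otimes> u\<^sup>\<star>)) \<le> \<nu> (2 \<odot> \<one>) + \<nu> (u \<otimes> u \<oplus> u\<^sup>\<star> \<otimes> u\<^sup>\<star>)"
      using u by (intro norm_laws(4)) simp_all
    also have "\<nu> (u \<otimes> u \<oplus> u\<^sup>\<star> \<otimes> u\<^sup>\<star>) \<le> \<nu> (u \<otimes> u) + \<nu> (u\<^sup>\<star> \<otimes> u\<^sup>\<star>)" using u by (simp add: norm_laws)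
    also have "\<nu> (u \<otimes> u) \<le> 1" using norm_laws(2)[OF u u] nu by simp
    also have "\<nu> (u\<^sup>\<star> \<otimes> u\<^sup>\<star>) \<le> 1" using norm_laws(2)[of "u\<^sup>\<star>" "u\<^sup>\<star>"] u nu by (simp add: norm_star)
    finally show ?thesis by (simp add: norm_laws)
  qed
  ultimately have "\<nu> (4 \<odot> (\<one> \<ominus> a \<otimes> a)) \<le> 4" by simp
  thus ?thesis using a by (simp add: norm_laws)
qed

subsection \<open>Positive elements and truncation\<close>

text \<open>The simplifier keeps products nested to the right, where \<open>x \<otimes> y\<close> is
  visible only with a further factor behind it. This lemma and the next restate product rules in
  that form.\<close>

lemma mul_eq_left: "x \<otimes> y = z \<Longrightarrow> x \<in> \<C> \<Longrightarrow> y \<in> \<C> \<Longrightarrow> w \<in> \<C> \<Longrightarrow> x \<otimes> y \<otimes> w = z \<otimes> w"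
  using mul_laws(1)[of x y w] by simp

lemma commute_left:
  "x \<otimes> y = y \<otimes> x \<Longrightarrow> x \<in> \<C> \<Longrightarrow> y \<in> \<C> \<Longrightarrow> w \<in> \<C> \<Longrightarrow> x \<otimes> y \<otimes> w = y \<otimes> x \<otimes> w"
  using mul_laws(1)[of x y w] mul_laws(1)[of y x w] by simp

text \<open>The absolute value of the scaled element \<open>a'\<close> is the root of
  \<open>1 - k\<close> with \<open>k = 1 - a' a'\<close>, where \<open>norm_one_minus_square\<close>
  supplies the norm bound on \<open>k\<close>. Since \<open>sqrt_one_minus\<close> also gives norm
  at most 1 for \<open>1 - s\<close>, it applies a second time and yields a root of
  \<open>s\<close>. That root \<open>u\<close> certifies positivity of \<open>p\<close>.\<close>

lemma abs_exists:
  assumes a: "a \<in> \<C>" "a\<^sup>\<star> = a"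
  obtains p u where "p \<in> \<C>" "p\<^sup>\<star> = p" "p \<otimes> p = a \<otimes> a" "u \<in> \<C>" "u\<^sup>\<star> = u" "u \<otimes> u = p"
    "\<And>v. v \<in> \<C> \<Longrightarrow> v \<otimes> a = a \<otimes> v \<Longrightarrow> v \<otimes> p = p \<otimes> v"
    "\<And>v. v \<in> \<C> \<Longrightarrow> v \<otimes> a = a \<otimes> v \<Longrightarrow> v \<otimes> u = u \<otimes> v"
proof -
  \<comment> \<open>The summand 1 keeps the scaling factor invertible for
    \<open>a = 0\<close>.\<close>
  define r where "r = \<nu> a + 1"
  have r: "r > 0" using norm_nonneg[OF a(1)] unfolding r_def by linarith
  define a' where "a' = of_real (1/r) \<odot> a"
  have a': "a' \<in> \<C>" "a'\<^sup>\<star> = a'" using a by (simp_all add: a'_def star_laws)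
  have "\<nu> a' = \<nu> a / r" using a r by (simp add: a'_def norm_laws norm_divide)
  also have "\<dots> \<le> 1" using norm_nonneg[OF a(1)] by (simp add: r_def)
  finally have na': "\<nu> a' \<le> 1" .
  define k where "k = \<one> \<ominus> a' \<otimes> a'"
  have k: "k \<in> \<C>" "k\<^sup>\<star> = k" "\<nu> k \<le> 1"
    using a' norm_one_minus_square[OF a' na'] by (simp_all add: k_def star_laws)
  obtain s where s: "s \<in> \<C>" "s\<^sup>\<star> = s" "s \<otimes> s = \<one> \<ominus> k" "\<nu> (\<one> \<ominus> s) \<le> 1"
    and s_comm: "\<And>w. w \<in> \<C> \<Longrightarrow> w \<otimes> k = k \<otimes> w \<Longrightarrow> w \<otimes> s = s \<otimes> w"
    by (rule sqrt_one_minus[OF k]) (rule that; assumption)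
  have k': "\<one> \<ominus> s \<in> \<C>" "(\<one> \<ominus> s)\<^sup>\<star> = \<one> \<ominus> s" using s by (simp_all add: star_laws)
  obtain w where w: "w \<in> \<C>" "w\<^sup>\<star> = w" "w \<otimes> w = \<one> \<ominus> (\<one> \<ominus> s)"
    and w_comm: "\<And>v. v \<in> \<C> \<Longrightarrow> v \<otimes> (\<one> \<ominus> s) = (\<one> \<ominus> s) \<otimes> v \<Longrightarrow> v \<otimes> w = w \<otimes> v"
    by (rule sqrt_one_minus[OF k' s(4)]) (rule that; assumption)
  have ww: "w \<otimes> w = s" unfolding w(3) using s(1) by (intro tr_eqI) (simp_all add: alg)
  have "\<one> \<ominus> k = a' \<otimes> a'" unfolding k_def using a' by (intro tr_eqI) (simp_all add: alg)
  hence ss: "s \<otimes> s = a' \<otimes> a'" using s(3) by simp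
  have cs: "v \<otimes> s = s \<otimes> v" if v: "v \<in> \<C>" "v \<otimes> a = a \<otimes> v" for v
  proof (rule s_comm[OF v(1)])
    have "v \<otimes> a' = a' \<otimes> v" using v a by (simp add: a'_def mul_laws)
    hence "v \<otimes> a' \<otimes> a' = (a' \<otimes> a') \<otimes> v" using v a' by (metis mul_laws(1))
    thus "v \<otimes> k = k \<otimes> v" using v a' by (simp add: k_def mul_laws)
  qed
  show ?thesis
  proof (rule that[of "of_real r \<odot> s" "of_real (sqrt r) \<odot> w"])
    have "(of_real r \<odot> s) \<otimes> (of_real r \<odot> s) = of_real (r * r) \<odot> (s \<otimes> s)"
      using s(1) by (simp add: mul_laws)
    also have "\<dots> = a \<otimes> a" unfolding ss a'_def using a r by (simp add: mul_laws)
    finally show "(of_real r \<odot> s) \<otimes> (of_real r \<odot> s) = a \<otimes> a" .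
    have "of_real (sqrt r) * of_real (sqrt r) = (of_real r :: complex)"
      using r by (simp flip: of_real_mult)
    thus "(of_real (sqrt r) \<odot> w) \<otimes> (of_real (sqrt r) \<odot> w) = of_real r \<odot> s"
      using s(1) w(1) ww by (simp add: mul_laws)
    fix v assume v: "v \<in> \<C>" "v \<otimes> a = a \<otimes> v"
    show "v \<otimes> (of_real r \<odot> s) = (of_real r \<odot> s) \<otimes> v" using cs[OF v] v s(1) by (simp add: mul_laws)
    have "v \<otimes> w = w \<otimes> v" using cs[OF v] v s(1) by (intro w_comm) (simp_all add: mul_laws)
    thus "v \<otimes> (of_real (sqrt r) \<odot> w) = (of_real (sqrt r) \<odot> w) \<otimes> v" using v w(1) by (simp add: mul_laws)
  qed (use s w in \<open>simp_all add: star_laws\<close>)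
qed

text \<open>The next two lemmas show that \<open>p\<close> equals its absolute value \<open>q\<close>, by killing the negative part
  \<open>n = (q - p) / 2\<close> with the faithful trace.\<close>
lemma abs_decomp:
  assumes p: "p \<in> \<C>" "p\<^sup>\<star> = p" and q: "q \<in> \<C>" "q\<^sup>\<star> = q" "q \<otimes> q = p \<otimes> p" "p \<otimes> q = q \<otimes> p"
  defines "n \<equiv> (1/2) \<odot> (q \<ominus> p)"
  shows "n \<in> \<C>" "n\<^sup>\<star> = n" "n \<otimes> q = n \<otimes> n" "n \<otimes> p = (-1) \<odot> (n \<otimes> n)" "q \<otimes> n = n \<otimes> q"
  unfolding n_def using p q(1,2)
  by (simp_all add: star_laws)
    (intro tr_eqI; simp add: alg q(3,4) mul_eq_left[OF q(3)] commute_left[OF q(4)])+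

lemma abs_eq_self:
  assumes p: "p \<in> \<C>" "p\<^sup>\<star> = p" and q: "q \<in> \<C>" "q\<^sup>\<star> = q" "q \<otimes> q = p \<otimes> p" "p \<otimes> q = q \<otimes> p"
    and u: "u \<in> \<C>" "u\<^sup>\<star> = u" "u \<otimes> u = q"
    and neg: "\<And>n. n = (1/2) \<odot> (q \<ominus> p) \<Longrightarrow> Re (\<tau> (n \<otimes> q \<otimes> n)) \<le> 0"
  shows "q = p"
proof -
  define n where "n = (1/2) \<odot> (q \<ominus> p)"
  note n = abs_decomp[OF p q, folded n_def]
  have "(u \<otimes> n)\<^sup>\<star> \<otimes> (u \<otimes> n) = n \<otimes> (u \<otimes> u) \<otimes> n"
    using u(1,2) n(1,2) by (simp add: star_laws mul_laws)
  hence "Re (\<tau> ((u \<otimes> n)\<^sup>\<star> \<otimes> (u \<otimes> n))) \<le> 0" using neg[OF n_def] u(3) by simp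
  \<comment> \<open>The trace of \<open>n q n\<close> is a squared 2-norm and at most 0, so
    faithfulness kills \<open>u n\<close>, hence \<open>q n\<close>, which is the square of
    \<open>n\<close>, hence \<open>n\<close>.\<close>
  hence "u \<otimes> n = \<zero>" using tr_faithful u n by simp
  hence "u \<otimes> u \<otimes> n = \<zero>" using u by simp
  hence "q \<otimes> n = \<zero>" using u n mul_laws(1)[of u u n] by simp
  hence "n\<^sup>\<star> \<otimes> n = \<zero>" using n by simp
  hence "n = \<zero>" using tr_faithful[OF n(1)] by simp
  hence "\<tau> (w \<otimes> n) = 0" if "w \<in> \<C>" for w using that by simp
  thus "q = p" using p q(1) unfolding n_def by (intro tr_eqI) (simp_all add: alg)
qed

text \<open>Positivity is assumed only for the quadratic form of the trace. With \<open>n\<close>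
  the negative part, \<open>n p = - n n\<close> and \<open>n q = n n\<close>, so the trace of
  \<open>n q n\<close> is minus that of \<open>n p n\<close> and therefore at most 0, as
  \<open>abs_eq_self\<close> asks.\<close>

lemma pos_sqrt:
  assumes p: "p \<in> \<C>" "p\<^sup>\<star> = p" and pos: "\<And>y. y \<in> \<C> \<Longrightarrow> 0 \<le> Re (\<tau> (y\<^sup>\<star> \<otimes> p \<otimes> y))"
  obtains u where "u \<in> \<C>" "u\<^sup>\<star> = u" "u \<otimes> u = p" "\<And>v. v \<in> \<C> \<Longrightarrow> v \<otimes> p = p \<otimes> v \<Longrightarrow> v \<otimes> u = u \<otimes> v"
proof -
  obtain q u where q: "q \<in> \<C>" "q\<^sup>\<star> = q" "q \<otimes> q = p \<otimes> p" and u: "u \<in> \<C>" "u\<^sup>\<star> = u" "u \<otimes> u = q"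
    and comm: "\<And>v. v \<in> \<C> \<Longrightarrow> v \<otimes> p = p \<otimes> v \<Longrightarrow> v \<otimes> q = q \<otimes> v"
      "\<And>v. v \<in> \<C> \<Longrightarrow> v \<otimes> p = p \<otimes> v \<Longrightarrow> v \<otimes> u = u \<otimes> v"
    by (rule abs_exists[OF p]) (rule that; assumption)
  have pq: "p \<otimes> q = q \<otimes> p" using comm(1)[OF p(1)] by simp
  have "q = p"
  proof (rule abs_eq_self[OF p q pq u])
    fix n assume n_def: "n = (1/2) \<odot> (q \<ominus> p)"
    note n = abs_decomp[OF p q pq, folded n_def]
    have "n \<otimes> p \<otimes> n = (n \<otimes> p) \<otimes> n" "n \<otimes> q \<otimes> n = (n \<otimes> q) \<otimes> n" using n(1) p q(1) by (simp_all add: mul_laws)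
    hence "\<tau> (n \<otimes> p \<otimes> n) = - \<tau> (n \<otimes> q \<otimes> n)" unfolding n(3,4) using n(1) by (simp add: mul_laws tr_laws)
    thus "Re (\<tau> (n \<otimes> q \<otimes> n)) \<le> 0" using pos[OF n(1)] n(2) by simp
  qed
  thus ?thesis using that u comm by blast
qed

text \<open>Here \<open>b\<close> is the absolute value of \<open>a\<close>, and
  \<open>p = (b + a) / 2\<close> satisfies \<open>p b = p p\<close>. For the negative part
  \<open>n\<close> of \<open>p\<close> this makes the trace of \<open>n b n\<close> the negative of
  that of \<open>n q n\<close>. The root \<open>u\<close> of \<open>b\<close> shows the former to be
  nonnegative, so \<open>p\<close> is its own absolute value \<open>q\<close> and inherits the root
  \<open>w\<close>.\<close>

lemma pos_half:
  assumes a: "a \<in> \<C>" "a\<^sup>\<star> = a" and b: "b \<in> \<C>" "b\<^sup>\<star> = b" "b \<otimes> b = a \<otimes> a" "a \<otimes> b = b \<otimes> a"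
    and u: "u \<in> \<C>" "u\<^sup>\<star> = u" "u \<otimes> u = b"
  obtains v where "v \<in> \<C>" "v\<^sup>\<star> = v" "v \<otimes> v = (1/2) \<odot> (b \<oplus> a)"
proof -
  define p where "p = (1/2) \<odot> (b \<oplus> a)"
  have p: "p \<in> \<C>" "p\<^sup>\<star> = p" using a b by (simp_all add: p_def star_laws)
  have pb: "p \<otimes> b = p \<otimes> p" "b \<otimes> p = p \<otimes> b" unfolding p_def using a(1) b(1)
    by (intro tr_eqI; simp add: alg b(3,4))+
  obtain q w where q: "q \<in> \<C>" "q\<^sup>\<star> = q" "q \<otimes> q = p \<otimes> p" and w: "w \<in> \<C>" "w\<^sup>\<star> = w" "w \<otimes> w = q"
    and comm: "\<And>v. v \<in> \<C> \<Longrightarrow> v \<otimes> p = p \<otimes> v \<Longrightarrow> v \<otimes> q = q \<otimes> v"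
    by (rule abs_exists[OF p]) (rule that; assumption)
  have pq: "p \<otimes> q = q \<otimes> p" using comm[OF p(1)] by simp
  have bq: "b \<otimes> q = q \<otimes> b" using comm[OF b(1)] pb by simp
  have "q = p"
  proof (rule abs_eq_self[OF p q pq w])
    fix n assume n_def: "n = (1/2) \<odot> (q \<ominus> p)"
    note n = abs_decomp[OF p q pq, folded n_def]
    have nb: "n \<otimes> b = b \<otimes> n" unfolding n_def using p(1) q(1) b(1) bq pb(2) by (simp add: mul_laws)
    have "n \<otimes> b \<otimes> n = n \<otimes> n \<otimes> b" using nb by simp
    also have "\<dots> = (n \<otimes> n) \<otimes> b" using n(1) b(1) by (simp add: mul_laws)
    also have "n \<otimes> n = (-1) \<odot> (n \<otimes> p)" using n(1,4) by simp
    also have "\<dots> \<otimes> b = (-1) \<odot> (n \<otimes> p \<otimes> b)" using n(1) p b(1) by (simp add: mul_laws)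
    also have "n \<otimes> p \<otimes> b = (n \<otimes> p) \<otimes> p" using pb n(1) p by (simp add: mul_laws)
    also have "\<dots> = ((-1) \<odot> (n \<otimes> n)) \<otimes> p" by (simp only: n(4))
    also have "\<dots> = (-1) \<odot> (n \<otimes> n \<otimes> p)" using n(1) p by (simp add: mul_laws)
    also have "n \<otimes> n \<otimes> p = (-1) \<odot> (n \<otimes> n \<otimes> n)" using n(1,4) by (simp add: mul_laws)
    finally have 1: "\<tau> (n \<otimes> b \<otimes> n) = - \<tau> (n \<otimes> n \<otimes> n)" using n(1) by (simp add: tr_laws)
    have "n \<otimes> q \<otimes> n = (n \<otimes> q) \<otimes> n" using n(1) q(1) by (simp add: mul_laws)
    also have "\<dots> = n \<otimes> n \<otimes> n" unfolding n(3) using n(1) by (simp add: mul_laws)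
    finally have 2: "\<tau> (n \<otimes> q \<otimes> n) = - \<tau> (n \<otimes> b \<otimes> n)" using 1 by simp
    have "(u \<otimes> n)\<^sup>\<star> \<otimes> (u \<otimes> n) = n \<otimes> (u \<otimes> u) \<otimes> n"
      using u(1,2) n(1,2) by (simp add: star_laws mul_laws)
    hence "0 \<le> Re (\<tau> (n \<otimes> b \<otimes> n))" using tr_pos(1)[of "u \<otimes> n"] u n(1) by simp
    thus "Re (\<tau> (n \<otimes> q \<otimes> n)) \<le> 0" using 2 by simp
  qed
  thus ?thesis using that w unfolding p_def by simp
qed

text \<open>Jordan decomposition: \<open>p\<close> and \<open>q\<close> are half of the absolute
  value plus and minus \<open>a\<close>. Their product vanishes because \<open>a\<close> commutes
  with its absolute value, which has the same square. The roots \<open>v\<close> and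
  \<open>w\<close> record positivity.\<close>

lemma pos_neg_parts:
  assumes a: "a \<in> \<C>" "a\<^sup>\<star> = a"
  obtains p q v w where "p \<in> \<C>" "q \<in> \<C>" "v \<in> \<C>" "w \<in> \<C>" "v\<^sup>\<star> = v" "w\<^sup>\<star> = w"
    "v \<otimes> v = p" "w \<otimes> w = q" "a = p \<ominus> q" "p \<otimes> q = \<zero>"
proof -
  obtain b u where b: "b \<in> \<C>" "b\<^sup>\<star> = b" "b \<otimes> b = a \<otimes> a" and u: "u \<in> \<C>" "u\<^sup>\<star> = u" "u \<otimes> u = b"
    and comm: "\<And>v. v \<in> \<C> \<Longrightarrow> v \<otimes> a = a \<otimes> v \<Longrightarrow> v \<otimes> b = b \<otimes> v"
    by (rule abs_exists[OF a]) (rule that; assumption)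
  have ab: "a \<otimes> b = b \<otimes> a" using comm[OF a(1)] by simp
  let ?m = "(-1) \<odot> a"
  have m: "?m \<in> \<C>" "?m\<^sup>\<star> = ?m" "b \<otimes> b = ?m \<otimes> ?m" "?m \<otimes> b = b \<otimes> ?m"
    using a b ab by (simp_all add: star_laws mul_laws)
  obtain v where v: "v \<in> \<C>" "v\<^sup>\<star> = v" "v \<otimes> v = (1/2) \<odot> (b \<oplus> a)"
    by (rule pos_half[OF a b ab u]) (rule that; assumption)
  obtain w where w: "w \<in> \<C>" "w\<^sup>\<star> = w" "w \<otimes> w = (1/2) \<odot> (b \<oplus> ?m)"
    by (rule pos_half[OF m(1,2) b(1,2) m(3,4) u]) (rule that; assumption)
  show ?thesis
  proof (rule that[OF _ _ v(1) w(1) v(2) w(2) v(3) w(3)])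
    show "a = (1/2) \<odot> (b \<oplus> a) \<ominus> (1/2) \<odot> (b \<oplus> ?m)"
      using a(1) b(1) by (intro tr_eqI) (simp_all add: alg)
    show "(1/2) \<odot> (b \<oplus> a) \<otimes> (1/2) \<odot> (b \<oplus> ?m) = \<zero>"
      using a(1) b(1) by (intro tr_eqI) (simp_all add: alg ab b(3))
  qed (use a b in simp_all)
qed

text \<open>Converse of \<open>n2_mul_left\<close>. The bound makes \<open>r^2 - h\<close> positive,
  with root \<open>w\<close>; let \<open>g\<close> be the root of \<open>h\<close>. As
  \<open>w\<close> and \<open>g\<close> commute, \<open>u = g + i w\<close> has \<open>r^2\<close>
  as product with its adjoint, so its norm is \<open>r\<close>. Since \<open>2 g\<close> is
  \<open>u\<close> plus its adjoint, \<open>g\<close> has norm at most \<open>r\<close>, and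
  \<open>x\<close> and \<open>g\<close> have the same norm.\<close>

lemma norm_le_if_n2_bounded:
  assumes x: "x \<in> \<C>" and r: "r \<ge> 0" and bound: "\<And>y. y \<in> \<C> \<Longrightarrow> \<rho> (x \<otimes> y) \<le> r * \<rho> y"
  shows "\<nu> x \<le> r"
proof -
  define h where "h = x\<^sup>\<star> \<otimes> x"
  have h: "h \<in> \<C>" "h\<^sup>\<star> = h" using x by (simp_all add: h_def star_laws)
  have hy: "Re (\<tau> (y\<^sup>\<star> \<otimes> h \<otimes> y)) = (\<rho> (x \<otimes> y))\<^sup>2" if y: "y \<in> \<C>" for y
    using x y by (simp add: h_def n2_sq star_laws mul_laws)
  have h_pos: "0 \<le> Re (\<tau> (y\<^sup>\<star> \<otimes> h \<otimes> y))" if y: "y \<in> \<C>" for y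
    using hy[OF y] by simp
  obtain g where g: "g \<in> \<C>" "g\<^sup>\<star> = g" "g \<otimes> g = h"
    and g_comm: "\<And>v. v \<in> \<C> \<Longrightarrow> v \<otimes> h = h \<otimes> v \<Longrightarrow> v \<otimes> g = g \<otimes> v"
    by (rule pos_sqrt[OF h h_pos]) (assumption | rule that; assumption)+
  define p where "p = of_real (r\<^sup>2) \<odot> \<one> \<ominus> h"
  have p: "p \<in> \<C>" "p\<^sup>\<star> = p" using h by (simp_all add: p_def star_laws)
  have p_pos: "0 \<le> Re (\<tau> (y\<^sup>\<star> \<otimes> p \<otimes> y))" if y: "y \<in> \<C>" for y
  proof -
    have "\<tau> (y\<^sup>\<star> \<otimes> p \<otimes> y) = of_real (r\<^sup>2) * \<tau> (y\<^sup>\<star> \<otimes> y) - \<tau> (y\<^sup>\<star> \<otimes> h \<otimes> y)"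
      using y h by (simp add: p_def alg)
    hence "Re (\<tau> (y\<^sup>\<star> \<otimes> p \<otimes> y)) = (r * \<rho> y)\<^sup>2 - (\<rho> (x \<otimes> y))\<^sup>2"
      using y by (simp add: hy n2_sq power_mult_distrib)
    also have "\<dots> \<ge> 0" using power_mono[OF bound[OF y], of 2] x y by simp
    finally show ?thesis .
  qed
  obtain w where w: "w \<in> \<C>" "w\<^sup>\<star> = w" "w \<otimes> w = p"
    and w_comm: "\<And>v. v \<in> \<C> \<Longrightarrow> v \<otimes> p = p \<otimes> v \<Longrightarrow> v \<otimes> w = w \<otimes> v"
    by (rule pos_sqrt[OF p p_pos]) (assumption | rule that; assumption)+
  have "h \<otimes> w = w \<otimes> h" using h by (intro w_comm) (simp_all add: p_def mul_laws)
  hence wg: "w \<otimes> g = g \<otimes> w" using g_comm[OF w(1)] by simp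
  define u where "u = g \<oplus> \<i> \<odot> w"
  have u: "u \<in> \<C>" using g w by (simp add: u_def)
  have "u\<^sup>\<star> \<otimes> u = of_real (r\<^sup>2) \<odot> \<one>"
  proof -
    have gg: "\<tau> (x \<otimes> g \<otimes> g) = \<tau> (x \<otimes> h)" for x using g(3) by simp
    have ww: "\<tau> (x \<otimes> w \<otimes> w) = of_real (r\<^sup>2) * \<tau> x - \<tau> (x \<otimes> h)" if "x \<in> \<C>" for x
      unfolding w(3) p_def using that h by (simp add: alg)
    show ?thesis unfolding u_def using g(1,2) w(1,2) h(1)
      by (intro tr_eqI) (simp_all add: alg wg gg ww)
  qed
  hence "(\<nu> u)\<^sup>2 = r\<^sup>2" using norm_cstar[OF u] by (simp add: norm_laws norm_power)
  hence nu: "\<nu> u = r" using r u by (simp add: power2_eq_iff_nonneg)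
  have "2 \<odot> g = u \<oplus> u\<^sup>\<star>" unfolding u_def using g(1,2) w(1,2) by (intro tr_eqI) (simp_all add: alg)
  hence "\<nu> (2 \<odot> g) \<le> \<nu> u + \<nu> (u\<^sup>\<star>)" using norm_laws(1)[of u "u\<^sup>\<star>"] u by simp
  hence ng: "\<nu> g \<le> r" using g(1) u nu by (simp add: norm_laws norm_star)
  have "(\<nu> x)\<^sup>2 = (\<nu> g)\<^sup>2" using norm_cstar[OF x] norm_cstar[OF g(1)] g h_def by simp
  thus ?thesis using ng x g(1) by (simp add: power2_eq_iff_nonneg)
qed

text \<open>With \<open>1 + p = (1 + B) (1 - q)\<close> the inverse comes from the Neumann series of
  \<open>q\<close>. The norm of \<open>q\<close> is below 1 because \<open>q\<close> is
  \<open>B / (1 + B)\<close> times \<open>1 - a a\<close> for the contraction \<open>a\<close>, the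
  element \<open>v\<close> divided by the root of \<open>B\<close>.\<close>

lemma inverse_one_plus_square:
  assumes v: "v \<in> \<C>" "v\<^sup>\<star> = v" and p: "p = v \<otimes> v"
  obtains c where "c \<in> \<C>" "c\<^sup>\<star> = c" "(\<one> \<oplus> p) \<otimes> c = \<one>" "c \<otimes> (\<one> \<oplus> p) = \<one>"
proof -
  \<comment> \<open>The summand 1 makes \<open>B\<close> positive; the rest makes \<open>v\<close>
    divided by the root of \<open>B\<close> a contraction.\<close>
  define B where "B = (\<nu> v)\<^sup>2 + 1"
  have B: "B \<ge> 1" by (simp add: B_def)
  have pC: "p \<in> \<C>" "p\<^sup>\<star> = p" using v by (simp_all add: p star_laws)
  define q where "q = \<one> \<ominus> of_real (1 / (1 + B)) \<odot> (\<one> \<oplus> p)"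
  have q: "q \<in> \<C>" using pC by (simp add: q_def)
  have nq: "\<nu> q \<le> B / (1 + B)"
  proof -
    define a where "a = of_real (1 / sqrt B) \<odot> v"
    have a: "a \<in> \<C>" "a\<^sup>\<star> = a" using v by (simp_all add: a_def star_laws)
    have "\<nu> a = \<nu> v / sqrt B" using v B by (simp add: a_def norm_laws norm_divide)
    also have "\<nu> v \<le> sqrt B" by (rule real_le_rsqrt) (simp add: B_def)
    hence "\<nu> v / sqrt B \<le> 1" using B by simp
    finally have "\<nu> (\<one> \<ominus> a \<otimes> a) \<le> 1" using norm_one_minus_square[OF a] by simp
    moreover have "q = of_real (B / (1 + B)) \<odot> (\<one> \<ominus> a \<otimes> a)"
    proof -
      have e: "of_real (sqrt B) * of_real (sqrt B) = (of_real B :: complex)"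
        using B by (simp flip: of_real_mult)
      have aa: "a \<otimes> a = of_real (1 / B) \<odot> p"
        using v B by (simp add: a_def p mul_laws e flip: of_real_mult)
      have f: "(1::complex) - of_real (1 / (1 + B)) = of_real (B / (1 + B))"
      proof -
        have "1 - 1 / (1 + B) = B / (1 + B)" using B by (simp add: field_simps)
        hence "complex_of_real (1 - 1 / (1 + B)) = of_real (B / (1 + B))" by (rule arg_cong)
        thus ?thesis by (simp only: of_real_diff of_real_1)
      qed
      have g: "of_real (B / (1 + B)) * of_real (1 / B) = (of_real (1 / (1 + B)) :: complex)"
        using B unfolding of_real_mult[symmetric] by simp
      have *: "\<beta> \<odot> \<one> \<ominus> (\<beta> * \<delta>) \<odot> p = \<beta> \<odot> (\<one> \<ominus> \<delta> \<odot> p)" for \<beta> \<delta>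
        using pC by (intro tr_eqI) (simp_all add: alg)
      have "q = of_real (B / (1 + B)) \<odot> \<one> \<ominus> of_real (1 / (1 + B)) \<odot> p"
        unfolding f[symmetric] q_def using pC by (intro tr_eqI) (simp_all add: alg)
      also have "\<dots> = of_real (B / (1 + B)) \<odot> (\<one> \<ominus> of_real (1 / B) \<odot> p)"
        unfolding g[symmetric] by (rule *)
      finally show ?thesis by (simp add: aa)
    qed
    moreover have "cmod (of_real (B / (1 + B))) = B / (1 + B)" using B by (simp only: norm_of_real) simp
    ultimately show ?thesis
      using norm_laws(3)[of "\<one> \<ominus> a \<otimes> a" "of_real (B / (1 + B))"] a(1) B
        mult_left_le[of "\<nu> (\<one> \<ominus> a \<otimes> a)" "B / (1 + B)"] by (simp only: closed) simp
  qed
  define \<theta> where "\<theta> = B / (1 + B)"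
  have \<theta>: "0 \<le> \<theta>" "\<theta> < 1" using B by (simp_all add: \<theta>_def)
  define y where "y = rec_nat \<zero> (\<lambda>_ x. \<one> \<oplus> q \<otimes> x)"
  have y_rec: "y 0 = \<zero>" "y (Suc n) = \<one> \<oplus> q \<otimes> y n" for n by (simp_all add: y_def)
  have y: "y n \<in> \<C>" for n by (induction n) (use q in \<open>simp_all add: y_rec\<close>)
  have d: "\<nu> (y (Suc n) \<ominus> y n) \<le> (\<Sum>i<Suc n. \<theta> ^ i) - (\<Sum>i<n. \<theta> ^ i)" for n
  proof (induction n)
    case 0
    have "y (Suc 0) \<ominus> y 0 = \<one>" using q by (intro tr_eqI) (simp_all add: y_rec alg)
    thus ?case by simp
  next
    case (Suc n)
    have "y (Suc (Suc n)) \<ominus> y (Suc n) = q \<otimes> (y (Suc n) \<ominus> y n)"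
      unfolding arg_cong2[OF y_rec(2)[of "Suc n"] y_rec(2)[of n], of "tsub P"] using q y
      by (intro tr_eqI) (simp_all add: alg)
    hence "\<nu> (y (Suc (Suc n)) \<ominus> y (Suc n)) \<le> \<nu> q * \<nu> (y (Suc n) \<ominus> y n)"
      using norm_laws(2)[of q "y (Suc n) \<ominus> y n"] q y by simp
    also have "\<dots> \<le> \<theta> * \<theta> ^ n"
      using Suc nq q y \<theta> by (intro mult_mono) (auto simp: \<theta>_def)
    finally show ?case by simp
  qed
  have "convergent (\<lambda>n. \<Sum>i<n. \<theta> ^ i)"
    using \<theta> by (intro summable_iff_convergent[THEN iffD1] summable_geometric) simp
  then obtain l where l: "l \<in> \<C>" "(\<lambda>n. \<nu> (y n \<ominus> l)) \<longlonglongrightarrow> 0"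
    using convergent_if_dominated[of y "\<lambda>n. \<Sum>i<n. \<theta> ^ i", OF y d] by blast
  have fix_l: "l = \<one> \<oplus> q \<otimes> l"
  proof (rule norm_limit_unique[of _ _ "\<lambda>n. y (Suc n)"])
    show "(\<lambda>n. \<nu> (y (Suc n) \<ominus> l)) \<longlonglongrightarrow> 0" using l(2) by (rule LIMSEQ_Suc)
    have *: "(\<lambda>n. \<nu> q * \<nu> (y n \<ominus> l)) \<longlonglongrightarrow> 0" using l(2) by (rule tendsto_mult_right_zero)
    show "(\<lambda>n. \<nu> (y (Suc n) \<ominus> (\<one> \<oplus> q \<otimes> l))) \<longlonglongrightarrow> 0"
    proof (rule tendsto_sandwich[OF _ _ tendsto_const *])
      have "y (Suc n) \<ominus> (\<one> \<oplus> q \<otimes> l) = q \<otimes> (y n \<ominus> l)" for n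
        unfolding y_rec using q y l by (intro tr_eqI) (simp_all add: alg)
      thus "\<forall>\<^sub>F n in sequentially. \<nu> (y (Suc n) \<ominus> (\<one> \<oplus> q \<otimes> l)) \<le> \<nu> q * \<nu> (y n \<ominus> l)"
        using norm_laws(2)[of q "y _ \<ominus> l"] q y l by simp
    qed (use q y l in simp)
  qed (use q y l in simp_all)
  define c where "c = of_real (1 / (1 + B)) \<odot> l"
  have c: "c \<in> \<C>" using l by (simp add: c_def)
  have "q \<otimes> l = l \<ominus> (\<one> \<oplus> p) \<otimes> c"
    unfolding q_def c_def using pC l by (intro tr_eqI) (simp_all add: alg)
  moreover have "\<tau> (w \<otimes> l) = \<tau> w + \<tau> (w \<otimes> q \<otimes> l)" if "w \<in> \<C>" for w
    using arg_cong[OF fix_l, of "\<lambda>x. \<tau> (w \<otimes> x)"] that l q by (simp add: alg)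
  ultimately have right: "(\<one> \<oplus> p) \<otimes> c = \<one>"
    using pC c l by (intro tr_eqI) (simp_all add: mul_laws(6) tr_laws)
  \<comment> \<open>Taking adjoints turns the right inverse into a left inverse; the two agree, so
    \<open>c\<close> is self-adjoint.\<close>
  have left: "c\<^sup>\<star> \<otimes> (\<one> \<oplus> p) = \<one>"
    using arg_cong[OF right, of "tstar P"] pC c by (simp add: star_laws)
  have "c\<^sup>\<star> = c\<^sup>\<star> \<otimes> (\<one> \<oplus> p) \<otimes> c" using right c by simp
  also have "\<dots> = (c\<^sup>\<star> \<otimes> (\<one> \<oplus> p)) \<otimes> c" using c pC by (intro mul_laws(1)[symmetric]) simp_all
  also have "\<dots> = c" using left c by simp
  finally show ?thesis using that c left right by simp
qed

text \<open>Cutting \<open>f\<close> down to norm \<open>r\<close>: multiply by \<open>(1 + p)\<^sup>-\<^sup>1\<close>, where \<open>p\<close> is the positive part of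
  \<open>f\<^sup>\<star> f / r\<^sup>2 - 1\<close>.\<close>
lemma truncation:
  assumes f: "f \<in> \<C>" and g: "g \<in> \<C>" "\<nu> g \<le> r\<^sup>2" and r: "r > 0"
  obtains h where "h \<in> \<C>" "\<nu> h \<le> r" "\<rho> (f \<ominus> h) \<le> \<nu> f / r\<^sup>2 * \<rho> (f\<^sup>\<star> \<otimes> f \<ominus> g)"
proof -
  define k where "k = of_real (1 / r\<^sup>2) \<odot> (f\<^sup>\<star> \<otimes> f)"
  define g' where "g' = of_real (1 / r\<^sup>2) \<odot> g"
  have k: "k \<in> \<C>" "k\<^sup>\<star> = k" using f by (simp_all add: k_def star_laws)
  have g': "g' \<in> \<C>" "\<nu> g' \<le> 1" using g r by (simp_all add: g'_def norm_laws norm_divide norm_power)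
  have kg: "\<rho> (k \<ominus> g') = \<rho> (f\<^sup>\<star> \<otimes> f \<ominus> g) / r\<^sup>2"
  proof -
    have "k \<ominus> g' = of_real (1 / r\<^sup>2) \<odot> (f\<^sup>\<star> \<otimes> f \<ominus> g)"
      unfolding k_def g'_def using f g by (intro tr_eqI) (simp_all add: alg)
    thus ?thesis using f g by (simp add: n2_smult norm_divide norm_power)
  qed
  have a: "k \<ominus> \<one> \<in> \<C>" "(k \<ominus> \<one>)\<^sup>\<star> = k \<ominus> \<one>" using k by (simp_all add: star_laws)
  obtain p q v w where p: "p \<in> \<C>" "q \<in> \<C>" and v: "v \<in> \<C>" "w \<in> \<C>" "v\<^sup>\<star> = v" "w\<^sup>\<star> = w"
    and vw: "v \<otimes> v = p" "w \<otimes> w = q" and pq: "k \<ominus> \<one> = p \<ominus> q" "p \<otimes> q = \<zero>"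
    by (rule pos_neg_parts[OF a]) (rule that; assumption)
  have ps: "p\<^sup>\<star> = p" using v star_laws(2)[of v v] vw by simp
  \<comment> \<open>As \<open>p q = 0\<close>, the square of \<open>p\<close> is
    \<open>p (k - 1)\<close>, which splits into \<open>p (k - g') + p (g' - 1)\<close>. The second
    part has nonpositive trace because \<open>g'\<close> is a contraction and \<open>p\<close> is
    the square of \<open>v\<close>, so Cauchy-Schwarz on the first part suffices.\<close>
  have np: "\<rho> p \<le> \<rho> (k \<ominus> g')"
  proof -
    have "(\<rho> p)\<^sup>2 = Re (\<tau> (p \<otimes> (p \<ominus> q)))" using p ps pq by (simp add: n2_sq mul_laws tr_laws)
    also have "p \<otimes> (p \<ominus> q) = p \<otimes> (k \<ominus> g') \<oplus> p \<otimes> (g' \<ominus> \<one>)"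
      unfolding pq(1)[symmetric] using p k g' by (intro tr_eqI) (simp_all add: alg)
    also have "Re (\<tau> \<dots>) = Re (\<tau> (p \<otimes> (k \<ominus> g'))) + Re (\<tau> (p \<otimes> (g' \<ominus> \<one>)))"
      using p k g' by (simp add: tr_laws)
    also have "Re (\<tau> (p \<otimes> (k \<ominus> g'))) \<le> \<rho> p * \<rho> (k \<ominus> g')"
      using Cauchy_Schwarz[of p "k \<ominus> g'"] ps p k g' complex_Re_le_cmod order_trans by fastforce
    also have "Re (\<tau> (p \<otimes> (g' \<ominus> \<one>))) \<le> 0"
    proof -
      have "\<tau> (p \<otimes> (g' \<ominus> \<one>)) = \<tau> (v \<otimes> v \<otimes> g') - \<tau> (v\<^sup>\<star> \<otimes> v)"
        unfolding vw(1)[symmetric] using v g' by (simp add: mul_laws tr_laws)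
      also have "\<tau> (v \<otimes> v \<otimes> g') = \<tau> (v\<^sup>\<star> \<otimes> g' \<otimes> v)"
        using tr_comm[of v "v \<otimes> g'"] v g' by (simp add: mul_laws)
      finally have "Re (\<tau> (p \<otimes> (g' \<ominus> \<one>))) = Re (\<tau> (v\<^sup>\<star> \<otimes> g' \<otimes> v)) - (\<rho> v)\<^sup>2"
        using v by (simp add: n2_sq)
      also have "Re (\<tau> (v\<^sup>\<star> \<otimes> g' \<otimes> v)) \<le> \<rho> v * \<rho> (g' \<otimes> v)"
        using Cauchy_Schwarz[of v "g' \<otimes> v"] v g' complex_Re_le_cmod order_trans by fastforce
      also have "\<rho> (g' \<otimes> v) \<le> 1 * \<rho> v"
        using n2_mul_left[of g' v] mult_right_mono[of "\<nu> g'" 1 "\<rho> v"] v g' by simp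
      finally show ?thesis using v mult_left_mono[of _ _ "\<rho> v"] by (simp add: power2_eq_square)
    qed
    finally have "\<rho> p * \<rho> p \<le> \<rho> p * \<rho> (k \<ominus> g')" by (simp add: power2_eq_square)
    thus ?thesis using p k g' by (cases "\<rho> p = 0") (simp_all add: mult_le_cancel_left less_le)
  qed
  obtain c where c: "c \<in> \<C>" "c\<^sup>\<star> = c" "(\<one> \<oplus> p) \<otimes> c = \<one>" "c \<otimes> (\<one> \<oplus> p) = \<one>"
    by (rule inverse_one_plus_square[OF v(1,3) vw(1)[symmetric]]) (rule that; assumption)
  have pos: "0 \<le> Re (\<tau> (y\<^sup>\<star> \<otimes> p \<otimes> y))" "0 \<le> Re (\<tau> (y\<^sup>\<star> \<otimes> q \<otimes> y))" if y: "y \<in> \<C>" for y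
    using tr_pos(1)[of "v \<otimes> y"] tr_pos(1)[of "w \<otimes> y"] v y by (simp_all add: star_laws mul_laws flip: vw)
  \<comment> \<open>Positivity of \<open>p\<close> bounds the squared 2-norm of \<open>c y\<close>
    by the trace form of \<open>1 + p\<close> at \<open>c y\<close>; since
    \<open>(1 + p) c = 1\<close>, Cauchy-Schwarz applies.\<close>
  have nc: "\<rho> (c \<otimes> y) \<le> \<rho> y" if y: "y \<in> \<C>" for y
  proof -
    have "(\<rho> (c \<otimes> y))\<^sup>2 \<le> Re (\<tau> ((c \<otimes> y)\<^sup>\<star> \<otimes> (c \<otimes> y))) + Re (\<tau> ((c \<otimes> y)\<^sup>\<star> \<otimes> p \<otimes> c \<otimes> y))"
      using pos(1)[of "c \<otimes> y"] c y by (simp add: n2_sq)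
    also have "\<dots> = Re (\<tau> ((c \<otimes> y)\<^sup>\<star> \<otimes> ((\<one> \<oplus> p) \<otimes> c) \<otimes> y))"
      using c(1) y p by (simp add: mul_laws tr_laws)
    also have "\<dots> \<le> \<rho> (c \<otimes> y) * \<rho> y" unfolding c(3)
      using Cauchy_Schwarz[of "c \<otimes> y" y] c y complex_Re_le_cmod order_trans by fastforce
    finally show ?thesis
      using c y by (cases "\<rho> (c \<otimes> y) = 0") (simp_all add: power2_eq_square mult_le_cancel_left less_le)
  qed
  have nc1: "\<nu> c \<le> 1" using norm_le_if_n2_bounded[OF c(1), of 1] nc by simp
  show ?thesis
  proof (rule that[of "f \<otimes> c"])
    show "\<nu> (f \<otimes> c) \<le> r"
    proof (rule norm_le_if_n2_bounded)
      fix y assume y: "y \<in> \<C>"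
      let ?y = "c \<otimes> y"
      \<comment> \<open>In the form of \<open>k = 1 + p - q\<close> at \<open>c y\<close>, the part
        \<open>1 + p\<close> is cancelled by \<open>c\<close>, and the part \<open>- q\<close> only
        lowers the value.\<close>
      have k_eq: "k = \<one> \<oplus> (p \<ominus> q)" unfolding pq(1)[symmetric] using k by (intro tr_eqI) (simp_all add: alg)
      have "\<tau> ((f \<otimes> ?y)\<^sup>\<star> \<otimes> f \<otimes> ?y) = of_real (r\<^sup>2) * \<tau> (?y\<^sup>\<star> \<otimes> k \<otimes> ?y)"
        using f c y r by (simp add: k_def star_laws mul_laws tr_laws)
      also have "\<tau> (?y\<^sup>\<star> \<otimes> k \<otimes> ?y) = \<tau> (?y\<^sup>\<star> \<otimes> ((\<one> \<oplus> p) \<otimes> c) \<otimes> y) - \<tau> (?y\<^sup>\<star> \<otimes> q \<otimes> ?y)"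
        unfolding k_eq using p c(1) y by (simp add: mul_laws tr_laws)
      finally have "(\<rho> (f \<otimes> ?y))\<^sup>2 = r\<^sup>2 * (Re (\<tau> (?y\<^sup>\<star> \<otimes> y)) - Re (\<tau> (?y\<^sup>\<star> \<otimes> q \<otimes> ?y)))"
        unfolding c(3) using f c y by (simp add: n2_sq)
      also have "\<dots> \<le> r\<^sup>2 * (\<rho> ?y * \<rho> y)"
        using Cauchy_Schwarz[of ?y y] complex_Re_le_cmod[of "\<tau> (?y\<^sup>\<star> \<otimes> y)"] pos(2)[of ?y] c y
        by (intro mult_left_mono) auto
      also have "\<dots> \<le> r\<^sup>2 * (\<rho> y * \<rho> y)" using nc[OF y] c y by (intro mult_left_mono mult_right_mono) auto
      also have "\<dots> = (r * \<rho> y)\<^sup>2" by (simp add: power2_eq_square)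
      finally have "\<rho> (f \<otimes> ?y) \<le> r * \<rho> y" by (rule power2_le_imp_le) (use r y in simp)
      thus "\<rho> ((f \<otimes> c) \<otimes> y) \<le> r * \<rho> y" using f c y by (simp add: mul_laws)
    qed (use f c r in simp_all)
    \<comment> \<open>Multiplying \<open>1 - c = p c\<close> by \<open>f\<close> on the
      left.\<close>
    have "f \<ominus> f \<otimes> c = f \<otimes> p \<otimes> c"
    proof -
      have "\<tau> (w \<otimes> f \<otimes> p \<otimes> c) = \<tau> (w \<otimes> f) - \<tau> (w \<otimes> f \<otimes> c)" if "w \<in> \<C>" for w
        using arg_cong[OF c(3), of "\<lambda>x. \<tau> (w \<otimes> f \<otimes> x)"] that f c(1) p(1) by (simp add: alg)
      thus ?thesis using f c(1) p(1) by (intro tr_eqI) (simp_all add: alg)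
    qed
    hence "\<rho> (f \<ominus> f \<otimes> c) \<le> \<nu> f * \<rho> (p \<otimes> c)" using n2_mul_left[of f "p \<otimes> c"] f p c by simp
    also have "\<rho> (p \<otimes> c) \<le> \<rho> p * 1"
      using n2_mul_right[of p c] mult_left_mono[OF nc1, of "\<rho> p"] p c by simp
    also have "\<dots> \<le> \<rho> (f\<^sup>\<star> \<otimes> f \<ominus> g) / r\<^sup>2" using np kg by simp
    finally show "\<rho> (f \<ominus> f \<otimes> c) \<le> \<nu> f / r\<^sup>2 * \<rho> (f\<^sup>\<star> \<otimes> f \<ominus> g)"
      using f mult_left_mono by fastforce
  qed (use f c in simp)
qed

end

section \<open>The tracial ultrapower\<close>

lemma ultrafilter_not_eventually:
  assumes "nonprincipal_ultrafilter U"
  shows "\<not> eventually p U \<longleftrightarrow> eventually (\<lambda>n. \<not> p n) U"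
proof -
  have "eventually p U \<or> eventually (\<lambda>n. \<not> p n) U" "U \<noteq> bot"
    using assms[unfolded nonprincipal_ultrafilter_def, THEN conjunct2, THEN conjunct1, THEN spec, of "{n. p n}"]
      assms by (simp_all add: nonprincipal_ultrafilter_def)
  moreover have "\<not> (eventually p U \<and> eventually (\<lambda>n. \<not> p n) U)"
    using \<open>U \<noteq> bot\<close> eventually_conj[of p U "\<lambda>n. \<not> p n"] by (auto simp: trivial_limit_def)
  ultimately show ?thesis by blast
qed

lemma ultrafilter_eventually_ge:
  assumes "nonprincipal_ultrafilter U"
  shows "\<forall>\<^sub>F n in U. m \<le> n"
proof -
  have "\<forall>\<^sub>F n in U. \<forall>k\<in>{..<m}. n \<noteq> k"
    using assms unfolding nonprincipal_ultrafilter_def by (subst eventually_ball_finite_distrib) auto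
  thus ?thesis by (rule eventually_mono) (auto simp: not_less)
qed

text \<open>An ultrafilter converges to each of its cluster points, and compactness of the closure
  of the range provides one.\<close>

lemma ultrafilter_bounded_limit:
  fixes f :: "nat \<Rightarrow> 'b::heine_borel"
  assumes U: "nonprincipal_ultrafilter U" and "bounded (range f)"
  obtains l where "(f \<longlongrightarrow> l) U"
proof -
  let ?K = "closure (range f)"
  have "compact ?K" using assms(2) by (simp add: compact_closure)
  moreover have "filtermap f U \<noteq> bot"
    using U by (auto simp: nonprincipal_ultrafilter_def filtermap_bot_iff)
  moreover have "\<forall>\<^sub>F x in filtermap f U. x \<in> ?K"
    using closure_subset[of "range f"] by (auto simp: eventually_filtermap intro!: always_eventually)
  ultimately obtain l where l: "inf (nhds l) (filtermap f U) \<noteq> bot"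
    unfolding compact_filter by blast
  have "(f \<longlongrightarrow> l) U"
  proof (rule topological_tendstoI, rule ccontr)
    fix S assume S: "open S" "l \<in> S" "\<not> (\<forall>\<^sub>F x in U. f x \<in> S)"
    hence "\<forall>\<^sub>F x in filtermap f U. x \<notin> S"
      using ultrafilter_not_eventually[OF U] by (simp add: eventually_filtermap)
    moreover have "\<forall>\<^sub>F x in nhds l. x \<in> S" using S eventually_nhds by blast
    ultimately have "eventually (\<lambda>_. False) (inf (nhds l) (filtermap f U))"
      unfolding eventually_inf by blast
    thus False using l by (simp add: trivial_limit_def)
  qed
  thus ?thesis by (rule that)
qed

text \<open>Countable saturation: at coordinate \<open>n\<close>, satisfy the strongest condition \<open>A m\<close> with
  \<open>m \<le> n\<close> that is satisfiable there.\<close>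
lemma saturation:
  assumes U: "nonprincipal_ultrafilter U" and S: "S \<noteq> {}"
    and anti: "\<And>m n c. A (Suc m) n c \<Longrightarrow> A m n c"
    and ex: "\<And>m. \<forall>\<^sub>F n in U. \<exists>c\<in>S. A m n c"
  obtains y where "\<And>n. y n \<in> S" "\<And>m. \<forall>\<^sub>F n in U. A m n (y n)"
proof -
  define good where "good n m \<longleftrightarrow> m \<le> n \<and> (\<exists>c\<in>S. A m n c)" for n m
  define G where "G n = (GREATEST m. good n m)" for n
  have G: "good n (G n)" "m \<le> G n" if "good n m" for n m
  proof -
    show "good n (G n)" unfolding G_def
      by (rule GreatestI_nat[where P = "good n" and b = n, OF that]) (simp add: good_def)
    show "m \<le> G n" unfolding G_def
      by (rule Greatest_le_nat[where P = "good n" and b = n, OF that]) (simp add: good_def)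
  qed
  \<comment> \<open>Where no stage is good, the coordinate is an arbitrary element of
    \<open>S\<close>; such coordinates do not matter for the ultrafilter.\<close>
  have "\<forall>n. \<exists>c. c \<in> S \<and> (\<forall>m. good n m \<longrightarrow> A (G n) n c)"
    using S G(1) unfolding good_def by (metis ex_in_conv)
  then obtain y where y: "\<And>n. y n \<in> S" "\<And>n m. good n m \<Longrightarrow> A (G n) n (y n)" by metis
  have anti': "A M n c \<Longrightarrow> m \<le> M \<Longrightarrow> A m n c" for m M n c
    by (induction M) (auto simp: le_Suc_eq dest: anti)
  have "\<forall>\<^sub>F n in U. A m n (y n)" for m
    using ex[of m] ultrafilter_eventually_ge[OF U, of m]
  proof eventually_elim
    case (elim n)
    hence "good n m" by (simp add: good_def)
    thus ?case using y(2) G(2) anti' by blast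
  qed
  thus ?thesis using that y(1) by blast
qed

locale tracial_ultrapower = tracial_algebra +
  fixes U :: "nat filter"
  assumes ultra: "nonprincipal_ultrafilter U"
begin

abbreviation \<Q> where "\<Q> \<equiv> ultrapower P U"
abbreviation cls ("\<lbrakk>_\<rbrakk>") where "\<lbrakk>f\<rbrakk> \<equiv> ucls P U f"
abbreviation "\<B> \<equiv> bseq P"

lemma U_nontrivial [simp]: "U \<noteq> bot"
  using ultra by (simp add: nonprincipal_ultrafilter_def)

lemma bseq_carrier [simp]: "f \<in> \<B> \<Longrightarrow> f n \<in> \<C>"
  by (simp add: bseq_def)

lemma bseq_bound: assumes "f \<in> \<B>" obtains B where "B \<ge> 0" "\<And>n. \<nu> (f n) \<le> B"
proof -
  obtain B where B: "\<And>n. \<nu> (f n) \<le> B" using assms unfolding bseq_def by blast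
  moreover have "B \<ge> 0" using B[of 0] norm_nonneg[OF bseq_carrier[OF assms, of 0]] by linarith
  ultimately show ?thesis using that by blast
qed

lemma bseqI: "(\<And>n. f n \<in> \<C>) \<Longrightarrow> (\<And>n. \<nu> (f n) \<le> B) \<Longrightarrow> f \<in> \<B>"
  unfolding bseq_def by blast

lemma bseq_closed [simp]:
  "(\<lambda>n. \<zero>) \<in> \<B>" "(\<lambda>n. \<one>) \<in> \<B>"
  "f \<in> \<B> \<Longrightarrow> g \<in> \<B> \<Longrightarrow> (\<lambda>n. f n \<oplus> g n) \<in> \<B>"
  "f \<in> \<B> \<Longrightarrow> g \<in> \<B> \<Longrightarrow> (\<lambda>n. f n \<ominus> g n) \<in> \<B>"
  "f \<in> \<B> \<Longrightarrow> g \<in> \<B> \<Longrightarrow> (\<lambda>n. f n \<otimes> g n) \<in> \<B>"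
  "f \<in> \<B> \<Longrightarrow> (\<lambda>n. c \<odot> f n) \<in> \<B>"
  "f \<in> \<B> \<Longrightarrow> (\<lambda>n. (f n)\<^sup>\<star>) \<in> \<B>"
proof -
  show "(\<lambda>n. \<zero>) \<in> \<B>" "(\<lambda>n. \<one>) \<in> \<B>" by (rule bseqI[of _ 1]; simp)+
  assume f: "f \<in> \<B>"
  obtain B where B: "B \<ge> 0" "\<And>n. \<nu> (f n) \<le> B" using bseq_bound[OF f] by blast
  show "(\<lambda>n. c \<odot> f n) \<in> \<B>"
    using f B by (intro bseqI[of _ "cmod c * B"]) (simp_all add: norm_laws mult_left_mono)
  show "(\<lambda>n. (f n)\<^sup>\<star>) \<in> \<B>"
    using f B by (intro bseqI[of _ B]) (simp_all add: norm_star)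
  assume g: "g \<in> \<B>"
  obtain D where D: "D \<ge> 0" "\<And>n. \<nu> (g n) \<le> D" using bseq_bound[OF g] by blast
  show "(\<lambda>n. f n \<oplus> g n) \<in> \<B>"
    using f g by (intro bseqI[of _ "B + D"] order_trans[OF norm_laws(1) add_mono[OF B(2) D(2)]]) simp_all
  show "(\<lambda>n. f n \<ominus> g n) \<in> \<B>"
    using f g by (intro bseqI[of _ "B + D"] order_trans[OF norm_laws(4) add_mono[OF B(2) D(2)]]) simp_all
  show "(\<lambda>n. f n \<otimes> g n) \<in> \<B>"
    using f g B(1) by (intro bseqI[of _ "B * D"] order_trans[OF norm_laws(2) mult_mono[OF B(2) D(2)]]) simp_all
qed

section \<open>Classes of bounded sequences and their operations\<close>

definition eqv where "eqv f g \<longleftrightarrow> ((\<lambda>n. \<rho> (f n \<ominus> g n)) \<longlongrightarrow> 0) U"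

lemma tendsto_zero_le:
  fixes F G :: "nat \<Rightarrow> real"
  assumes "(G \<longlongrightarrow> 0) U" "\<And>n. 0 \<le> F n" "\<And>n. F n \<le> G n"
  shows "(F \<longlongrightarrow> 0) U"
  by (rule tendsto_sandwich[OF _ _ tendsto_const assms(1)]) (use assms in auto)

lemma eqv_refl: "f \<in> \<B> \<Longrightarrow> eqv f f"
  by (simp add: eqv_def)

lemma eqv_sym: assumes "f \<in> \<B>" "g \<in> \<B>" "eqv f g" shows "eqv g f"
proof -
  have "\<rho> (g n \<ominus> f n) = \<rho> (f n \<ominus> g n)" for n using assms by (intro n2_minus_commute) simp_all
  thus ?thesis using assms(3) unfolding eqv_def by simp
qed

lemma eqv_trans:
  assumes "f \<in> \<B>" "g \<in> \<B>" "h \<in> \<B>" "eqv f g" "eqv g h" shows "eqv f h"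
proof -
  have "((\<lambda>n. \<rho> (f n \<ominus> g n) + \<rho> (g n \<ominus> h n)) \<longlongrightarrow> 0) U"
    using tendsto_add[of _ 0 U _ 0] assms(4,5) unfolding eqv_def by fastforce
  thus ?thesis unfolding eqv_def
    by (rule tendsto_zero_le) (use assms n2_diff_triangle in simp_all)
qed

lemma ucls_eq_iff: assumes "f \<in> \<B>" "g \<in> \<B>" shows "\<lbrakk>f\<rbrakk> = \<lbrakk>g\<rbrakk> \<longleftrightarrow> eqv f g"
proof
  assume "\<lbrakk>f\<rbrakk> = \<lbrakk>g\<rbrakk>"
  moreover have "g \<in> \<lbrakk>g\<rbrakk>" using assms eqv_refl[of g] by (simp add: ucls_def eqv_def)
  ultimately have "g \<in> \<lbrakk>f\<rbrakk>" by simp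
  thus "eqv f g" by (simp add: ucls_def eqv_def)
next
  assume "eqv f g"
  thus "\<lbrakk>f\<rbrakk> = \<lbrakk>g\<rbrakk>"
    using assms eqv_trans[of f g] eqv_trans[of g f] eqv_sym[of f g]
    unfolding ucls_def eqv_def[symmetric] by blast
qed

lemma mem_ucls: "g \<in> \<lbrakk>f\<rbrakk> \<longleftrightarrow> g \<in> \<B> \<and> eqv f g"
  by (simp add: ucls_def eqv_def)

lemma urep_ucls: assumes "f \<in> \<B>" shows "urep \<lbrakk>f\<rbrakk> \<in> \<B>" "eqv f (urep \<lbrakk>f\<rbrakk>)"
proof -
  have "f \<in> \<lbrakk>f\<rbrakk>" using assms eqv_refl by (simp add: mem_ucls)
  hence "urep \<lbrakk>f\<rbrakk> \<in> \<lbrakk>f\<rbrakk>" unfolding urep_def by (rule someI[of "\<lambda>g. g \<in> \<lbrakk>f\<rbrakk>"])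
  thus "urep \<lbrakk>f\<rbrakk> \<in> \<B>" "eqv f (urep \<lbrakk>f\<rbrakk>)" by (simp_all add: mem_ucls)
qed

lemma carrier_Q: "tcarrier \<Q> = ucls P U ` \<B>"
  by (simp add: ultrapower_def)

lemma ucls_carrier [simp]: "f \<in> \<B> \<Longrightarrow> \<lbrakk>f\<rbrakk> \<in> tcarrier \<Q>"
  by (simp add: carrier_Q)

lemma n2_mul_diff:
  assumes "x \<in> \<C>" "y \<in> \<C>" "x' \<in> \<C>" "y' \<in> \<C>"
  shows "\<rho> (x \<otimes> y \<ominus> x' \<otimes> y') \<le> \<nu> x * \<rho> (y \<ominus> y') + \<rho> (x \<ominus> x') * \<nu> y'"
proof -
  have "x \<otimes> y \<ominus> x' \<otimes> y' = x \<otimes> (y \<ominus> y') \<oplus> (x \<ominus> x') \<otimes> y'"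
    using assms by (intro tr_eqI) (simp_all add: alg)
  thus ?thesis using assms n2_add[of "x \<otimes> (y \<ominus> y')" "(x \<ominus> x') \<otimes> y'"]
      n2_mul_left[of x "y \<ominus> y'"] n2_mul_right[of "x \<ominus> x'" y'] by simp
qed

text \<open>The operations of \<open>ultrapower\<close> are computed with the representatives chosen
  by \<open>urep\<close>, so the content is independence of that choice. For products this uses
  boundedness in operator norm: an error in one factor is measured in the 2-norm while the other
  factor is absorbed by its operator norm bound.\<close>

lemma ops_Q:
  "tzero \<Q> = \<lbrakk>\<lambda>n. \<zero>\<rbrakk>" "tone \<Q> = \<lbrakk>\<lambda>n. \<one>\<rbrakk>"
  "f \<in> \<B> \<Longrightarrow> g \<in> \<B> \<Longrightarrow> tadd \<Q> \<lbrakk>f\<rbrakk> \<lbrakk>g\<rbrakk> = \<lbrakk>\<lambda>n. f n \<oplus> g n\<rbrakk>"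
  "f \<in> \<B> \<Longrightarrow> g \<in> \<B> \<Longrightarrow> tmul \<Q> \<lbrakk>f\<rbrakk> \<lbrakk>g\<rbrakk> = \<lbrakk>\<lambda>n. f n \<otimes> g n\<rbrakk>"
  "f \<in> \<B> \<Longrightarrow> tsmult \<Q> c \<lbrakk>f\<rbrakk> = \<lbrakk>\<lambda>n. c \<odot> f n\<rbrakk>"
  "f \<in> \<B> \<Longrightarrow> tstar \<Q> \<lbrakk>f\<rbrakk> = \<lbrakk>\<lambda>n. (f n)\<^sup>\<star>\<rbrakk>"
proof -
  show "tzero \<Q> = \<lbrakk>\<lambda>n. \<zero>\<rbrakk>" "tone \<Q> = \<lbrakk>\<lambda>n. \<one>\<rbrakk>" by (simp_all add: ultrapower_def)
  assume f: "f \<in> \<B>"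
  define r where "r = urep \<lbrakk>f\<rbrakk>"
  have r: "r \<in> \<B>" "((\<lambda>n. \<rho> (f n \<ominus> r n)) \<longlongrightarrow> 0) U" using urep_ucls[OF f] by (simp_all add: r_def eqv_def)
  have "\<rho> (c \<odot> f n \<ominus> c \<odot> r n) = cmod c * \<rho> (f n \<ominus> r n)" for n c
  proof -
    have "c \<odot> f n \<ominus> c \<odot> r n = c \<odot> (f n \<ominus> r n)" using f r(1) by (intro tr_eqI) (simp_all add: alg)
    thus ?thesis using f r(1) by (simp add: n2_smult)
  qed
  hence "eqv (\<lambda>n. c \<odot> f n) (\<lambda>n. c \<odot> r n)"
    using tendsto_mult_right_zero[OF r(2)] by (simp add: eqv_def)
  thus "tsmult \<Q> c \<lbrakk>f\<rbrakk> = \<lbrakk>\<lambda>n. c \<odot> f n\<rbrakk>"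
    using f r(1) by (simp add: ultrapower_def ucls_eq_iff eqv_sym flip: r_def)
  have "\<rho> ((f n)\<^sup>\<star> \<ominus> (r n)\<^sup>\<star>) = \<rho> (f n \<ominus> r n)" for n
    using n2_star[of "f n \<ominus> r n"] f r(1) by (simp add: star_laws)
  hence "eqv (\<lambda>n. (f n)\<^sup>\<star>) (\<lambda>n. (r n)\<^sup>\<star>)" using r(2) by (simp add: eqv_def)
  thus "tstar \<Q> \<lbrakk>f\<rbrakk> = \<lbrakk>\<lambda>n. (f n)\<^sup>\<star>\<rbrakk>"
    using f r(1) by (simp add: ultrapower_def ucls_eq_iff eqv_sym flip: r_def)
  assume g: "g \<in> \<B>"
  define s where "s = urep \<lbrakk>g\<rbrakk>"
  have s: "s \<in> \<B>" "((\<lambda>n. \<rho> (g n \<ominus> s n)) \<longlongrightarrow> 0) U" using urep_ucls[OF g] by (simp_all add: s_def eqv_def)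
  have a1: "((\<lambda>n. \<rho> (f n \<ominus> r n) + \<rho> (g n \<ominus> s n)) \<longlongrightarrow> 0) U"
    using tendsto_add[OF r(2) s(2)] by simp
  have a2: "\<rho> ((f n \<oplus> g n) \<ominus> (r n \<oplus> s n)) \<le> \<rho> (f n \<ominus> r n) + \<rho> (g n \<ominus> s n)" for n
  proof -
    have "(f n \<oplus> g n) \<ominus> (r n \<oplus> s n) = (f n \<ominus> r n) \<oplus> (g n \<ominus> s n)"
      using f g r(1) s(1) by (intro tr_eqI) (simp_all add: alg)
    thus ?thesis using f g r(1) s(1) by (simp add: n2_add)
  qed
  have "eqv (\<lambda>n. f n \<oplus> g n) (\<lambda>n. r n \<oplus> s n)"
    unfolding eqv_def by (rule tendsto_zero_le[OF a1 _ a2]) (use f g r s in simp)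
  thus "tadd \<Q> \<lbrakk>f\<rbrakk> \<lbrakk>g\<rbrakk> = \<lbrakk>\<lambda>n. f n \<oplus> g n\<rbrakk>"
    using f g r(1) s(1) by (simp add: ultrapower_def ucls_eq_iff eqv_sym flip: r_def s_def)
  obtain B D where B: "\<And>n. \<nu> (f n) \<le> B" and D: "\<And>n. \<nu> (s n) \<le> D"
    using bseq_bound[OF f] bseq_bound[OF s(1)] by metis
  have m1: "((\<lambda>n. B * \<rho> (g n \<ominus> s n) + \<rho> (f n \<ominus> r n) * D) \<longlongrightarrow> 0) U"
    using tendsto_add[OF tendsto_mult_right_zero[OF s(2)] tendsto_mult_left_zero[OF r(2)]] by simp
  have m2: "\<rho> (f n \<otimes> g n \<ominus> r n \<otimes> s n) \<le> B * \<rho> (g n \<ominus> s n) + \<rho> (f n \<ominus> r n) * D" for n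
    using n2_mul_diff[of "f n" "g n" "r n" "s n"] f g r(1) s(1)
      mult_right_mono[OF B[of n], of "\<rho> (g n \<ominus> s n)"] mult_left_mono[OF D[of n], of "\<rho> (f n \<ominus> r n)"]
    by simp
  have "eqv (\<lambda>n. f n \<otimes> g n) (\<lambda>n. r n \<otimes> s n)"
    unfolding eqv_def by (rule tendsto_zero_le[OF m1 _ m2]) (use f g r s in simp)
  thus "tmul \<Q> \<lbrakk>f\<rbrakk> \<lbrakk>g\<rbrakk> = \<lbrakk>\<lambda>n. f n \<otimes> g n\<rbrakk>"
    using f g r(1) s(1) by (simp add: ultrapower_def ucls_eq_iff eqv_sym flip: r_def s_def)
qed

lemma sub_Q: "f \<in> \<B> \<Longrightarrow> g \<in> \<B> \<Longrightarrow> tsub \<Q> \<lbrakk>f\<rbrakk> \<lbrakk>g\<rbrakk> = \<lbrakk>\<lambda>n. f n \<ominus> g n\<rbrakk>"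
  unfolding tsub_def by (simp add: ops_Q(3,5))

lemma tr_Q: assumes f: "f \<in> \<B>" shows "((\<lambda>n. \<tau> (f n)) \<longlongrightarrow> ttr \<Q> \<lbrakk>f\<rbrakk>) U"
proof -
  define r where "r = urep \<lbrakk>f\<rbrakk>"
  have r: "r \<in> \<B>" "((\<lambda>n. \<rho> (f n \<ominus> r n)) \<longlongrightarrow> 0) U" using urep_ucls[OF f] by (simp_all add: r_def eqv_def)
  obtain B where B: "\<And>n. \<nu> (f n) \<le> B" using bseq_bound[OF f] by blast
  have "cmod (\<tau> (f n)) \<le> B" for n
    using cmod_tr_le_n2[of "f n"] n2_le_norm[of "f n"] B[of n] f by simp
  hence "bounded (range (\<lambda>n. \<tau> (f n)))" by (auto simp: bounded_iff)
  then obtain l where l: "((\<lambda>n. \<tau> (f n)) \<longlongrightarrow> l) U" by (rule ultrafilter_bounded_limit[OF ultra])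
  have "((\<lambda>n. \<tau> (f n) - \<tau> (r n)) \<longlongrightarrow> 0) U"
  proof (rule tendsto_norm_zero_cancel, rule tendsto_zero_le[OF r(2)])
    show "cmod (\<tau> (f n) - \<tau> (r n)) \<le> \<rho> (f n \<ominus> r n)" for n
      using cmod_tr_le_n2[of "f n \<ominus> r n"] f r(1) by (simp add: tr_laws)
  qed simp
  from tendsto_diff[OF l this] have "((\<lambda>n. \<tau> (r n)) \<longlongrightarrow> l) U" by simp
  hence "ttr \<Q> \<lbrakk>f\<rbrakk> = l" by (simp add: ultrapower_def tendsto_Lim flip: r_def)
  thus ?thesis using l by simp
qed

lemma n2_Q: assumes f: "f \<in> \<B>" shows "((\<lambda>n. \<rho> (f n)) \<longlongrightarrow> n2 \<Q> \<lbrakk>f\<rbrakk>) U"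
proof -
  have "n2 \<Q> \<lbrakk>f\<rbrakk> = sqrt (Re (ttr \<Q> \<lbrakk>\<lambda>n. (f n)\<^sup>\<star> \<otimes> f n\<rbrakk>))" using f by (simp add: n2_def ops_Q)
  moreover have "((\<lambda>n. sqrt (Re (\<tau> ((f n)\<^sup>\<star> \<otimes> f n)))) \<longlongrightarrow> sqrt (Re (ttr \<Q> \<lbrakk>\<lambda>n. (f n)\<^sup>\<star> \<otimes> f n\<rbrakk>))) U"
    using f by (intro tendsto_intros tr_Q) simp_all
  ultimately show ?thesis by (simp add: n2_def)
qed

section \<open>The quotient norm\<close>

lemma norm_Q_set:
  assumes f: "f \<in> \<B>" and "g \<in> \<lbrakk>f\<rbrakk>"
  shows "((\<lambda>n. \<nu> (g n)) \<longlongrightarrow> Lim U (\<lambda>n. \<nu> (g n))) U" "0 \<le> Lim U (\<lambda>n. \<nu> (g n))"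
proof -
  have g: "g \<in> \<B>" using assms by (simp add: mem_ucls)
  obtain B where B: "\<And>n. \<nu> (g n) \<le> B" using bseq_bound[OF g] by blast
  hence "bounded (range (\<lambda>n. \<nu> (g n)))" using g by (auto simp: bounded_iff)
  then obtain l where l: "((\<lambda>n. \<nu> (g n)) \<longlongrightarrow> l) U" by (rule ultrafilter_bounded_limit[OF ultra])
  thus 1: "((\<lambda>n. \<nu> (g n)) \<longlongrightarrow> Lim U (\<lambda>n. \<nu> (g n))) U" by (simp add: tendsto_Lim)
  show "0 \<le> Lim U (\<lambda>n. \<nu> (g n))"
    by (rule tendsto_lowerbound[OF 1]) (use g in simp_all)
qed

lemma norm_Q: "tnorm \<Q> X = Inf ((\<lambda>f. Lim U (\<lambda>n. \<nu> (f n))) ` X)"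
  by (simp add: ultrapower_def)

lemma norm_Q_nonneg: assumes "f \<in> \<B>" shows "0 \<le> tnorm \<Q> \<lbrakk>f\<rbrakk>"
  unfolding norm_Q
proof (rule cInf_greatest)
  show "(\<lambda>f. Lim U (\<lambda>n. \<nu> (f n))) ` \<lbrakk>f\<rbrakk> \<noteq> {}" using urep_ucls[OF assms] by (auto simp: mem_ucls)
qed (use norm_Q_set(2)[OF assms] in auto)

lemma norm_Q_le:
  assumes f: "f \<in> \<B>" and b: "\<And>n. \<nu> (f n) \<le> r"
  shows "tnorm \<Q> \<lbrakk>f\<rbrakk> \<le> r"
proof -
  have m: "f \<in> \<lbrakk>f\<rbrakk>" using f eqv_refl by (simp add: mem_ucls)
  have "tnorm \<Q> \<lbrakk>f\<rbrakk> \<le> Lim U (\<lambda>n. \<nu> (f n))"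
    unfolding norm_Q by (rule cInf_lower) (use m norm_Q_set(2)[OF f] in \<open>auto intro!: bdd_belowI2\<close>)
  also have "\<dots> \<le> r" by (rule tendsto_upperbound[OF norm_Q_set(1)[OF f m]]) (use b in simp_all)
  finally show ?thesis .
qed

text \<open>Saturation glues the approximations for the tolerances \<open>1 / Suc m\<close> into one
  sequence in the ball whose 2-norm distance from \<open>f\<close> tends to 0, that is, into an
  exact representative.\<close>

lemma ball_rep_approx:
  assumes f: "f \<in> \<B>" and r: "r \<ge> 0"
    and ap: "\<And>\<eta>. \<eta> > 0 \<Longrightarrow> \<forall>\<^sub>F n in U. \<exists>h\<in>\<C>. \<nu> h \<le> r \<and> \<rho> (f n \<ominus> h) < \<eta>"
  obtains h where "h \<in> \<B>" "\<And>n. \<nu> (h n) \<le> r" "\<lbrakk>f\<rbrakk> = \<lbrakk>h\<rbrakk>"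
proof -
  let ?S = "{h \<in> \<C>. \<nu> h \<le> r}" and ?A = "\<lambda>m n h. \<rho> (f n \<ominus> h) < 1 / Suc m"
  obtain h where h: "\<And>n. h n \<in> ?S" "\<And>m. \<forall>\<^sub>F n in U. ?A m n (h n)"
  proof (rule saturation[OF ultra, of ?S ?A])
    show "?S \<noteq> {}" using r by (auto intro!: exI[of _ "\<zero>"])
    show "?A m n c" if "?A (Suc m) n c" for m n c
      by (rule less_le_trans[OF that]) (simp add: frac_le)
    show "\<forall>\<^sub>F n in U. \<exists>c\<in>?S. ?A m n c" for m
      using ap[of "1 / Suc m"] by (auto elim!: eventually_mono)
  qed (rule that; assumption)
  have hB: "h \<in> \<B>" using h(1) by (intro bseqI[of _ r]) auto
  have "eqv f h" unfolding eqv_def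
  proof (rule tendstoI)
    fix e :: real assume "e > 0"
    then obtain m where m: "1 / Suc m < e" using nat_approx_posE by blast
    show "\<forall>\<^sub>F n in U. dist (\<rho> (f n \<ominus> h n)) 0 < e"
      using h(2)[of m] by eventually_elim (use m f hB in simp)
  qed
  thus ?thesis using that[of h] hB h(1) f by (simp add: ucls_eq_iff)
qed

lemma norm_Q_le_approx:
  assumes f: "f \<in> \<B>" and r: "r \<ge> 0"
    and ap: "\<And>\<eta>. \<eta> > 0 \<Longrightarrow> \<forall>\<^sub>F n in U. \<exists>h\<in>\<C>. \<nu> h \<le> r \<and> \<rho> (f n \<ominus> h) < \<eta>"
  shows "tnorm \<Q> \<lbrakk>f\<rbrakk> \<le> r"
  using ball_rep_approx[OF assms] norm_Q_le by metis

text \<open>The infimum in the quotient norm is attained, and by a bound valid in every coordinate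
  rather than only in the limit. A representative with limit below \<open>r + \<epsilon>\<close> is
  scaled down into the ball of radius \<open>r\<close>, which costs at most
  \<open>\<epsilon>\<close> in the 2-norm.\<close>

lemma ball_rep:
  assumes f: "f \<in> \<B>" and nr: "tnorm \<Q> \<lbrakk>f\<rbrakk> \<le> r"
  obtains h where "h \<in> \<B>" "\<And>n. \<nu> (h n) \<le> r" "\<lbrakk>f\<rbrakk> = \<lbrakk>h\<rbrakk>"
proof (rule ball_rep_approx[OF f])
  show r: "0 \<le> r" using norm_Q_nonneg[OF f] nr by linarith
  fix \<eta> :: real assume "\<eta> > 0"
  define \<epsilon> where "\<epsilon> = \<eta> / 2"
  have \<epsilon>: "\<epsilon> > 0" using \<open>\<eta> > 0\<close> by (simp add: \<epsilon>_def)
  have ne: "\<lbrakk>f\<rbrakk> \<noteq> {}" using urep_ucls[OF f] by (auto simp: mem_ucls)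
  have "Inf ((\<lambda>f. Lim U (\<lambda>n. \<nu> (f n))) ` \<lbrakk>f\<rbrakk>) < r + \<epsilon>" using nr \<epsilon> by (simp add: norm_Q)
  then obtain g where g: "g \<in> \<lbrakk>f\<rbrakk>" "Lim U (\<lambda>n. \<nu> (g n)) < r + \<epsilon>"
    using ne cInf_lessD[of "(\<lambda>f. Lim U (\<lambda>n. \<nu> (f n))) ` \<lbrakk>f\<rbrakk>" "r + \<epsilon>"] by blast
  have gB: "g \<in> \<B>" and fg: "((\<lambda>n. \<rho> (f n \<ominus> g n)) \<longlongrightarrow> 0) U" using g(1) by (simp_all add: mem_ucls eqv_def)
  have "\<forall>\<^sub>F n in U. \<nu> (g n) < r + \<epsilon>" using norm_Q_set(1)[OF f g(1)] g(2) by (rule order_tendstoD)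
  moreover have "\<forall>\<^sub>F n in U. \<rho> (f n \<ominus> g n) < \<epsilon>" using fg \<epsilon> by (rule order_tendstoD)
  ultimately show "\<forall>\<^sub>F n in U. \<exists>h\<in>\<C>. \<nu> h \<le> r \<and> \<rho> (f n \<ominus> h) < \<eta>"
  proof eventually_elim
    case (elim n)
    \<comment> \<open>Scaling by \<open>t\<close> takes radius \<open>r + \<epsilon>\<close> to
      \<open>r\<close> and moves \<open>g n\<close> by at most
      \<open>(1 - t) (r + \<epsilon>) = \<epsilon>\<close>.\<close>
    define t where "t = r / (r + \<epsilon>)"
    have t: "0 \<le> t" "t * (r + \<epsilon>) = r" "1 - t = \<epsilon> / (r + \<epsilon>)" using r \<epsilon> by (auto simp: t_def field_simps)
    let ?h = "of_real t \<odot> g n"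
    have "\<nu> ?h \<le> t * (r + \<epsilon>)" using t(1) elim(1) gB by (simp add: norm_laws mult_left_mono)
    moreover have "\<rho> (g n \<ominus> ?h) \<le> \<epsilon>"
    proof -
      have "g n \<ominus> ?h = of_real (1 - t) \<odot> g n" using gB by (intro tr_eqI) (simp_all add: alg)
      moreover have "1 - t \<ge> 0" using t(3) r \<epsilon> by simp
      ultimately have "\<rho> (g n \<ominus> ?h) = (1 - t) * \<rho> (g n)"
        using n2_smult[of "g n" "of_real (1 - t)"] gB by (simp only: bseq_carrier norm_of_real abs_of_nonneg)
      also have "\<dots> \<le> (1 - t) * (r + \<epsilon>)"
        using \<open>1 - t \<ge> 0\<close> elim(1) n2_le_norm[of "g n"] gB by (intro mult_left_mono) simp_all
      also have "\<dots> = \<epsilon>" using t(3) r \<epsilon> by simp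
      finally show ?thesis .
    qed
    moreover have "\<rho> (f n \<ominus> ?h) \<le> \<rho> (f n \<ominus> g n) + \<rho> (g n \<ominus> ?h)" using f gB by (intro n2_diff_triangle) simp_all
    ultimately have "\<nu> ?h \<le> r \<and> \<rho> (f n \<ominus> ?h) < \<eta>" using elim(2) t(2) by (simp add: \<epsilon>_def)
    thus ?case using gB by (intro bexI[of _ ?h]) simp_all
  qed
qed (rule that; assumption)

text \<open>Read \<open>D r \<eta> x\<close> as: the size of \<open>x\<close> is at most
  \<open>r\<close>, up to an error \<open>\<eta>\<close>. The limit of a Cauchy sequence in the
  ultrapower is found by saturation, once for both completeness axioms, with \<open>D\<close> built
  from the 2-norm or from the operator norm. The index \<open>N j\<close> belongs to the Cauchy
  tolerance \<open>1 / Suc j\<close>.\<close>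

lemma saturated_Cauchy_limit:
  fixes f :: "nat \<Rightarrow> nat \<Rightarrow> 'a" and D :: "real \<Rightarrow> real \<Rightarrow> 'a \<Rightarrow> bool" and N :: "nat \<Rightarrow> nat"
  assumes S: "\<And>k n. N 0 \<le> k \<Longrightarrow> f k n \<in> S"
    and mono: "\<And>r \<eta> \<eta>' x. D r \<eta> x \<Longrightarrow> \<eta> \<le> \<eta>' \<Longrightarrow> D r \<eta>' x"
    and D: "\<And>j k \<eta>. N j \<le> k \<Longrightarrow> \<eta> > 0 \<Longrightarrow> \<forall>\<^sub>F n in U. D (1 / Suc j) \<eta> (f (N j) n \<ominus> f k n)"
  obtains y where "\<And>n. y n \<in> S" "\<And>j \<eta>. \<eta> > 0 \<Longrightarrow> \<forall>\<^sub>F n in U. D (1 / Suc j) \<eta> (f (N j) n \<ominus> y n)"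
proof -
  let ?A = "\<lambda>m n c. \<forall>j\<le>m. D (1 / Suc j) (1 / Suc m) (f (N j) n \<ominus> c)"
  obtain y where y: "\<And>n. y n \<in> S" "\<And>m. \<forall>\<^sub>F n in U. ?A m n (y n)"
  proof (rule saturation[OF ultra, of S ?A])
    show "S \<noteq> {}" using S by blast
    show "?A m n c" if "?A (Suc m) n c" for m n c
    proof (intro allI impI)
      fix j assume "j \<le> m"
      hence "D (1 / Suc j) (1 / Suc (Suc m)) (f (N j) n \<ominus> c)" using that by simp
      thus "D (1 / Suc j) (1 / Suc m) (f (N j) n \<ominus> c)" by (rule mono) (simp add: frac_le)
    qed
    fix m
    \<comment> \<open>Stage \<open>m\<close> is satisfied by a term of the sequence itself, taken
      beyond all indices \<open>N j\<close> with \<open>j <= m\<close>.\<close>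
    define k where "k = Max (N ` {..m})"
    have k: "N j \<le> k" if "j \<le> m" for j using that by (simp add: k_def)
    have "\<forall>\<^sub>F n in U. \<forall>j\<in>{..m}. D (1 / Suc j) (1 / Suc m) (f (N j) n \<ominus> f k n)"
      using D[OF k] by (subst eventually_ball_finite_distrib) simp_all
    thus "\<forall>\<^sub>F n in U. \<exists>c\<in>S. ?A m n c"
      by (rule eventually_mono) (use S k in blast)
  qed (rule that; assumption)
  have "\<forall>\<^sub>F n in U. D (1 / Suc j) \<eta> (f (N j) n \<ominus> y n)" if \<eta>: "\<eta> > 0" for j \<eta>
  proof -
    obtain m where m: "1 / Suc m < \<eta>" using nat_approx_posE[OF \<eta>] by blast
    show ?thesis using y(2)[of "max m j"]
    proof eventually_elim
      case (elim n)
      have "1 / Suc (max m j) \<le> 1 / Suc m" by (simp add: frac_le)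
      hence "1 / Suc (max m j) \<le> \<eta>" using m by linarith
      moreover have "D (1 / Suc j) (1 / Suc (max m j)) (f (N j) n \<ominus> y n)" using elim by simp
      ultimately show ?case using mono by blast
    qed
  qed
  thus ?thesis using that y(1) by blast
qed

lemma carrier_Q_E: assumes "X \<in> tcarrier \<Q>" obtains f where "f \<in> \<B>" "X = \<lbrakk>f\<rbrakk>"
  using assms by (auto simp: carrier_Q)

lemma norm_rep:
  assumes "X \<in> tcarrier \<Q>"
  obtains f where "f \<in> \<B>" "X = \<lbrakk>f\<rbrakk>" "\<And>n. \<nu> (f n) \<le> tnorm \<Q> X"
proof -
  obtain g where g: "g \<in> \<B>" "X = \<lbrakk>g\<rbrakk>" using carrier_Q_E[OF assms] by blast
  obtain h where "h \<in> \<B>" "\<And>n. \<nu> (h n) \<le> tnorm \<Q> \<lbrakk>g\<rbrakk>" "\<lbrakk>g\<rbrakk> = \<lbrakk>h\<rbrakk>"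
    by (rule ball_rep[OF g(1) order_refl]) (rule that; assumption)
  thus ?thesis using that[of h] g by simp
qed

lemma norm_Q_smult_le: assumes "X \<in> tcarrier \<Q>" shows "tnorm \<Q> (tsmult \<Q> c X) \<le> cmod c * tnorm \<Q> X"
proof -
  obtain f where f: "f \<in> \<B>" "X = \<lbrakk>f\<rbrakk>" "\<And>n. \<nu> (f n) \<le> tnorm \<Q> X" using norm_rep[OF assms] by blast
  have "tnorm \<Q> \<lbrakk>\<lambda>n. c \<odot> f n\<rbrakk> \<le> cmod c * tnorm \<Q> X"
    using f(1,3) by (intro norm_Q_le) (simp_all add: norm_laws mult_left_mono)
  thus ?thesis using f(1,2) by (simp add: ops_Q(5))
qed

text \<open>One inequality holds in each coordinate. For the other, \<open>ball_rep\<close>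
  represents the product of \<open>X\<close> with its adjoint by a sequence in the ball of radius
  \<open>r^2\<close>, and \<open>truncation\<close> applied in each coordinate moves
  \<open>f\<close> into the ball of radius \<open>r\<close> without changing its class.\<close>

lemma norm_Q_cstar:
  assumes X: "X \<in> tcarrier \<Q>"
  shows "tnorm \<Q> (tmul \<Q> (tstar \<Q> X) X) = (tnorm \<Q> X)\<^sup>2"
proof (rule antisym)
  obtain f where f: "f \<in> \<B>" "X = \<lbrakk>f\<rbrakk>" "\<And>n. \<nu> (f n) \<le> tnorm \<Q> X" using norm_rep[OF X] by blast
  have XX: "tmul \<Q> (tstar \<Q> X) X = \<lbrakk>\<lambda>n. (f n)\<^sup>\<star> \<otimes> f n\<rbrakk>" using f(1,2) by (simp add: ops_Q(4,6))
  have ffB: "(\<lambda>n. (f n)\<^sup>\<star> \<otimes> f n) \<in> \<B>" using f(1) by simp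
  show "tnorm \<Q> (tmul \<Q> (tstar \<Q> X) X) \<le> (tnorm \<Q> X)\<^sup>2" unfolding XX
  proof (rule norm_Q_le[OF ffB])
    fix n
    have "\<nu> ((f n)\<^sup>\<star> \<otimes> f n) = (\<nu> (f n))\<^sup>2" using f(1) by (simp add: norm_cstar)
    also have "\<dots> \<le> (tnorm \<Q> X)\<^sup>2" using f(1) by (intro power_mono f(3)) simp
    finally show "\<nu> ((f n)\<^sup>\<star> \<otimes> f n) \<le> (tnorm \<Q> X)\<^sup>2" .
  qed
  define t where "t = tnorm \<Q> (tmul \<Q> (tstar \<Q> X) X)"
  have t0: "0 \<le> t" unfolding t_def XX by (rule norm_Q_nonneg[OF ffB])
  have X0: "0 \<le> tnorm \<Q> X" unfolding f(2) by (rule norm_Q_nonneg[OF f(1)])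
  have bound: "tnorm \<Q> X \<le> r" if r: "r > 0" "t \<le> r\<^sup>2" for r
  proof -
    obtain g where g: "g \<in> \<B>" "\<And>n. \<nu> (g n) \<le> r\<^sup>2" "\<lbrakk>\<lambda>n. (f n)\<^sup>\<star> \<otimes> f n\<rbrakk> = \<lbrakk>g\<rbrakk>"
      by (rule ball_rep[OF ffB, of "r\<^sup>2", folded XX, folded t_def, unfolded XX, OF r(2)]) (rule that; assumption)
    have fg: "((\<lambda>n. \<rho> ((f n)\<^sup>\<star> \<otimes> f n \<ominus> g n)) \<longlongrightarrow> 0) U"
      using g(3) ucls_eq_iff[OF ffB g(1)] by (simp add: eqv_def)
    have "\<exists>h. h \<in> \<C> \<and> \<nu> h \<le> r \<and> \<rho> (f n \<ominus> h) \<le> \<nu> (f n) / r\<^sup>2 * \<rho> ((f n)\<^sup>\<star> \<otimes> f n \<ominus> g n)" for n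
      by (rule truncation[OF bseq_carrier[OF f(1)] bseq_carrier[OF g(1)] g(2) r(1)]) blast
    then obtain h where h: "\<And>n. h n \<in> \<C>" "\<And>n. \<nu> (h n) \<le> r"
      "\<And>n. \<rho> (f n \<ominus> h n) \<le> \<nu> (f n) / r\<^sup>2 * \<rho> ((f n)\<^sup>\<star> \<otimes> f n \<ominus> g n)" by metis
    have hB: "h \<in> \<B>" using h by (intro bseqI[of _ r])
    have lim: "((\<lambda>n. tnorm \<Q> X / r\<^sup>2 * \<rho> ((f n)\<^sup>\<star> \<otimes> f n \<ominus> g n)) \<longlongrightarrow> 0) U"
      using fg by (rule tendsto_mult_right_zero)
    have "eqv f h" unfolding eqv_def
    proof (rule tendsto_zero_le[OF lim])
      fix n
      show "0 \<le> \<rho> (f n \<ominus> h n)" using f(1) h(1) by simp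
      have "\<nu> (f n) / r\<^sup>2 * \<rho> ((f n)\<^sup>\<star> \<otimes> f n \<ominus> g n) \<le> tnorm \<Q> X / r\<^sup>2 * \<rho> ((f n)\<^sup>\<star> \<otimes> f n \<ominus> g n)"
        using f(1) g(1) by (intro mult_right_mono divide_right_mono f(3)) simp_all
      thus "\<rho> (f n \<ominus> h n) \<le> tnorm \<Q> X / r\<^sup>2 * \<rho> ((f n)\<^sup>\<star> \<otimes> f n \<ominus> g n)" using h(3)[of n] by linarith
    qed
    hence "X = \<lbrakk>h\<rbrakk>" using f(1,2) hB ucls_eq_iff[of f h] by simp
    thus ?thesis using norm_Q_le[OF hB h(2)] by simp
  qed
  show "(tnorm \<Q> X)\<^sup>2 \<le> tnorm \<Q> (tmul \<Q> (tstar \<Q> X) X)"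
  proof (rule ccontr)
    assume "\<not> ?thesis"
    hence lt: "t < (tnorm \<Q> X)\<^sup>2" by (simp add: t_def)
    \<comment> \<open>The square of \<open>r\<close> lies strictly between \<open>t\<close> and the
      squared norm of \<open>X\<close>; in particular \<open>r\<close> is positive, as
      \<open>truncation\<close> requires.\<close>
    define r where "r = sqrt ((t + (tnorm \<Q> X)\<^sup>2) / 2)"
    have rr: "r\<^sup>2 = (t + (tnorm \<Q> X)\<^sup>2) / 2" "r > 0" unfolding r_def using t0 lt by simp_all
    have "tnorm \<Q> X \<le> r" using bound[OF rr(2)] rr(1) lt by simp
    hence "(tnorm \<Q> X)\<^sup>2 \<le> r\<^sup>2" using X0 by (rule power_mono)
    thus False using rr(1) lt by simp
  qed
qed

section \<open>Norm inequalities and completeness of the ultrapower\<close>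

lemma Cauchy_indices:
  fixes g :: "nat \<Rightarrow> nat \<Rightarrow> real"
  assumes "\<forall>\<epsilon>>0. \<exists>N. \<forall>m\<ge>N. \<forall>n\<ge>N. g m n < \<epsilon>"
  obtains N where "\<And>j m n. N j \<le> m \<Longrightarrow> N j \<le> n \<Longrightarrow> g m n < 1 / real (Suc j)"
proof -
  have "\<forall>j. \<exists>N. \<forall>m\<ge>N. \<forall>n\<ge>N. g m n < 1 / real (Suc j)" using assms by simp
  then obtain N where "\<forall>j. \<forall>m\<ge>N j. \<forall>n\<ge>N j. g m n < 1 / real (Suc j)" by (rule choice[THEN exE])
  thus ?thesis using that by blast
qed

lemma norm_Q_add_mul:
  assumes "X \<in> tcarrier \<Q>" "Y \<in> tcarrier \<Q>"
  shows "tnorm \<Q> (tadd \<Q> X Y) \<le> tnorm \<Q> X + tnorm \<Q> Y" "tnorm \<Q> (tmul \<Q> X Y) \<le> tnorm \<Q> X * tnorm \<Q> Y"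
proof -
  obtain f where f: "f \<in> \<B>" "X = \<lbrakk>f\<rbrakk>" "\<And>n. \<nu> (f n) \<le> tnorm \<Q> X" using norm_rep[OF assms(1)] by blast
  obtain g where g: "g \<in> \<B>" "Y = \<lbrakk>g\<rbrakk>" "\<And>n. \<nu> (g n) \<le> tnorm \<Q> Y" using norm_rep[OF assms(2)] by blast
  have X0: "0 \<le> tnorm \<Q> X" unfolding f(2) by (rule norm_Q_nonneg[OF f(1)])
  have "tnorm \<Q> \<lbrakk>\<lambda>n. f n \<oplus> g n\<rbrakk> \<le> tnorm \<Q> X + tnorm \<Q> Y"
    using f(1) g(1) by (intro norm_Q_le order_trans[OF norm_laws(1) add_mono[OF f(3) g(3)]]) simp_all
  thus "tnorm \<Q> (tadd \<Q> X Y) \<le> tnorm \<Q> X + tnorm \<Q> Y" using f(1,2) g(1,2) by (simp add: ops_Q(3))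
  have "tnorm \<Q> \<lbrakk>\<lambda>n. f n \<otimes> g n\<rbrakk> \<le> tnorm \<Q> X * tnorm \<Q> Y"
    using f(1) g(1) X0 by (intro norm_Q_le order_trans[OF norm_laws(2) mult_mono[OF f(3) g(3)]]) simp_all
  thus "tnorm \<Q> (tmul \<Q> X Y) \<le> tnorm \<Q> X * tnorm \<Q> Y" using f(1,2) g(1,2) by (simp add: ops_Q(4))
qed

lemma n2_Q_le:
  assumes f: "f \<in> \<B>" and "\<And>\<eta>. \<eta> > 0 \<Longrightarrow> \<forall>\<^sub>F n in U. \<rho> (f n) < r + \<eta>"
  shows "n2 \<Q> \<lbrakk>f\<rbrakk> \<le> r"
proof (rule field_le_epsilon)
  fix \<eta> :: real assume "\<eta> > 0"
  hence "\<forall>\<^sub>F n in U. \<rho> (f n) \<le> r + \<eta>"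
    using assms(2)[of \<eta>] by (auto elim!: eventually_mono)
  thus "n2 \<Q> \<lbrakk>f\<rbrakk> \<le> r + \<eta>" by (intro tendsto_upperbound[OF n2_Q[OF f]]) simp_all
qed

lemma ball_complete_Q:
  assumes F: "\<And>n. F n \<in> tcarrier \<Q>" "\<And>n. tnorm \<Q> (F n) \<le> 1"
    and C: "\<forall>\<epsilon>>0. \<exists>N. \<forall>m\<ge>N. \<forall>n\<ge>N. n2 \<Q> (tsub \<Q> (F m) (F n)) < \<epsilon>"
  shows "\<exists>x\<in>tcarrier \<Q>. tnorm \<Q> x \<le> 1 \<and> (\<lambda>n. n2 \<Q> (tsub \<Q> (F n) x)) \<longlonglongrightarrow> 0"
proof -
  obtain N where N: "\<And>j m n. N j \<le> m \<Longrightarrow> N j \<le> n \<Longrightarrow> n2 \<Q> (tsub \<Q> (F m) (F n)) < 1 / real (Suc j)"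
    by (rule Cauchy_indices[OF C]) (rule that; assumption)
  have "\<exists>f. f \<in> \<B> \<and> F k = \<lbrakk>f\<rbrakk> \<and> (\<forall>n. \<nu> (f n) \<le> 1)" for k
    using norm_rep[OF F(1)[of k]] F(2)[of k] order_trans by metis
  then obtain f where f: "\<And>k. f k \<in> \<B>" "\<And>k. F k = \<lbrakk>f k\<rbrakk>" "\<And>k n. \<nu> (f k n) \<le> 1" by metis
  let ?S = "{c \<in> \<C>. \<nu> c \<le> 1}"
  obtain y where y: "\<And>n. y n \<in> ?S" "\<And>j \<eta>. \<eta> > 0 \<Longrightarrow> \<forall>\<^sub>F n in U. \<rho> (f (N j) n \<ominus> y n) < 1 / Suc j + \<eta>"
  proof (rule saturated_Cauchy_limit[of N f ?S "\<lambda>r \<eta> x. \<rho> x < r + \<eta>"])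
    show "f k n \<in> ?S" for k n using f by simp
    show "\<rho> x < r + \<eta>'" if "\<rho> x < r + \<eta>" "\<eta> \<le> \<eta>'" for r \<eta> \<eta>' and x :: 'a using that by simp
    fix j k and \<eta> :: real assume k: "N j \<le> k" and \<eta>: "\<eta> > 0"
    have "((\<lambda>n. \<rho> (f (N j) n \<ominus> f k n)) \<longlongrightarrow> n2 \<Q> (tsub \<Q> (F (N j)) (F k))) U"
      using n2_Q[of "\<lambda>n. f (N j) n \<ominus> f k n"] f(1) by (simp add: f(2) sub_Q)
    moreover have "n2 \<Q> (tsub \<Q> (F (N j)) (F k)) < 1 / Suc j + \<eta>" using N[of j "N j" k] k \<eta> by simp
    ultimately show "\<forall>\<^sub>F n in U. \<rho> (f (N j) n \<ominus> f k n) < 1 / Suc j + \<eta>" by (rule order_tendstoD)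
  qed (rule that; assumption)
  have yB: "y \<in> \<B>" using y(1) by (intro bseqI[of _ 1]) auto
  have near: "n2 \<Q> (tsub \<Q> (F (N j)) \<lbrakk>y\<rbrakk>) \<le> 1 / Suc j" for j
  proof -
    have "n2 \<Q> \<lbrakk>\<lambda>n. f (N j) n \<ominus> y n\<rbrakk> \<le> 1 / Suc j" using y(2) f(1) yB by (intro n2_Q_le) simp_all
    thus ?thesis using f(1) yB by (simp add: f(2) sub_Q)
  qed
  have "(\<lambda>n. n2 \<Q> (tsub \<Q> (F n) \<lbrakk>y\<rbrakk>)) \<longlonglongrightarrow> 0"
  proof (rule LIMSEQ_I)
    fix e :: real assume "e > 0"
    then obtain j where j: "1 / Suc j < e / 2" using nat_approx_posE[of "e / 2"] by auto
    have "norm (n2 \<Q> (tsub \<Q> (F n) \<lbrakk>y\<rbrakk>) - 0) < e" if n: "n \<ge> N j" for n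
    proof -
      have l1: "((\<lambda>i. \<rho> (f n i \<ominus> y i)) \<longlongrightarrow> n2 \<Q> (tsub \<Q> (F n) \<lbrakk>y\<rbrakk>)) U"
        using n2_Q[of "\<lambda>i. f n i \<ominus> y i"] f(1) yB by (simp add: f(2) sub_Q)
      have l2: "((\<lambda>i. \<rho> (f n i \<ominus> f (N j) i) + \<rho> (f (N j) i \<ominus> y i))
          \<longlongrightarrow> n2 \<Q> (tsub \<Q> (F n) (F (N j))) + n2 \<Q> (tsub \<Q> (F (N j)) \<lbrakk>y\<rbrakk>)) U"
        using n2_Q[of "\<lambda>i. f n i \<ominus> f (N j) i"] n2_Q[of "\<lambda>i. f (N j) i \<ominus> y i"] f(1) yB
        by (intro tendsto_add) (simp_all add: f(2) sub_Q)
      have "n2 \<Q> (tsub \<Q> (F n) \<lbrakk>y\<rbrakk>) \<le> n2 \<Q> (tsub \<Q> (F n) (F (N j))) + n2 \<Q> (tsub \<Q> (F (N j)) \<lbrakk>y\<rbrakk>)"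
        by (rule tendsto_le[OF _ l2 l1]) (use f(1) yB n2_diff_triangle in simp_all)
      moreover have "0 \<le> n2 \<Q> (tsub \<Q> (F n) \<lbrakk>y\<rbrakk>)"
        by (rule tendsto_lowerbound[OF l1]) (use f(1) yB in simp_all)
      ultimately show ?thesis using N[of j n "N j"] n near[of j] j by simp
    qed
    thus "\<exists>no. \<forall>n\<ge>no. norm (n2 \<Q> (tsub \<Q> (F n) \<lbrakk>y\<rbrakk>) - 0) < e" by blast
  qed
  moreover have "tnorm \<Q> \<lbrakk>y\<rbrakk> \<le> 1" using y(1) yB by (intro norm_Q_le) auto
  ultimately show ?thesis using yB by (intro bexI[of _ "\<lbrakk>y\<rbrakk>"]) simp_all
qed

lemma norm_complete_Q:
  assumes F: "\<And>n. F n \<in> tcarrier \<Q>"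
    and C: "\<forall>\<epsilon>>0. \<exists>N. \<forall>m\<ge>N. \<forall>n\<ge>N. tnorm \<Q> (tsub \<Q> (F m) (F n)) < \<epsilon>"
  shows "\<exists>x\<in>tcarrier \<Q>. (\<lambda>n. tnorm \<Q> (tsub \<Q> (F n) x)) \<longlonglongrightarrow> 0"
proof -
  obtain N where N: "\<And>j m n. N j \<le> m \<Longrightarrow> N j \<le> n \<Longrightarrow> tnorm \<Q> (tsub \<Q> (F m) (F n)) < 1 / real (Suc j)"
    by (rule Cauchy_indices[OF C]) (rule that; assumption)
  have "\<exists>f. f \<in> \<B> \<and> F k = \<lbrakk>f\<rbrakk> \<and> (\<forall>n. \<nu> (f n) \<le> tnorm \<Q> (F k))" for k
    using norm_rep[OF F(1)[of k]] by metis
  then obtain f where f: "\<And>k. f k \<in> \<B>" "\<And>k. F k = \<lbrakk>f k\<rbrakk>" "\<And>k n. \<nu> (f k n) \<le> tnorm \<Q> (F k)" by metis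
  have triangle: "tnorm \<Q> (tsub \<Q> \<lbrakk>a\<rbrakk> \<lbrakk>c\<rbrakk>) \<le> tnorm \<Q> (tsub \<Q> \<lbrakk>a\<rbrakk> \<lbrakk>b\<rbrakk>) + tnorm \<Q> (tsub \<Q> \<lbrakk>b\<rbrakk> \<lbrakk>c\<rbrakk>)"
    if "a \<in> \<B>" "b \<in> \<B>" "c \<in> \<B>" for a b c
  proof -
    have "a n \<ominus> c n = (a n \<ominus> b n) \<oplus> (b n \<ominus> c n)" for n using that by (intro tr_eqI) (simp_all add: alg)
    hence "tsub \<Q> \<lbrakk>a\<rbrakk> \<lbrakk>c\<rbrakk> = tadd \<Q> (tsub \<Q> \<lbrakk>a\<rbrakk> \<lbrakk>b\<rbrakk>) (tsub \<Q> \<lbrakk>b\<rbrakk> \<lbrakk>c\<rbrakk>)"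
      using that by (simp add: sub_Q ops_Q(3))
    thus ?thesis using norm_Q_add_mul(1)[of "tsub \<Q> \<lbrakk>a\<rbrakk> \<lbrakk>b\<rbrakk>" "tsub \<Q> \<lbrakk>b\<rbrakk> \<lbrakk>c\<rbrakk>"] that by (simp add: sub_Q)
  qed
  \<comment> \<open>This bounds the terms from \<open>N 0\<close> on, which is the range where
    \<open>saturated_Cauchy_limit\<close> asks for membership in \<open>S\<close>.\<close>
  define B where "B = tnorm \<Q> (F (N 0)) + 1"
  have FB: "tnorm \<Q> (F k) \<le> B" if k: "N 0 \<le> k" for k
  proof -
    have "f k n = f (N 0) n \<oplus> (f k n \<ominus> f (N 0) n)" for n using f(1) by (intro tr_eqI) (simp_all add: alg)
    hence "F k = \<lbrakk>\<lambda>n. f (N 0) n \<oplus> (f k n \<ominus> f (N 0) n)\<rbrakk>" unfolding f(2) by simp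
    also have "\<dots> = tadd \<Q> (F (N 0)) (tsub \<Q> (F k) (F (N 0)))" using f(1) by (simp add: f(2) sub_Q ops_Q(3))
    finally have "F k = tadd \<Q> (F (N 0)) (tsub \<Q> (F k) (F (N 0)))" .
    moreover have "tsub \<Q> (F k) (F (N 0)) \<in> tcarrier \<Q>" using f(1) by (simp add: f(2) sub_Q)
    ultimately have "tnorm \<Q> (F k) \<le> tnorm \<Q> (F (N 0)) + tnorm \<Q> (tsub \<Q> (F k) (F (N 0)))"
      using norm_Q_add_mul(1)[OF F] by metis
    thus ?thesis using N[of 0 k "N 0"] k by (simp add: B_def)
  qed
  \<comment> \<open>The operator norm of coordinates depends on the representative, so smallness in
    operator norm is expressed as small 2-norm distance to the ball of radius
    \<open>r\<close>.\<close>
  let ?S = "{c \<in> \<C>. \<nu> c \<le> B}" and ?D = "\<lambda>r \<eta> x. \<exists>h\<in>\<C>. \<nu> h \<le> r \<and> \<rho> (x \<ominus> h) < \<eta>"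
  obtain y where y: "\<And>n. y n \<in> ?S" "\<And>j \<eta>. \<eta> > 0 \<Longrightarrow> \<forall>\<^sub>F n in U. ?D (1 / Suc j) \<eta> (f (N j) n \<ominus> y n)"
  proof (rule saturated_Cauchy_limit[of N f ?S ?D])
    show "f k n \<in> ?S" if "N 0 \<le> k" for k n using f(1) f(3)[of k n] FB[OF that] by simp
    show "?D r \<eta>' x" if "?D r \<eta> x" "\<eta> \<le> \<eta>'" for r \<eta> \<eta>' x using that less_le_trans by blast
    fix j k and \<eta> :: real assume k: "N j \<le> k" and \<eta>: "\<eta> > 0"
    have d: "(\<lambda>n. f (N j) n \<ominus> f k n) \<in> \<B>" using f(1) by simp
    have "tnorm \<Q> \<lbrakk>\<lambda>n. f (N j) n \<ominus> f k n\<rbrakk> \<le> 1 / Suc j"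
      using N[of j "N j" k] k f(1) by (simp add: f(2) sub_Q)
    then obtain h where h: "h \<in> \<B>" "\<And>n. \<nu> (h n) \<le> 1 / Suc j" "\<lbrakk>\<lambda>n. f (N j) n \<ominus> f k n\<rbrakk> = \<lbrakk>h\<rbrakk>"
      by (rule ball_rep[OF d]) (rule that; assumption)
    hence "((\<lambda>n. \<rho> ((f (N j) n \<ominus> f k n) \<ominus> h n)) \<longlongrightarrow> 0) U"
      using ucls_eq_iff[OF d h(1)] by (simp add: eqv_def)
    hence "\<forall>\<^sub>F n in U. \<rho> ((f (N j) n \<ominus> f k n) \<ominus> h n) < \<eta>" using \<eta> by (rule order_tendstoD)
    thus "\<forall>\<^sub>F n in U. ?D (1 / Suc j) \<eta> (f (N j) n \<ominus> f k n)"
    proof eventually_elim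
      case (elim n)
      thus ?case using h(2)[of n] bseq_carrier[OF h(1), of n] by blast
    qed
  qed (rule that; assumption)
  have yB: "y \<in> \<B>" using y(1) by (intro bseqI[of _ B]) auto
  have near: "tnorm \<Q> (tsub \<Q> (F (N j)) \<lbrakk>y\<rbrakk>) \<le> 1 / Suc j" for j
  proof -
    have "tnorm \<Q> \<lbrakk>\<lambda>n. f (N j) n \<ominus> y n\<rbrakk> \<le> 1 / Suc j"
      using y(2) f(1) yB by (intro norm_Q_le_approx) simp_all
    thus ?thesis using f(1) yB by (simp add: f(2) sub_Q)
  qed
  have "(\<lambda>n. tnorm \<Q> (tsub \<Q> (F n) \<lbrakk>y\<rbrakk>)) \<longlonglongrightarrow> 0"
  proof (rule LIMSEQ_I)
    fix e :: real assume "e > 0"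
    then obtain j where j: "1 / Suc j < e / 2" using nat_approx_posE[of "e / 2"] by auto
    have "norm (tnorm \<Q> (tsub \<Q> (F n) \<lbrakk>y\<rbrakk>) - 0) < e" if n: "n \<ge> N j" for n
    proof -
      have "0 \<le> tnorm \<Q> (tsub \<Q> (F n) \<lbrakk>y\<rbrakk>)"
        using norm_Q_nonneg[of "\<lambda>i. f n i \<ominus> y i"] f(1) yB by (simp add: f(2) sub_Q)
      thus ?thesis using N[of j n "N j"] n near[of j] j triangle[OF f(1) f(1) yB, of n "N j"] by (simp add: f(2))
    qed
    thus "\<exists>no. \<forall>n\<ge>no. norm (tnorm \<Q> (tsub \<Q> (F n) \<lbrakk>y\<rbrakk>) - 0) < e" by blast
  qed
  thus ?thesis using yB by (intro bexI[of _ "\<lbrakk>y\<rbrakk>"]) simp_all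
qed

section \<open>Verification of the axioms for the ultrapower\<close>

lemma ucls_cong: "(\<And>n. f n = g n) \<Longrightarrow> \<lbrakk>f\<rbrakk> = \<lbrakk>g\<rbrakk>"
  by (rule arg_cong[of _ _ "ucls P U"]) (rule ext)

text \<open>The case numbers follow the order of the locale assumptions. Algebraic equations hold
  coordinatewise; norm axioms rest on representatives attaining the norm, and trace axioms on
  uniqueness of ultralimits.\<close>

theorem tracial_algebra_Q: "tracial_algebra \<Q>"
proof (rule tracial_algebra.intro, goal_cases)
  case 16
  show ?case
    by (auto simp: carrier_Q ops_Q(3,4) intro!: ucls_cong tr_eqI) (simp_all add: alg)
next
  case 17
  show ?case
    by (auto simp: carrier_Q ops_Q(4,5) intro!: ucls_cong tr_eqI) (simp_all add: alg)
next
  case 21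
  show ?case
  proof (intro ballI conjI)
    fix X assume X: "X \<in> tcarrier \<Q>"
    obtain f where f: "f \<in> \<B>" "X = \<lbrakk>f\<rbrakk>" "\<And>n. \<nu> (f n) \<le> tnorm \<Q> X" using norm_rep[OF X] by blast
    show "0 \<le> tnorm \<Q> X" unfolding f(2) by (rule norm_Q_nonneg[OF f(1)])
    show "tnorm \<Q> X = 0 \<longleftrightarrow> X = tzero \<Q>"
    proof
      assume "tnorm \<Q> X = 0"
      hence "\<nu> (f n) = 0" for n using f(3)[of n] norm_nonneg[OF bseq_carrier[OF f(1)], of n] by linarith
      hence "f n = \<zero>" for n using f(1) by (simp add: norm_zero_iff)
      thus "X = tzero \<Q>" unfolding f(2) ops_Q(1) by (rule ucls_cong)
    next
      assume "X = tzero \<Q>"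
      thus "tnorm \<Q> X = 0" using norm_Q_le[of "\<lambda>n. \<zero>" 0] norm_Q_nonneg[of "\<lambda>n. \<zero>"] by (simp add: ops_Q(1))
    qed
  qed
next
  case 22
  show ?case using norm_Q_add_mul by blast
next
  case 23
  show ?case
  proof (intro allI ballI antisym norm_Q_smult_le)
    fix a X assume X: "X \<in> tcarrier \<Q>"
    obtain f where f: "f \<in> \<B>" "X = \<lbrakk>f\<rbrakk>" using carrier_Q_E[OF X] by blast
    show "cmod a * tnorm \<Q> X \<le> tnorm \<Q> (tsmult \<Q> a X)"
    proof (cases "a = 0")
      case False
      have "tsmult \<Q> (1 / a) (tsmult \<Q> a X) = X" unfolding f(2) using f(1) False by (simp add: ops_Q(5))
      moreover have "tsmult \<Q> a X \<in> tcarrier \<Q>" using f by (simp add: ops_Q(5))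
      ultimately have "tnorm \<Q> X \<le> cmod (1 / a) * tnorm \<Q> (tsmult \<Q> a X)"
        using norm_Q_smult_le[of "tsmult \<Q> a X" "1 / a"] by simp
      thus ?thesis using False by (simp add: norm_divide field_simps)
    next
      case True
      thus ?thesis using norm_Q_nonneg[of "\<lambda>n. 0 \<odot> f n"] f by (simp add: ops_Q(5))
    qed
  qed
next
  case 24
  show ?case using norm_Q_cstar by blast
next
  case 25
  show ?case by (intro allI impI norm_complete_Q) simp_all
next
  case 26
  show ?case
  proof (intro ballI)
    fix X Y assume "X \<in> tcarrier \<Q>" "Y \<in> tcarrier \<Q>"
    then obtain f g where f: "f \<in> \<B>" "X = \<lbrakk>f\<rbrakk>" and g: "g \<in> \<B>" "Y = \<lbrakk>g\<rbrakk>" by (auto simp: carrier_Q)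
    show "ttr \<Q> (tadd \<Q> X Y) = ttr \<Q> X + ttr \<Q> Y"
      using tendsto_add[OF tr_Q[OF f(1)] tr_Q[OF g(1)]] tr_Q[of "\<lambda>n. f n \<oplus> g n"] f g
      by (intro tendsto_unique[OF U_nontrivial]) (simp_all add: ops_Q(3) tr_laws)
  qed
next
  case 27
  show ?case
  proof (intro allI ballI)
    fix a X assume "X \<in> tcarrier \<Q>"
    then obtain f where f: "f \<in> \<B>" "X = \<lbrakk>f\<rbrakk>" by (auto simp: carrier_Q)
    show "ttr \<Q> (tsmult \<Q> a X) = a * ttr \<Q> X"
      using tendsto_mult[OF tendsto_const tr_Q[OF f(1)]] tr_Q[of "\<lambda>n. a \<odot> f n"] f
      by (intro tendsto_unique[OF U_nontrivial]) (simp_all add: ops_Q(5) tr_laws)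
  qed
next
  case 28
  have "((\<lambda>n. 1) \<longlongrightarrow> ttr \<Q> (tone \<Q>)) U" using tr_Q[of "\<lambda>n. \<one>"] by (simp add: ops_Q(2) tr_laws)
  thus ?case by (simp add: tendsto_const_iff)
next
  case 29
  show ?case
  proof (intro ballI)
    fix X Y assume "X \<in> tcarrier \<Q>" "Y \<in> tcarrier \<Q>"
    then obtain f g where f: "f \<in> \<B>" "X = \<lbrakk>f\<rbrakk>" and g: "g \<in> \<B>" "Y = \<lbrakk>g\<rbrakk>" by (auto simp: carrier_Q)
    have "\<tau> (f n \<otimes> g n) = \<tau> (g n \<otimes> f n)" for n using f g by (intro tr_comm) simp_all
    thus "ttr \<Q> (tmul \<Q> X Y) = ttr \<Q> (tmul \<Q> Y X)"
      using tr_Q[of "\<lambda>n. f n \<otimes> g n"] tr_Q[of "\<lambda>n. g n \<otimes> f n"] f g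
      by (intro tendsto_unique[OF U_nontrivial]) (simp_all add: ops_Q(4))
  qed
next
  case 30
  show ?case
  proof (intro ballI)
    fix X assume "X \<in> tcarrier \<Q>"
    then obtain f where f: "f \<in> \<B>" "X = \<lbrakk>f\<rbrakk>" by (auto simp: carrier_Q)
    have lim: "((\<lambda>n. \<tau> ((f n)\<^sup>\<star> \<otimes> f n)) \<longlongrightarrow> ttr \<Q> (tmul \<Q> (tstar \<Q> X) X)) U"
      using tr_Q[of "\<lambda>n. (f n)\<^sup>\<star> \<otimes> f n"] f by (simp add: ops_Q(4,6))
    have "((\<lambda>n. 0) \<longlongrightarrow> Im (ttr \<Q> (tmul \<Q> (tstar \<Q> X) X))) U"
      using tendsto_Im[OF lim] f(1) by (simp add: tr_pos)
    moreover have "0 \<le> Re (ttr \<Q> (tmul \<Q> (tstar \<Q> X) X))"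
      by (rule tendsto_lowerbound[OF tendsto_Re[OF lim]]) (use f(1) tr_pos in simp_all)
    ultimately show "Im (ttr \<Q> (tmul \<Q> (tstar \<Q> X) X)) = 0 \<and> 0 \<le> Re (ttr \<Q> (tmul \<Q> (tstar \<Q> X) X))"
      by (simp add: tendsto_const_iff)
  qed
next
  case 31
  show ?case
  proof (intro ballI impI)
    fix X assume "X \<in> tcarrier \<Q>" and z: "ttr \<Q> (tmul \<Q> (tstar \<Q> X) X) = 0"
    then obtain f where f: "f \<in> \<B>" "X = \<lbrakk>f\<rbrakk>" by (auto simp: carrier_Q)
    have "f n \<ominus> \<zero> = f n" for n using f(1) by (intro tr_eqI) (simp_all add: alg)
    moreover have "n2 \<Q> X = 0" using z by (simp add: n2_def)
    ultimately have "eqv f (\<lambda>n. \<zero>)" using n2_Q[OF f(1)] f(2) by (simp add: eqv_def)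
    thus "X = tzero \<Q>" using f by (simp add: ops_Q(1) ucls_eq_iff)
  qed
next
  case 32
  show ?case by (intro allI impI ball_complete_Q) simp_all
qed (auto simp: carrier_Q ops_Q intro!: ucls_cong tr_eqI, (simp_all add: alg)?)

end

section \<open>Commutators, relative commutants and formulas\<close>

definition tcomm :: "'a tralg \<Rightarrow> 'a \<Rightarrow> 'a \<Rightarrow> 'a" where
  "tcomm Q x y = tsub Q (tmul Q x y) (tmul Q y x)"

lemma restr_simps [simp]:
  "tcarrier (restr Q S) = S" "tzero (restr Q S) = tzero Q" "tone (restr Q S) = tone Q"
  "tadd (restr Q S) = tadd Q" "tmul (restr Q S) = tmul Q" "tsmult (restr Q S) = tsmult Q"
  "tstar (restr Q S) = tstar Q" "tnorm (restr Q S) = tnorm Q" "ttr (restr Q S) = ttr Q"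
  "tsub (restr Q S) = tsub Q" "n2 (restr Q S) = n2 Q"
  by (auto simp: restr_def tsub_def n2_def fun_eq_iff)

context tracial_algebra
begin

lemma tcomm_closed [simp]: "x \<in> \<C> \<Longrightarrow> y \<in> \<C> \<Longrightarrow> tcomm P x y \<in> \<C>"
  by (simp add: tcomm_def)

lemma tcomm_eq_zero: "x \<in> \<C> \<Longrightarrow> y \<in> \<C> \<Longrightarrow> \<rho> (tcomm P x y) = 0 \<longleftrightarrow> x \<otimes> y = y \<otimes> x"
  using diff_eq_zero[of "x \<otimes> y" "y \<otimes> x"] by (auto simp: n2_zero_iff tcomm_def)

lemma n2_tcomm_le: "x \<in> \<C> \<Longrightarrow> y \<in> \<C> \<Longrightarrow> \<rho> (tcomm P x y) \<le> 2 * \<nu> x * \<rho> y"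
proof -
  assume a: "x \<in> \<C>" "y \<in> \<C>"
  have "\<rho> (tcomm P x y) \<le> \<rho> (x \<otimes> y) + \<rho> ((-1) \<odot> (y \<otimes> x))"
    unfolding tcomm_def tsub_def using a by (intro n2_add) simp_all
  thus ?thesis using n2_mul_left[OF a] n2_mul_right[OF a(2,1)] a by (simp add: n2_smult mult.commute)
qed

lemma tcomm_diff_right:
  "x \<in> \<C> \<Longrightarrow> y \<in> \<C> \<Longrightarrow> w \<in> \<C> \<Longrightarrow> tcomm P x y = tcomm P x (y \<ominus> w) \<oplus> tcomm P x w"
  unfolding tcomm_def by (intro tr_eqI) (simp_all add: alg)

text \<open>For fixed \<open>x\<close> the commutator is Lipschitz in its second argument for the
  2-norm, with constant \<open>2 * \<nu> x\<close>. The added 1 in the proof avoids division by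
  zero.\<close>

lemma commute_if_commute_dense:
  assumes x: "x \<in> \<C>" and s: "s \<in> \<C>" and d: "\<And>i. d i \<in> \<C>" "\<And>i. x \<otimes> d i = d i \<otimes> x"
    and dense: "\<And>\<epsilon>. \<epsilon> > 0 \<Longrightarrow> \<exists>i. \<rho> (s \<ominus> d i) < \<epsilon>"
  shows "x \<otimes> s = s \<otimes> x"
proof -
  have "\<rho> (tcomm P x s) \<le> 0 + e" if e: "e > 0" for e
  proof -
    have "e / (2 * \<nu> x + 1) > 0" using e norm_nonneg[OF x] by (intro divide_pos_pos) linarith+
    then obtain i where i: "\<rho> (s \<ominus> d i) < e / (2 * \<nu> x + 1)" using dense by blast
    have "tcomm P x (d i) = \<zero>" using d[of i] x by (simp add: tcomm_def)
    hence "tcomm P x s = tcomm P x (s \<ominus> d i)" using tcomm_diff_right[OF x s d(1)[of i]] x s d(1) by simp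
    hence "\<rho> (tcomm P x s) \<le> 2 * \<nu> x * \<rho> (s \<ominus> d i)" using n2_tcomm_le[of x "s \<ominus> d i"] x s d(1) by simp
    also have "\<dots> \<le> (2 * \<nu> x + 1) * (e / (2 * \<nu> x + 1))"
      using i x s d(1) by (intro mult_mono) (simp_all add: less_imp_le)
    also have "\<dots> = e" using norm_nonneg[OF x] by simp
    finally show ?thesis by simp
  qed
  hence "\<rho> (tcomm P x s) \<le> 0" by (rule field_le_epsilon)
  hence "\<rho> (tcomm P x s) = 0" by (rule antisym) (use x s in simp)
  thus ?thesis using x s by (simp add: tcomm_eq_zero)
qed

text \<open>Only the closure properties and the completeness axioms need an argument. A norm limit
  stays in the commutant by continuity. For a 2-norm limit, \<open>commute_if_commute_dense\<close>
  is used with the roles exchanged: \<open>s\<close> is the fixed factor, and the sequence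
  approximates \<open>x\<close>.\<close>

lemma tracial_algebra_relcomm:
  assumes M: "M \<subseteq> \<C>" and star: "\<And>s. s \<in> M \<Longrightarrow> s\<^sup>\<star> \<in> M"
  shows "tracial_algebra (restr P (relcomm P M))"
proof -
  let ?R = "relcomm P M"
  have R: "x \<in> \<C>" "\<And>s. s \<in> M \<Longrightarrow> x \<otimes> s = s \<otimes> x" if "x \<in> ?R" for x
    using that by (simp_all add: relcomm_def)
  have MC: "s \<in> \<C>" if "s \<in> M" for s using M that by blast
  have st: "x\<^sup>\<star> \<in> ?R" if x: "x \<in> ?R" for x
  proof -
    have "x\<^sup>\<star> \<otimes> s = s \<otimes> x\<^sup>\<star>" if s: "s \<in> M" for s
    proof -
      have "(s\<^sup>\<star> \<otimes> x)\<^sup>\<star> = (x \<otimes> s\<^sup>\<star>)\<^sup>\<star>" using R(2)[OF x star[OF s]] by simp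
      thus ?thesis using R(1)[OF x] MC[OF s] by (simp add: star_laws)
    qed
    thus ?thesis using R(1)[OF x] by (simp add: relcomm_def)
  qed
  have ml: "x \<otimes> y \<in> ?R" if x: "x \<in> ?R" and y: "y \<in> ?R" for x y
  proof -
    have "(x \<otimes> y) \<otimes> s = s \<otimes> x \<otimes> y" if s: "s \<in> M" for s
      using R[OF x] R[OF y] MC[OF s] s by (metis mul_laws(1))
    thus ?thesis using R(1)[OF x] R(1)[OF y] by (simp add: relcomm_def)
  qed
  have ad: "x \<oplus> y \<in> ?R" if x: "x \<in> ?R" and y: "y \<in> ?R" for x y
    using R[OF x] R[OF y] MC by (simp add: relcomm_def mul_laws)
  have sm: "c \<odot> x \<in> ?R" if x: "x \<in> ?R" for c x
    using R[OF x] MC by (simp add: relcomm_def mul_laws)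
  have zo: "\<zero> \<in> ?R" "\<one> \<in> ?R" using MC by (simp_all add: relcomm_def)
  have nc: "\<exists>x\<in>?R. (\<lambda>n. \<nu> (f n \<ominus> x)) \<longlonglongrightarrow> 0"
    if f: "\<And>n. f n \<in> ?R" and c: "\<forall>\<epsilon>>0. \<exists>N. \<forall>m\<ge>N. \<forall>n\<ge>N. \<nu> (f m \<ominus> f n) < \<epsilon>" for f
  proof -
    obtain x where x: "x \<in> \<C>" "(\<lambda>n. \<nu> (f n \<ominus> x)) \<longlonglongrightarrow> 0"
      using norm_complete[rule_format, of f] R(1)[OF f] c by blast
    have "x \<otimes> s = s \<otimes> x" if s: "s \<in> M" for s
      using norm_limit_star_commute(2)[OF R(1)[OF f] x MC[OF s]] R(2)[OF f s] by simp
    thus ?thesis using x by (intro bexI[of _ x]) (simp_all add: relcomm_def)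
  qed
  have bc: "\<exists>x\<in>?R. \<nu> x \<le> 1 \<and> (\<lambda>n. \<rho> (f n \<ominus> x)) \<longlonglongrightarrow> 0"
    if f: "\<And>n. f n \<in> ?R" "\<And>n. \<nu> (f n) \<le> 1"
      and c: "\<forall>\<epsilon>>0. \<exists>N. \<forall>m\<ge>N. \<forall>n\<ge>N. \<rho> (f m \<ominus> f n) < \<epsilon>" for f
  proof -
    obtain x where x: "x \<in> \<C>" "\<nu> x \<le> 1" "(\<lambda>n. \<rho> (f n \<ominus> x)) \<longlonglongrightarrow> 0"
      using ball_complete[rule_format, of f] R(1)[OF f(1)] f(2) c by blast
    have "s \<otimes> x = x \<otimes> s" if s: "s \<in> M" for s
    proof (rule commute_if_commute_dense[of s x f])
      show "s \<otimes> f i = f i \<otimes> s" for i using R(2)[OF f(1) s] by simp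
      fix \<epsilon> :: real assume "\<epsilon> > 0"
      with x(3) have "\<forall>\<^sub>F n in sequentially. \<rho> (f n \<ominus> x) < \<epsilon>" by (rule order_tendstoD)
      then obtain n where "\<rho> (f n \<ominus> x) < \<epsilon>" using eventually_happens'[OF sequentially_bot] by blast
      thus "\<exists>i. \<rho> (x \<ominus> f i) < \<epsilon>" using n2_minus_commute[OF R(1)[OF f(1)] x(1)] by metis
    qed (use x MC[OF s] R(1)[OF f(1)] in simp_all)
    thus ?thesis using x by (intro bexI[of _ x]) (simp_all add: relcomm_def)
  qed
  show ?thesis
  proof (rule tracial_algebra.intro, goal_cases)
    case 25 show ?case using nc by simp
  next
    case 32 show ?case using bc by simp
  next
    case 6 show ?case using R(1) add_comm_ax by simp
  next
    case 29 show ?case using R(1) tr_comm by simp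
  qed (use R(1) st ml ad sm zo in \<open>simp_all add: add_assoc_ax add_inverse_ax add_smult_ax smult_add_ax
      mul_laws star_laws norm_zero_iff norm_laws norm_cstar tr_laws tr_pos tr_faithful\<close>)
qed

end

section \<open>Formulas expressing the transferred conditions\<close>

definition pcomm :: "spoly \<Rightarrow> spoly \<Rightarrow> spoly" where
  "pcomm p q = PAdd (PMul p q) (PMul (PConst (-1)) (PMul q p))"

definition psq :: "spoly \<Rightarrow> spoly" where
  "psq p = PMul (PStar p) p"

primrec psum :: "(nat \<Rightarrow> spoly) \<Rightarrow> nat \<Rightarrow> spoly" where
  "psum p 0 = PConst 0"
| "psum p (Suc n) = PAdd (psum p n) (p n)"

text \<open>Conjunction of conditions of the form "value at most 0". The sum of positive parts is a
  continuous connective, vanishes exactly when all conditions hold, and dominates each single value,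
  so a small value means that every condition holds up to a small error.\<close>

definition FAnd :: "formula list \<Rightarrow> formula" where
  "FAnd \<phi>s = FConn (\<lambda>v. \<Sum>j<length \<phi>s. max 0 (v j)) \<phi>s"

text \<open>Variable layout: 0 is the element to be found, 1 is the test element, the even numbers from 2 on
  are the parameters from the small algebra, and the odd numbers from 3 on are the quantified tuple.\<close>

primrec FSups :: "(nat \<Rightarrow> real) \<Rightarrow> nat \<Rightarrow> formula \<Rightarrow> formula" where
  "FSups r 0 \<phi> = \<phi>"
| "FSups r (Suc m) \<phi> = FSup (2 * m + 3) (r m) (FSups r m \<phi>)"

text \<open>This is the assignment reached after opening the \<open>m\<close> suprema of
  \<open>FSups\<close> from the outside in, with values \<open>c (m - 1)\<close> down to
  \<open>c 0\<close>.\<close>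

primrec upd :: "(nat \<Rightarrow> 'a) \<Rightarrow> (nat \<Rightarrow> 'a) \<Rightarrow> nat \<Rightarrow> nat \<Rightarrow> 'a" where
  "upd \<beta> c 0 = \<beta>"
| "upd \<beta> c (Suc m) = upd (\<beta>(2 * m + 3 := c m)) c m"

definition F_comm :: "nat \<Rightarrow> formula" where
  "F_comm m = FRe (psum (\<lambda>i. psq (pcomm (PVar 0) (PVar (2 * i + 3)))) m)"

definition F_low :: "real \<Rightarrow> formula" where
  "F_low s = FRe (PAdd (PConst (of_real s)) (PMul (PConst (-1)) (psq (PVar 0))))"

text \<open>In a tracial algebra, value at most 0 says that the inequality with error
  \<open>1 / Suc k\<close> and penalty factor \<open>K\<close> holds on the whole unit ball.\<close>

definition F_central :: "nat \<Rightarrow> nat \<Rightarrow> formula" where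
  "F_central k K = FSup 1 1 (FRe (PAdd (PConst (of_real (- 1 / Suc k)))
     (PAdd (psq (pcomm (PVar 0) (PVar 1)))
       (PMul (PConst (- of_nat K)) (psum (\<lambda>i. psq (pcomm (PVar 1) (PVar (2 * i + 2)))) K)))))"

text \<open>Trace zero takes four entries, both signs of the real and of the imaginary part, because
  \<open>FAnd\<close> sees only positive parts.\<close>

definition F_rest :: "(nat \<Rightarrow> nat) \<Rightarrow> nat \<Rightarrow> formula list" where
  "F_rest K m = [FRe (PVar 0), FRe (PMul (PConst (-1)) (PVar 0)), FIm (PVar 0),
     FIm (PMul (PConst (-1)) (PVar 0))] @ map (\<lambda>k. F_central k (K k)) [0..<m]"

text \<open>\<open>R\<close> and \<open>s\<close> will be the norm and the squared 2-norm of the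
  original central element: candidates stay bounded and cannot degenerate to 0.\<close>

definition F_main :: "real \<Rightarrow> real \<Rightarrow> (nat \<Rightarrow> nat) \<Rightarrow> nat \<Rightarrow> formula" where
  "F_main R s K m = FInf 0 R (FAnd (F_comm m # F_low s # F_rest K m))"

lemma adm_FAnd: assumes "\<And>\<phi>. \<phi> \<in> set \<phi>s \<Longrightarrow> adm \<phi>" shows "adm (FAnd \<phi>s)"
proof -
  have "continuous_on UNIV (\<lambda>v :: nat \<Rightarrow> real. \<Sum>j<length \<phi>s. max 0 (v j))"
    by (intro continuous_on_sum continuous_on_max continuous_on_const continuous_on_product_coordinates)
  thus ?thesis unfolding FAnd_def using assms
    by (intro adm.intros) (auto intro: continuous_on_subset)
qed

lemma adm_FSups: "adm \<phi> \<Longrightarrow> adm (FSups r m \<phi>)"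
  by (induction m) (auto intro: adm.intros)

lemma adm_F_main: "adm (F_main R s K m)"
  unfolding F_main_def F_comm_def F_low_def F_rest_def F_central_def
  by (intro adm.intros adm_FAnd) (auto intro: adm.intros)

lemma feval_FAnd: "feval (FAnd \<phi>s) Q \<beta> = (\<Sum>j<length \<phi>s. max 0 (feval (\<phi>s ! j) Q \<beta>))"
  by (simp add: FAnd_def vecof_def)

lemma feval_FAnd_nonneg: "0 \<le> feval (FAnd \<phi>s) Q \<beta>"
  unfolding feval_FAnd by (rule sum_nonneg) simp

lemma feval_FAnd_member: assumes "\<phi> \<in> set \<phi>s" shows "feval \<phi> Q \<beta> \<le> feval (FAnd \<phi>s) Q \<beta>"
proof -
  obtain j where j: "j < length \<phi>s" "\<phi> = \<phi>s ! j" using assms by (auto simp: in_set_conv_nth)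
  have "feval \<phi> Q \<beta> \<le> max 0 (feval (\<phi>s ! j) Q \<beta>)" using j by simp
  also have "\<dots> \<le> feval (FAnd \<phi>s) Q \<beta>"
    unfolding feval_FAnd by (rule member_le_sum) (use j in auto)
  finally show ?thesis .
qed

lemma feval_FAnd_zero: "(\<And>\<phi>. \<phi> \<in> set \<phi>s \<Longrightarrow> feval \<phi> Q \<beta> \<le> 0) \<Longrightarrow> feval (FAnd \<phi>s) Q \<beta> = 0"
  unfolding feval_FAnd by (rule sum.neutral) (auto simp: max_def intro!: antisym)

lemma feval_FAnd_Cons: "feval (FAnd (\<phi> # \<phi>s)) Q \<beta> = max 0 (feval \<phi> Q \<beta>) + feval (FAnd \<phi>s) Q \<beta>"
  unfolding feval_FAnd length_Cons sum.lessThan_Suc_shift by simp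

lemma upd_other: "(\<And>i. i < m \<Longrightarrow> j \<noteq> 2 * i + 3) \<Longrightarrow> upd \<beta> c m j = \<beta> j"
  by (induction m arbitrary: \<beta>) auto

lemma upd_even: "upd \<beta> c m (2 * i + 2) = \<beta> (2 * i + 2)"
  by (rule upd_other) presburger

lemma upd_tuple: "i < m \<Longrightarrow> upd \<beta> c m (2 * i + 3) = c i"
proof (induction m arbitrary: \<beta>)
  case (Suc m)
  show ?case
  proof (cases "i = m")
    case True
    have "upd (\<beta>(2 * m + 3 := c m)) c m (2 * m + 3) = (\<beta>(2 * m + 3 := c m)) (2 * m + 3)"
      by (rule upd_other) auto
    thus ?thesis using True by simp
  qed (use Suc in simp)
qed simp

lemma upd_mem: "(\<And>j. \<beta> j \<in> S) \<Longrightarrow> (\<And>i. c i \<in> S) \<Longrightarrow> upd \<beta> c m j \<in> S"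
  by (induction m arbitrary: \<beta>) auto

text \<open>A real supremum dominates its members only when the set is bounded above, so the bound
  \<open>B\<close> is carried through the induction together with the inequality.\<close>

lemma feval_FSups_upper:
  assumes b: "\<And>\<beta>. (\<And>j. \<beta> j \<in> tcarrier Q) \<Longrightarrow> feval \<phi> Q \<beta> \<le> B"
    and c: "\<And>i. c i \<in> tcarrier Q" "\<And>i. tnorm Q (c i) \<le> r i" and \<beta>: "\<And>j. \<beta> j \<in> tcarrier Q"
  shows "feval (FSups r m \<phi>) Q \<beta> \<le> B \<and> feval \<phi> Q (upd \<beta> c m) \<le> feval (FSups r m \<phi>) Q \<beta>"
  using \<beta>
proof (induction m arbitrary: \<beta>)
  case 0 thus ?case using b by simp
next
  case (Suc m)
  let ?S = "{x \<in> tcarrier Q. tnorm Q x \<le> r m}" and ?f = "\<lambda>x. feval (FSups r m \<phi>) Q (\<beta>(2 * m + 3 := x))"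
  have IH: "?f x \<le> B \<and> feval \<phi> Q (upd (\<beta>(2 * m + 3 := x)) c m) \<le> ?f x" if "x \<in> tcarrier Q" for x
    using Suc.prems that by (intro Suc.IH) auto
  have cm: "c m \<in> ?S" using c by simp
  have "(SUP x\<in>?S. ?f x) \<le> B" by (rule cSUP_least) (use cm IH in auto)
  moreover have "?f (c m) \<le> (SUP x\<in>?S. ?f x)"
    by (rule cSUP_upper) (use cm IH in \<open>auto intro!: bdd_aboveI2\<close>)
  ultimately show ?case using IH[OF c(1)[of m]] by simp
qed

text \<open>The suprema change odd variables only, so the parameters at even places survive. The
  element \<open>z\<close> keeps each ball nonempty, without which the supremum could not be
  estimated.\<close>

lemma feval_FSups_least:
  assumes b: "\<And>\<beta>. (\<And>j. \<beta> j \<in> tcarrier Q) \<Longrightarrow> (\<And>i. \<beta> (2 * i + 2) = a i) \<Longrightarrow> feval \<phi> Q \<beta> \<le> B"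
    and r: "\<And>i. r i \<ge> 0" and z: "z \<in> tcarrier Q" "tnorm Q z = 0"
    and \<beta>: "\<And>j. \<beta> j \<in> tcarrier Q" "\<And>i. \<beta> (2 * i + 2) = a i"
  shows "feval (FSups r m \<phi>) Q \<beta> \<le> B"
  using \<beta>
proof (induction m arbitrary: \<beta>)
  case 0 thus ?case using b by simp
next
  case (Suc m)
  have "feval (FSups r m \<phi>) Q (\<beta>(2 * m + 3 := x)) \<le> B" if x: "x \<in> tcarrier Q" for x
  proof (rule Suc.IH)
    show "(\<beta>(2 * m + 3 := x)) (2 * i + 2) = a i" for i
      using Suc.prems(2)[of i] by (simp, presburger)
  qed (use Suc.prems x in simp)
  moreover have "z \<in> {x \<in> tcarrier Q. tnorm Q x \<le> r m}" using z r by simp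
  ultimately show ?case unfolding FSups.simps feval.simps by (intro cSUP_least) auto
qed

section \<open>Values of the formulas in a tracial algebra\<close>

context tracial_algebra
begin

lemma peval_closed [simp]: "(\<And>j. \<beta> j \<in> \<C>) \<Longrightarrow> peval p P \<beta> \<in> \<C>"
  by (induction p) simp_all

lemma peval_pcomm:
  "(\<And>j. \<beta> j \<in> \<C>) \<Longrightarrow> peval (pcomm p q) P \<beta> = tcomm P (peval p P \<beta>) (peval q P \<beta>)"
  by (simp add: pcomm_def tcomm_def tsub_def mul_laws)

lemma tr_psq: "(\<And>j. \<beta> j \<in> \<C>) \<Longrightarrow> Re (\<tau> (peval (psq p) P \<beta>)) = (\<rho> (peval p P \<beta>))\<^sup>2"
  by (simp add: psq_def n2_sq)

lemma tr_psum: "(\<And>j. \<beta> j \<in> \<C>) \<Longrightarrow> Re (\<tau> (peval (psum p n) P \<beta>)) = (\<Sum>i<n. Re (\<tau> (peval (p i) P \<beta>)))"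
  by (induction n) (simp_all add: tr_laws)

lemma tr_PConst_mul: "(\<And>j. \<beta> j \<in> \<C>) \<Longrightarrow> \<tau> (peval (PMul (PConst c) p) P \<beta>) = c * \<tau> (peval p P \<beta>)"
  by (simp add: mul_laws tr_laws)

lemma feval_F_comm:
  "(\<And>j. \<beta> j \<in> \<C>) \<Longrightarrow> feval (F_comm m) P \<beta> = (\<Sum>i<m. (\<rho> (tcomm P (\<beta> 0) (\<beta> (2 * i + 3))))\<^sup>2)"
  by (simp add: F_comm_def tr_psum tr_psq peval_pcomm)

lemma feval_F_low: "(\<And>j. \<beta> j \<in> \<C>) \<Longrightarrow> feval (F_low s) P \<beta> = s - (\<rho> (\<beta> 0))\<^sup>2"
  using tr_PConst_mul[of \<beta> "-1" "psq (PVar 0)"] tr_psq[of \<beta> "PVar 0"]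
  by (simp add: F_low_def tr_laws)

lemma feval_F_central:
  assumes \<beta>: "\<And>j. \<beta> j \<in> \<C>"
  shows "feval (F_central k K) P \<beta> = (SUP y\<in>{y \<in> \<C>. \<nu> y \<le> 1}.
    (\<rho> (tcomm P (\<beta> 0) y))\<^sup>2 - 1 / Suc k - K * (\<Sum>i<K. (\<rho> (tcomm P y (\<beta> (2 * i + 2))))\<^sup>2))"
proof -
  have "feval (FRe (PAdd (PConst (of_real (- 1 / Suc k))) (PAdd (psq (pcomm (PVar 0) (PVar 1)))
       (PMul (PConst (- of_nat K)) (psum (\<lambda>i. psq (pcomm (PVar 1) (PVar (2 * i + 2)))) K))))) P (\<beta>(1 := y))
    = (\<rho> (tcomm P (\<beta> 0) y))\<^sup>2 - 1 / Suc k - K * (\<Sum>i<K. (\<rho> (tcomm P y (\<beta> (2 * i + 2))))\<^sup>2)"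
    if y: "y \<in> \<C>" for y
  proof -
    let ?\<beta> = "\<beta>(1 := y)" and ?p = "psum (\<lambda>i. psq (pcomm (PVar 1) (PVar (2 * i + 2)))) K"
    have b: "?\<beta> j \<in> \<C>" for j using \<beta> y by simp
    have "Re (\<tau> (peval ?p P ?\<beta>)) = (\<Sum>i<K. (\<rho> (tcomm P y (\<beta> (2 * i + 2))))\<^sup>2)"
      unfolding tr_psum[OF b] tr_psq[OF b] peval_pcomm[OF b] by simp
    hence "Re (\<tau> (peval (PMul (PConst (- of_nat K)) ?p) P ?\<beta>))
        = - (K * (\<Sum>i<K. (\<rho> (tcomm P y (\<beta> (2 * i + 2))))\<^sup>2))"
      unfolding tr_PConst_mul[of ?\<beta>, OF b] by (simp del: fun_upd_apply)
    moreover have "Re (\<tau> (peval (psq (pcomm (PVar 0) (PVar 1))) P ?\<beta>)) = (\<rho> (tcomm P (\<beta> 0) y))\<^sup>2"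
      unfolding tr_psq[OF b] using b by (simp add: peval_pcomm)
    moreover have "Re (\<tau> (peval (PAdd (PConst (of_real (- 1 / Suc k))) (PAdd (psq (pcomm (PVar 0) (PVar 1)))
       (PMul (PConst (- of_nat K)) ?p))) P ?\<beta>)) = - 1 / Suc k
       + (Re (\<tau> (peval (psq (pcomm (PVar 0) (PVar 1))) P ?\<beta>)) + Re (\<tau> (peval (PMul (PConst (- of_nat K)) ?p) P ?\<beta>)))"
      unfolding peval.simps(2,3) using peval_closed[of ?\<beta>, OF b] by (simp add: tr_laws del: peval.simps fun_upd_apply)
    ultimately show ?thesis unfolding feval.simps by simp
  qed
  thus ?thesis unfolding F_central_def feval.simps(4) by (intro SUP_cong) simp_all
qed

lemma central_le:
  assumes \<beta>: "\<And>j. \<beta> j \<in> \<C>" and y: "y \<in> \<C>" "\<nu> y \<le> 1"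
  shows "(\<rho> (tcomm P (\<beta> 0) y))\<^sup>2 - 1 / Suc k - K * (\<Sum>i<K. (\<rho> (tcomm P y (\<beta> (2 * i + 2))))\<^sup>2)
    \<le> feval (F_central k K) P \<beta>"
  unfolding feval_F_central[OF \<beta>]
proof (rule cSUP_upper)
  \<comment> \<open>Dropping the two subtracted nonnegative terms leaves the squared commutator,
    which is bounded on the unit ball by the square of twice the norm of
    \<open>\<beta> 0\<close>.\<close>
  show "bdd_above ((\<lambda>y. (\<rho> (tcomm P (\<beta> 0) y))\<^sup>2 - 1 / Suc k - K * (\<Sum>i<K. (\<rho> (tcomm P y (\<beta> (2 * i + 2))))\<^sup>2))
      ` {y \<in> \<C>. \<nu> y \<le> 1})"
  proof (rule bdd_aboveI2)
    fix y assume "y \<in> {y \<in> \<C>. \<nu> y \<le> 1}"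
    hence y: "y \<in> \<C>" "\<nu> y \<le> 1" by simp_all
    have "\<rho> (tcomm P (\<beta> 0) y) \<le> 2 * \<nu> (\<beta> 0) * \<rho> y" using \<beta> y by (intro n2_tcomm_le)
    also have "\<dots> \<le> 2 * \<nu> (\<beta> 0) * 1" using \<beta> y n2_le_norm[of y] by (intro mult_left_mono) simp_all
    finally have "(\<rho> (tcomm P (\<beta> 0) y))\<^sup>2 \<le> (2 * \<nu> (\<beta> 0) * 1)\<^sup>2" using \<beta> y by (intro power_mono) simp_all
    moreover have "0 \<le> 1 / real (Suc k)" "0 \<le> K * (\<Sum>i<K. (\<rho> (tcomm P y (\<beta> (2 * i + 2))))\<^sup>2)"
      by (simp_all add: sum_nonneg)
    ultimately show "(\<rho> (tcomm P (\<beta> 0) y))\<^sup>2 - 1 / Suc k - K * (\<Sum>i<K. (\<rho> (tcomm P y (\<beta> (2 * i + 2))))\<^sup>2)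
        \<le> (2 * \<nu> (\<beta> 0) * 1)\<^sup>2" by linarith
  qed
qed (use y in simp)

lemma F_central_nonpos:
  assumes \<beta>: "\<And>j. \<beta> j \<in> \<C>"
    and "\<And>y. y \<in> \<C> \<Longrightarrow> \<nu> y \<le> 1 \<Longrightarrow>
      (\<rho> (tcomm P (\<beta> 0) y))\<^sup>2 \<le> 1 / Suc k + K * (\<Sum>i<K. (\<rho> (tcomm P y (\<beta> (2 * i + 2))))\<^sup>2)"
  shows "feval (F_central k K) P \<beta> \<le> 0"
  unfolding feval_F_central[OF \<beta>]
proof (rule cSUP_least)
  have "\<zero> \<in> {y \<in> \<C>. \<nu> y \<le> 1}" by simp
  thus "{y \<in> \<C>. \<nu> y \<le> 1} \<noteq> {}" by blast
qed (use assms(2) in fastforce)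

lemma F_rest_nonpos:
  assumes \<beta>: "\<And>j. \<beta> j \<in> \<C>" and "\<tau> (\<beta> 0) = 0"
    and "\<And>k y. k < m \<Longrightarrow> y \<in> \<C> \<Longrightarrow> \<nu> y \<le> 1 \<Longrightarrow>
      (\<rho> (tcomm P (\<beta> 0) y))\<^sup>2 \<le> 1 / Suc k + K k * (\<Sum>i<K k. (\<rho> (tcomm P y (\<beta> (2 * i + 2))))\<^sup>2)"
    and "\<phi> \<in> set (F_rest K m)"
  shows "feval \<phi> P \<beta> \<le> 0"
proof -
  have "feval (FRe (PMul (PConst (-1)) (PVar 0))) P \<beta> = 0" "feval (FIm (PMul (PConst (-1)) (PVar 0))) P \<beta> = 0"
    unfolding feval.simps tr_PConst_mul[OF \<beta>] using assms(2) by simp_all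
  moreover have "feval (F_central k (K k)) P \<beta> \<le> 0" if "k < m" for k
    by (rule F_central_nonpos[OF \<beta> assms(3)[OF that]])
  ultimately show ?thesis using assms(2,4) by (auto simp: F_rest_def simp del: peval.simps(4))
qed

lemma feval_F_main_le:
  assumes "x \<in> \<C>" "\<nu> x \<le> R"
  shows "feval (F_main R s K m) P \<beta> \<le> feval (FAnd (F_comm m # F_low s # F_rest K m)) P (\<beta>(0 := x))"
  unfolding F_main_def feval.simps
  by (rule cINF_lower) (use assms feval_FAnd_nonneg in \<open>auto intro!: bdd_belowI2\<close>)

text \<open>The candidate 0 meets every condition except the lower bound on its 2-norm, which it
  misses by exactly \<open>s\<close>. The bound is uniform in \<open>\<beta>\<close>, as
  \<open>feval_FSups_upper\<close> requires.\<close>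

lemma F_main_bounded:
  assumes \<beta>: "\<And>j. \<beta> j \<in> \<C>" and R: "R \<ge> 0" and s: "s \<ge> 0"
  shows "feval (F_main R s K m) P \<beta> \<le> s"
proof -
  let ?\<beta> = "\<beta>(0 := \<zero>)"
  have b: "?\<beta> j \<in> \<C>" for j using \<beta> by simp
  have z: "tcomm P \<zero> y = \<zero>" if "y \<in> \<C>" for y using that by (simp add: tcomm_def)
  have "feval (FAnd (F_rest K m)) P ?\<beta> = 0"
  proof (rule feval_FAnd_zero, rule F_rest_nonpos[OF b])
    fix k y assume "y \<in> \<C>"
    thus "(\<rho> (tcomm P (?\<beta> 0) y))\<^sup>2 \<le> 1 / Suc k + K k * (\<Sum>i<K k. (\<rho> (tcomm P y (?\<beta> (2 * i + 2))))\<^sup>2)"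
      by (simp add: z sum_nonneg)
  qed simp
  moreover have "feval (F_comm m) P ?\<beta> = 0" unfolding feval_F_comm[OF b] using \<beta> z by simp
  moreover have "feval (F_low s) P ?\<beta> = s" unfolding feval_F_low[OF b] by simp
  ultimately have "feval (FAnd (F_comm m # F_low s # F_rest K m)) P ?\<beta> = s"
    unfolding feval_FAnd_Cons using s by simp
  thus ?thesis using feval_F_main_le[of "\<zero>" R s K m \<beta>] R by simp
qed

text \<open>An infimum below \<open>\<epsilon>\<close> is undercut by an actual element of the ball,
  and the value of \<open>FAnd\<close> there dominates each conjunct. The infimum need not be
  attained, so an error of \<open>\<epsilon>\<close> remains in every condition.\<close>

lemma F_main_witness:
  assumes \<beta>: "\<And>j. \<beta> j \<in> \<C>" and R: "R \<ge> 0" and lt: "feval (F_main R s K m) P \<beta> < \<epsilon>"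
  obtains x where "x \<in> \<C>" "\<nu> x \<le> R" "\<And>i. i < m \<Longrightarrow> (\<rho> (tcomm P x (\<beta> (2 * i + 3))))\<^sup>2 < \<epsilon>"
    "s - (\<rho> x)\<^sup>2 < \<epsilon>" "\<bar>Re (\<tau> x)\<bar> < \<epsilon>" "\<bar>Im (\<tau> x)\<bar> < \<epsilon>"
    "\<And>k y. k < m \<Longrightarrow> y \<in> \<C> \<Longrightarrow> \<nu> y \<le> 1 \<Longrightarrow>
      (\<rho> (tcomm P x y))\<^sup>2 - 1 / Suc k - K k * (\<Sum>i<K k. (\<rho> (tcomm P y (\<beta> (2 * i + 2))))\<^sup>2) < \<epsilon>"
proof -
  let ?L = "F_comm m # F_low s # F_rest K m"
  have "\<zero> \<in> {x \<in> \<C>. \<nu> x \<le> R}" using R by simp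
  hence "(\<lambda>x. feval (FAnd ?L) P (\<beta>(0 := x))) ` {x \<in> \<C>. \<nu> x \<le> R} \<noteq> {}" by blast
  from cInf_lessD[OF this] lt obtain x where x: "x \<in> \<C>" "\<nu> x \<le> R" "feval (FAnd ?L) P (\<beta>(0 := x)) < \<epsilon>"
    unfolding F_main_def feval.simps by blast
  let ?\<beta> = "\<beta>(0 := x)"
  have b: "?\<beta> j \<in> \<C>" for j using \<beta> x by simp
  have mem: "feval \<phi> P ?\<beta> < \<epsilon>" if "\<phi> \<in> set ?L" for \<phi>
    using feval_FAnd_member[OF that, of P ?\<beta>] x(3) by linarith
  show ?thesis
  proof (rule that[OF x(1,2)])
    have "(\<Sum>i<m. (\<rho> (tcomm P x (\<beta> (2 * i + 3))))\<^sup>2) < \<epsilon>"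
      using mem[of "F_comm m"] unfolding feval_F_comm[OF b] by simp
    thus "(\<rho> (tcomm P x (\<beta> (2 * i + 3))))\<^sup>2 < \<epsilon>" if "i < m" for i
      using member_le_sum[of i "{..<m}" "\<lambda>i. (\<rho> (tcomm P x (\<beta> (2 * i + 3))))\<^sup>2"] that by simp
    show "s - (\<rho> x)\<^sup>2 < \<epsilon>" using mem[of "F_low s"] unfolding feval_F_low[OF b] by simp
    have "feval (FRe (PVar 0)) P ?\<beta> < \<epsilon>" "feval (FRe (PMul (PConst (-1)) (PVar 0))) P ?\<beta> < \<epsilon>"
      "feval (FIm (PVar 0)) P ?\<beta> < \<epsilon>" "feval (FIm (PMul (PConst (-1)) (PVar 0))) P ?\<beta> < \<epsilon>"
      by (intro mem; simp add: F_rest_def)+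
    thus "\<bar>Re (\<tau> x)\<bar> < \<epsilon>" "\<bar>Im (\<tau> x)\<bar> < \<epsilon>"
      unfolding feval.simps tr_PConst_mul[OF b] by (simp_all add: abs_less_iff)
    fix k y assume "k < m" and y: "y \<in> \<C>" "\<nu> y \<le> 1"
    hence "feval (F_central k (K k)) P ?\<beta> < \<epsilon>" by (intro mem) (simp add: F_rest_def)
    thus "(\<rho> (tcomm P x y))\<^sup>2 - 1 / Suc k - K k * (\<Sum>i<K k. (\<rho> (tcomm P y (\<beta> (2 * i + 2))))\<^sup>2) < \<epsilon>"
      using central_le[of ?\<beta>, OF b y, of k "K k"] by simp
  qed
qed

end

section \<open>Transfer of central elements\<close>

lemma dense_sequence:
  assumes "separable (restr Q M)" and "z \<in> M"
  obtains d :: "nat \<Rightarrow> 'a" where "\<And>i. d i \<in> M" "\<And>s \<epsilon>. s \<in> M \<Longrightarrow> \<epsilon> > 0 \<Longrightarrow> \<exists>i. n2 Q (tsub Q s (d i)) < \<epsilon>"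
proof -
  obtain D where D: "countable D" "D \<subseteq> M" "\<forall>x\<in>M. \<forall>\<epsilon>>0. \<exists>d\<in>D. n2 Q (tsub Q x d) < \<epsilon>"
    using assms(1) unfolding separable_def restr_simps by blast
  have ne: "D \<noteq> {}" using D(3) assms(2) zero_less_one by blast
  show ?thesis
  proof (rule that[of "from_nat_into D"])
    show "from_nat_into D i \<in> M" for i using from_nat_into[OF ne, of i] D(2) by blast
    fix s and \<epsilon> :: real assume "s \<in> M" "\<epsilon> > 0"
    then obtain d where "d \<in> D" "n2 Q (tsub Q s d) < \<epsilon>" using D(3) by blast
    thus "\<exists>i. n2 Q (tsub Q s (from_nat_into D i)) < \<epsilon>"
      using from_nat_into_surj[OF D(1)] by metis
  qed
qed

context tracial_ultrapower
begin

interpretation T: tracial_algebra \<Q> by (rule tracial_algebra_Q)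

lemma tcomm_bseq [simp]: "f \<in> \<B> \<Longrightarrow> g \<in> \<B> \<Longrightarrow> (\<lambda>n. tcomm P (f n) (g n)) \<in> \<B>"
  by (simp add: tcomm_def)

lemma tcomm_Q_lim:
  assumes "f \<in> \<B>" "g \<in> \<B>"
  shows "((\<lambda>n. (\<rho> (tcomm P (f n) (g n)))\<^sup>2) \<longlongrightarrow> (n2 \<Q> (tcomm \<Q> \<lbrakk>f\<rbrakk> \<lbrakk>g\<rbrakk>))\<^sup>2) U"
proof -
  have "tcomm \<Q> \<lbrakk>f\<rbrakk> \<lbrakk>g\<rbrakk> = \<lbrakk>\<lambda>n. tcomm P (f n) (g n)\<rbrakk>"
    unfolding tcomm_def using assms by (simp add: ops_Q(4) sub_Q)
  thus ?thesis using n2_Q[OF tcomm_bseq[OF assms]] by (intro tendsto_power) simp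
qed

lemma carrier_seq_rep:
  assumes "\<And>i. a i \<in> tcarrier \<Q>"
  obtains f where "\<And>i. f i \<in> \<B>" "\<And>i. a i = \<lbrakk>f i\<rbrakk>"
proof -
  have "\<forall>i. \<exists>f. f \<in> \<B> \<and> a i = \<lbrakk>f\<rbrakk>" using assms by (auto simp: carrier_Q)
  then obtain f where "\<forall>i. f i \<in> \<B> \<and> a i = \<lbrakk>f i\<rbrakk>" by (rule choice[THEN exE])
  thus ?thesis using that by blast
qed

text \<open>By saturation, the failure of the bound for every \<open>K\<close> would produce an element of the relative
  commutant of \<open>M\<close> that does not commute with \<open>x\<close>.\<close>
lemma central_modulus:
  fixes a :: "nat \<Rightarrow> (nat \<Rightarrow> 'a) set"
  assumes a: "\<And>i. a i \<in> tcarrier \<Q>" and x: "x \<in> tcarrier \<Q>"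
    and central: "\<And>y. y \<in> tcarrier \<Q> \<Longrightarrow> (\<And>i. tmul \<Q> y (a i) = tmul \<Q> (a i) y) \<Longrightarrow> tmul \<Q> x y = tmul \<Q> y x"
    and \<delta>: "\<delta> > 0"
  shows "\<exists>K::nat. \<forall>y\<in>tcarrier \<Q>. tnorm \<Q> y \<le> 1 \<longrightarrow>
    (n2 \<Q> (tcomm \<Q> x y))\<^sup>2 \<le> \<delta> + K * (\<Sum>i<K. (n2 \<Q> (tcomm \<Q> y (a i)))\<^sup>2)"
proof (rule ccontr)
  assume "\<not> ?thesis"
  hence "\<forall>K::nat. \<exists>y. y \<in> tcarrier \<Q> \<and> tnorm \<Q> y \<le> 1 \<and>
    (n2 \<Q> (tcomm \<Q> x y))\<^sup>2 > \<delta> + K * (\<Sum>i<K. (n2 \<Q> (tcomm \<Q> y (a i)))\<^sup>2)" by (auto simp: not_le)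
  then obtain y where y: "\<And>K. y K \<in> tcarrier \<Q>" "\<And>K. tnorm \<Q> (y K) \<le> 1"
    "\<And>K. (n2 \<Q> (tcomm \<Q> x (y K)))\<^sup>2 > \<delta> + real K * (\<Sum>i<K. (n2 \<Q> (tcomm \<Q> (y K) (a i)))\<^sup>2)" by metis
  obtain f where f: "\<And>i. f i \<in> \<B>" "\<And>i. a i = \<lbrakk>f i\<rbrakk>" by (rule carrier_seq_rep[OF a]) (rule that; assumption)
  obtain h where h: "h \<in> \<B>" "x = \<lbrakk>h\<rbrakk>" using carrier_Q_E[OF x] by blast
  \<comment> \<open>A strict bound, uniform in \<open>K\<close>, for the squared commutators of
    \<open>x\<close> with the unit ball; it forces the penalty sums below
    \<open>L / K\<close>.\<close>
  define L where "L = (2 * tnorm \<Q> x)\<^sup>2 + 1"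
  have L: "(n2 \<Q> (tcomm \<Q> x (y K)))\<^sup>2 < L" for K
  proof -
    have "n2 \<Q> (tcomm \<Q> x (y K)) \<le> 2 * tnorm \<Q> x * n2 \<Q> (y K)" by (rule T.n2_tcomm_le[OF x y(1)])
    also have "\<dots> \<le> 2 * tnorm \<Q> x * 1"
      using T.n2_le_norm[OF y(1)[of K]] y(2)[of K] x by (intro mult_left_mono) simp_all
    finally have "(n2 \<Q> (tcomm \<Q> x (y K)))\<^sup>2 \<le> (2 * tnorm \<Q> x)\<^sup>2"
      using x y(1) by (intro power_mono) simp_all
    thus ?thesis by (simp add: L_def)
  qed
  \<comment> \<open>The counterexample for \<open>Suc m\<close> is used, so that division by the
    penalty factor is possible at \<open>m = 0\<close> as well.\<close>
  have small: "(n2 \<Q> (tcomm \<Q> (y (Suc m)) (a i)))\<^sup>2 < L / Suc m" if "i < m" for i m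
  proof -
    have "(n2 \<Q> (tcomm \<Q> (y (Suc m)) (a i)))\<^sup>2 \<le> (\<Sum>i<Suc m. (n2 \<Q> (tcomm \<Q> (y (Suc m)) (a i)))\<^sup>2)"
      by (rule member_le_sum) (use that in auto)
    moreover have "real (Suc m) * (\<Sum>i<Suc m. (n2 \<Q> (tcomm \<Q> (y (Suc m)) (a i)))\<^sup>2) < L"
      using y(3)[of "Suc m"] L[of "Suc m"] \<delta> by linarith
    ultimately show ?thesis
      by (simp only: pos_less_divide_eq[OF of_nat_0_less_iff[THEN iffD2, OF zero_less_Suc]])
        (metis (no_types, lifting) mult.commute mult_left_mono of_nat_0_le_iff order_le_less_trans)
  qed
  let ?S = "{c \<in> \<C>. \<nu> c \<le> 1}"
  \<comment> \<open>The first condition keeps the commutator with \<open>x\<close> away from 0, the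
    others drive the commutators with the \<open>a i\<close> to 0. A solution of all stages
    contradicts \<open>central\<close>.\<close>
  let ?A = "\<lambda>m n c. (\<rho> (tcomm P (h n) c))\<^sup>2 > \<delta> \<and> (\<forall>i<m. (\<rho> (tcomm P c (f i n)))\<^sup>2 < L / Suc m)"
  obtain c where c: "\<And>n. c n \<in> ?S" "\<And>m. \<forall>\<^sub>F n in U. ?A m n (c n)"
  proof (rule saturation[OF ultra, of ?S ?A])
    have "\<zero> \<in> ?S" by simp
    thus "?S \<noteq> {}" by blast
    have "L \<ge> 0" by (simp add: L_def)
    hence "L / Suc (Suc m) \<le> L / Suc m" for m by (intro divide_left_mono) simp_all
    thus "?A m n c" if "?A (Suc m) n c" for m n c
      using that less_le_trans less_SucI by blast
    fix m
    obtain g where g: "g \<in> \<B>" "y (Suc m) = \<lbrakk>g\<rbrakk>" "\<And>n. \<nu> (g n) \<le> tnorm \<Q> (y (Suc m))"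
      using norm_rep[OF y(1)] by blast
    have "\<forall>\<^sub>F n in U. \<delta> < (\<rho> (tcomm P (h n) (g n)))\<^sup>2"
    proof (rule order_tendstoD(1)[OF tcomm_Q_lim[OF h(1) g(1)]])
      have "0 \<le> real (Suc m) * (\<Sum>i<Suc m. (n2 \<Q> (tcomm \<Q> (y (Suc m)) (a i)))\<^sup>2)" by (simp add: sum_nonneg)
      thus "\<delta> < (n2 \<Q> (tcomm \<Q> \<lbrakk>h\<rbrakk> \<lbrakk>g\<rbrakk>))\<^sup>2" using y(3)[of "Suc m"] h(2) g(2) by simp
    qed
    moreover have "\<forall>\<^sub>F n in U. \<forall>i\<in>{..<m}. (\<rho> (tcomm P (g n) (f i n)))\<^sup>2 < L / Suc m"
    proof (subst eventually_ball_finite_distrib, simp, intro ballI)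
      fix i assume "i \<in> {..<m}"
      hence "(n2 \<Q> (tcomm \<Q> \<lbrakk>g\<rbrakk> \<lbrakk>f i\<rbrakk>))\<^sup>2 < L / Suc m" using small[of i m] f(2)[of i] g(2) by simp
      thus "\<forall>\<^sub>F n in U. (\<rho> (tcomm P (g n) (f i n)))\<^sup>2 < L / Suc m"
        by (rule order_tendstoD(2)[OF tcomm_Q_lim[OF g(1) f(1)]])
    qed
    ultimately show "\<forall>\<^sub>F n in U. \<exists>c\<in>?S. ?A m n c"
    proof eventually_elim
      case (elim n)
      moreover have "g n \<in> ?S" using g(1) g(3)[of n] y(2)[of "Suc m"] by simp
      ultimately show ?case by blast
    qed
  qed (rule that; assumption)
  have cB: "c \<in> \<B>" using c(1) by (intro bseqI[of _ 1]) auto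
  have "tmul \<Q> \<lbrakk>c\<rbrakk> (a i) = tmul \<Q> (a i) \<lbrakk>c\<rbrakk>" for i
  proof -
    have "(n2 \<Q> (tcomm \<Q> \<lbrakk>c\<rbrakk> \<lbrakk>f i\<rbrakk>))\<^sup>2 \<le> 0"
    proof (rule LIMSEQ_le_const[of "\<lambda>m. L / Suc m"])
      show "(\<lambda>m. L / Suc m) \<longlonglongrightarrow> 0" using LIMSEQ_Suc[OF lim_const_over_n[of L]] by simp
      have "(n2 \<Q> (tcomm \<Q> \<lbrakk>c\<rbrakk> \<lbrakk>f i\<rbrakk>))\<^sup>2 \<le> L / Suc m" if m: "m \<ge> Suc i" for m
        by (rule tendsto_upperbound[OF tcomm_Q_lim[OF cB f(1)]])
          (use m c(2)[of m] in \<open>auto elim!: eventually_mono simp: less_imp_le\<close>)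
      thus "\<exists>N. \<forall>m\<ge>N. (n2 \<Q> (tcomm \<Q> \<lbrakk>c\<rbrakk> \<lbrakk>f i\<rbrakk>))\<^sup>2 \<le> L / Suc m" by blast
    qed
    hence "n2 \<Q> (tcomm \<Q> \<lbrakk>c\<rbrakk> \<lbrakk>f i\<rbrakk>) = 0" by simp
    thus ?thesis using T.tcomm_eq_zero[of "\<lbrakk>c\<rbrakk>" "\<lbrakk>f i\<rbrakk>"] cB f(1) by (simp add: f(2))
  qed
  hence "tmul \<Q> x \<lbrakk>c\<rbrakk> = tmul \<Q> \<lbrakk>c\<rbrakk> x" using central[of "\<lbrakk>c\<rbrakk>"] cB by simp
  hence "n2 \<Q> (tcomm \<Q> x \<lbrakk>c\<rbrakk>) = 0" using T.tcomm_eq_zero[OF x, of "\<lbrakk>c\<rbrakk>"] cB by simp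
  moreover have "\<delta> \<le> (n2 \<Q> (tcomm \<Q> \<lbrakk>h\<rbrakk> \<lbrakk>c\<rbrakk>))\<^sup>2"
    by (rule tendsto_lowerbound[OF tcomm_Q_lim[OF h(1) cB]])
      (use c(2)[of 0] in \<open>auto elim!: eventually_mono simp: less_imp_le\<close>)
  ultimately show False using h(2) \<delta> by simp
qed

text \<open>The approximate solutions for all \<open>m\<close> are replaced by one exact solution:
  the conditions are read in the coordinates, glued by saturation, and taken back to the
  ultralimit.\<close>

lemma saturated_central_witness:
  fixes a b :: "nat \<Rightarrow> (nat \<Rightarrow> 'a) set" and K :: "nat \<Rightarrow> nat"
  assumes a: "\<And>i. a i \<in> tcarrier \<Q>" and b: "\<And>i. b i \<in> tcarrier \<Q>" and R: "R \<ge> 0"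
    and ap: "\<And>m. \<exists>x\<in>tcarrier \<Q>. tnorm \<Q> x \<le> R \<and> (\<forall>i<m. (n2 \<Q> (tcomm \<Q> x (b i)))\<^sup>2 < 1 / Suc m)
      \<and> s - (n2 \<Q> x)\<^sup>2 < 1 / Suc m \<and> \<bar>Re (ttr \<Q> x)\<bar> < 1 / Suc m \<and> \<bar>Im (ttr \<Q> x)\<bar> < 1 / Suc m
      \<and> (\<forall>k<m. \<forall>y\<in>tcarrier \<Q>. tnorm \<Q> y \<le> 1 \<longrightarrow> (n2 \<Q> (tcomm \<Q> x y))\<^sup>2 - 1 / Suc k
          - K k * (\<Sum>i<K k. (n2 \<Q> (tcomm \<Q> y (a i)))\<^sup>2) < 1 / Suc m)"
  shows "\<exists>x\<in>tcarrier \<Q>. (\<forall>i. tmul \<Q> x (b i) = tmul \<Q> (b i) x) \<and> s \<le> (n2 \<Q> x)\<^sup>2 \<and> ttr \<Q> x = 0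
      \<and> (\<forall>k. \<forall>y\<in>tcarrier \<Q>. tnorm \<Q> y \<le> 1 \<longrightarrow> (n2 \<Q> (tcomm \<Q> x y))\<^sup>2
          \<le> 1 / Suc k + K k * (\<Sum>i<K k. (n2 \<Q> (tcomm \<Q> y (a i)))\<^sup>2))"
proof -
  obtain f where f: "\<And>i. f i \<in> \<B>" "\<And>i. a i = \<lbrakk>f i\<rbrakk>" by (rule carrier_seq_rep[OF a]) (rule that; assumption)
  obtain g where g: "\<And>i. g i \<in> \<B>" "\<And>i. b i = \<lbrakk>g i\<rbrakk>" by (rule carrier_seq_rep[OF b]) (rule that; assumption)
  define G where "G k n c y = (\<rho> (tcomm P c y))\<^sup>2 - 1 / real (Suc k)
    - real (K k) * (\<Sum>i<K k. (\<rho> (tcomm P y (f i n)))\<^sup>2)" for k n c y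
  have G_lim: "((\<lambda>n. G k n (c n) (y n)) \<longlongrightarrow> (n2 \<Q> (tcomm \<Q> \<lbrakk>c\<rbrakk> \<lbrakk>y\<rbrakk>))\<^sup>2 - 1 / Suc k
          - K k * (\<Sum>i<K k. (n2 \<Q> (tcomm \<Q> \<lbrakk>y\<rbrakk> (a i)))\<^sup>2)) U" if "c \<in> \<B>" "y \<in> \<B>" for k c y
    unfolding G_def f(2) using that f(1) by (intro tendsto_intros tcomm_Q_lim)
  let ?S = "{c \<in> \<C>. \<nu> c \<le> R}" and ?D = "{c \<in> \<C>. \<nu> c \<le> 1}"
  let ?A = "\<lambda>m n c. (\<forall>i<m. (\<rho> (tcomm P c (g i n)))\<^sup>2 < 1 / Suc m) \<and> s - (\<rho> c)\<^sup>2 < 1 / Suc m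
    \<and> \<bar>Re (\<tau> c)\<bar> < 1 / Suc m \<and> \<bar>Im (\<tau> c)\<bar> < 1 / Suc m \<and> (\<forall>k<m. \<forall>y\<in>?D. G k n c y < 1 / Suc m)"
  obtain c where c: "\<And>n. c n \<in> ?S" "\<And>m. \<forall>\<^sub>F n in U. ?A m n (c n)"
  proof (rule saturation[OF ultra, of ?S ?A])
    have "\<zero> \<in> ?S" using R by simp
    thus "?S \<noteq> {}" by blast
    have le: "1 / real (Suc (Suc m)) \<le> 1 / Suc m" for m by (simp add: frac_le)
    show "?A m n c" if A: "?A (Suc m) n c" for m n c
      using A less_le_trans[OF _ le[of m]] by (meson less_SucI)
    fix m
    obtain x where x: "x \<in> tcarrier \<Q>" "tnorm \<Q> x \<le> R" "\<forall>i<m. (n2 \<Q> (tcomm \<Q> x (b i)))\<^sup>2 < 1 / Suc m"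
      "s - (n2 \<Q> x)\<^sup>2 < 1 / Suc m" "\<bar>Re (ttr \<Q> x)\<bar> < 1 / Suc m" "\<bar>Im (ttr \<Q> x)\<bar> < 1 / Suc m"
      "\<forall>k<m. \<forall>y\<in>tcarrier \<Q>. tnorm \<Q> y \<le> 1 \<longrightarrow> (n2 \<Q> (tcomm \<Q> x y))\<^sup>2 - 1 / Suc k
          - K k * (\<Sum>i<K k. (n2 \<Q> (tcomm \<Q> y (a i)))\<^sup>2) < 1 / Suc m" using ap[of m] by blast
    obtain h where h: "h \<in> \<B>" "x = \<lbrakk>h\<rbrakk>" "\<And>n. \<nu> (h n) \<le> tnorm \<Q> x" using norm_rep[OF x(1)] by blast
    have 1: "\<forall>\<^sub>F n in U. \<forall>i\<in>{..<m}. (\<rho> (tcomm P (h n) (g i n)))\<^sup>2 < 1 / Suc m"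
    proof (subst eventually_ball_finite_distrib, simp, intro ballI)
      fix i assume "i \<in> {..<m}"
      hence "(n2 \<Q> (tcomm \<Q> \<lbrakk>h\<rbrakk> \<lbrakk>g i\<rbrakk>))\<^sup>2 < 1 / Suc m" using x(3)[rule_format, of i] g(2)[of i] h(2) by simp
      thus "\<forall>\<^sub>F n in U. (\<rho> (tcomm P (h n) (g i n)))\<^sup>2 < 1 / Suc m"
        by (rule order_tendstoD(2)[OF tcomm_Q_lim[OF h(1) g(1)]])
    qed
    have "((\<lambda>n. s - (\<rho> (h n))\<^sup>2) \<longlongrightarrow> s - (n2 \<Q> x)\<^sup>2) U"
      unfolding h(2) by (intro tendsto_intros n2_Q h(1))
    from order_tendstoD(2)[OF this x(4)] have 2: "\<forall>\<^sub>F n in U. s - (\<rho> (h n))\<^sup>2 < 1 / Suc m" .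
    have "((\<lambda>n. \<bar>Re (\<tau> (h n))\<bar>) \<longlongrightarrow> \<bar>Re (ttr \<Q> x)\<bar>) U" "((\<lambda>n. \<bar>Im (\<tau> (h n))\<bar>) \<longlongrightarrow> \<bar>Im (ttr \<Q> x)\<bar>) U"
      unfolding h(2) by (intro tendsto_intros tr_Q h(1))+
    from order_tendstoD(2)[OF this(1) x(5)] order_tendstoD(2)[OF this(2) x(6)]
    have 3: "\<forall>\<^sub>F n in U. \<bar>Re (\<tau> (h n))\<bar> < 1 / Suc m" "\<forall>\<^sub>F n in U. \<bar>Im (\<tau> (h n))\<bar> < 1 / Suc m" .
    \<comment> \<open>The quantifier over the ball passes to the coordinates by contraposition. If
      the inequality failed on a set of the ultrafilter, the failing coordinates, completed by
      arbitrary ball elements, would form an element of the unit ball of the ultrapower violating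
      the inequality known for \<open>x\<close>.\<close>
    have 4: "\<forall>\<^sub>F n in U. \<forall>k\<in>{..<m}. \<forall>y\<in>?D. G k n (h n) y < 1 / Suc m"
    proof (subst eventually_ball_finite_distrib, simp, intro ballI, rule ccontr)
      fix k assume k: "k \<in> {..<m}" and "\<not> (\<forall>\<^sub>F n in U. \<forall>y\<in>?D. G k n (h n) y < 1 / Suc m)"
      hence ev: "\<forall>\<^sub>F n in U. \<exists>y\<in>?D. G k n (h n) y \<ge> 1 / Suc m"
        unfolding ultrafilter_not_eventually[OF ultra] by (auto elim!: eventually_mono simp: not_less)
      have "\<forall>n. \<exists>y. y \<in> ?D \<and> ((\<exists>y\<in>?D. G k n (h n) y \<ge> 1 / Suc m) \<longrightarrow> G k n (h n) y \<ge> 1 / Suc m)"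
      proof
        fix n
        have "\<zero> \<in> ?D" by simp
        thus "\<exists>y. y \<in> ?D \<and> ((\<exists>y\<in>?D. G k n (h n) y \<ge> 1 / Suc m) \<longrightarrow> G k n (h n) y \<ge> 1 / Suc m)" by blast
      qed
      then obtain y where y: "\<forall>n. y n \<in> ?D \<and> ((\<exists>y\<in>?D. G k n (h n) y \<ge> 1 / Suc m) \<longrightarrow> G k n (h n) (y n) \<ge> 1 / Suc m)"
        by (rule choice[THEN exE])
      have yB: "y \<in> \<B>" using y by (intro bseqI[of _ 1]) auto
      have "tnorm \<Q> \<lbrakk>y\<rbrakk> \<le> 1" using y yB by (intro norm_Q_le) auto
      hence "(n2 \<Q> (tcomm \<Q> \<lbrakk>h\<rbrakk> \<lbrakk>y\<rbrakk>))\<^sup>2 - 1 / Suc k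
          - K k * (\<Sum>i<K k. (n2 \<Q> (tcomm \<Q> \<lbrakk>y\<rbrakk> (a i)))\<^sup>2) < 1 / Suc m" using x(7) k yB h(2) by simp
      from order_tendstoD(2)[OF G_lim[OF h(1) yB] this] ev have "\<forall>\<^sub>F n in U. False"
      proof eventually_elim
        case (elim n)
        have "G k n (h n) (y n) \<ge> 1 / Suc m" using y elim(2) by blast
        thus ?case using elim(1) by linarith
      qed
      thus False using U_nontrivial by (simp add: trivial_limit_def)
    qed
    show "\<forall>\<^sub>F n in U. \<exists>c\<in>?S. ?A m n c"
      using 1 2 3 4
    proof eventually_elim
      case (elim n)
      have "h n \<in> ?S" using h(1) h(3)[of n] x(2) by simp
      thus ?case using elim by (intro bexI[of _ "h n"]) simp_all
    qed
  qed (rule that; assumption)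
  have cB: "c \<in> \<B>" using c(1) by (intro bseqI[of _ R]) auto
  have lim0: "(\<lambda>m. 1 / real (Suc m)) \<longlonglongrightarrow> 0" using LIMSEQ_Suc[OF lim_const_over_n[of 1]] by simp
  \<comment> \<open>The threshold \<open>N\<close> is there because the condition with index
    \<open>i\<close> or \<open>k\<close> enters only from stage \<open>Suc i\<close> or
    \<open>Suc k\<close> on.\<close>
  have le0: "t \<le> 0" if "(F \<longlongrightarrow> t) U" "\<And>m. m \<ge> N \<Longrightarrow> \<forall>\<^sub>F n in U. F n < 1 / Suc m" for F t and N :: nat
  proof (rule LIMSEQ_le_const[OF lim0], intro exI allI impI)
    fix m assume "N \<le> m"
    thus "t \<le> 1 / Suc m"
      using that(2)[of m] by (intro tendsto_upperbound[OF that(1)]) (auto elim!: eventually_mono)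
  qed
  have ev: "\<forall>\<^sub>F n in U. s - (\<rho> (c n))\<^sup>2 < 1 / Suc m" "\<forall>\<^sub>F n in U. \<bar>Re (\<tau> (c n))\<bar> < 1 / Suc m"
    "\<forall>\<^sub>F n in U. \<bar>Im (\<tau> (c n))\<bar> < 1 / Suc m" for m
    using c(2)[of m] by (auto elim!: eventually_mono)
  show ?thesis
  proof (intro bexI[of _ "\<lbrakk>c\<rbrakk>"] conjI allI ballI impI)
    fix i
    have "(n2 \<Q> (tcomm \<Q> \<lbrakk>c\<rbrakk> \<lbrakk>g i\<rbrakk>))\<^sup>2 \<le> 0"
    proof (rule le0[OF tcomm_Q_lim[OF cB g(1)], of "Suc i"])
      fix m assume "Suc i \<le> m"
      thus "\<forall>\<^sub>F n in U. (\<rho> (tcomm P (c n) (g i n)))\<^sup>2 < 1 / Suc m"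
        using c(2)[of m] by (elim eventually_mono) simp
    qed
    hence "n2 \<Q> (tcomm \<Q> \<lbrakk>c\<rbrakk> \<lbrakk>g i\<rbrakk>) = 0" by simp
    thus "tmul \<Q> \<lbrakk>c\<rbrakk> (b i) = tmul \<Q> (b i) \<lbrakk>c\<rbrakk>"
      using T.tcomm_eq_zero[of "\<lbrakk>c\<rbrakk>" "\<lbrakk>g i\<rbrakk>"] cB g(1) by (simp add: g(2))
  next
    have "((\<lambda>n. s - (\<rho> (c n))\<^sup>2) \<longlongrightarrow> s - (n2 \<Q> \<lbrakk>c\<rbrakk>)\<^sup>2) U" by (intro tendsto_intros n2_Q cB)
    from le0[where N = 0, OF this ev(1)] have "s - (n2 \<Q> \<lbrakk>c\<rbrakk>)\<^sup>2 \<le> 0" .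
    thus "s \<le> (n2 \<Q> \<lbrakk>c\<rbrakk>)\<^sup>2" by simp
  next
    have "((\<lambda>n. \<bar>Re (\<tau> (c n))\<bar>) \<longlongrightarrow> \<bar>Re (ttr \<Q> \<lbrakk>c\<rbrakk>)\<bar>) U" by (intro tendsto_intros tr_Q cB)
    from le0[where N = 0, OF this ev(2)] have "\<bar>Re (ttr \<Q> \<lbrakk>c\<rbrakk>)\<bar> \<le> 0" .
    moreover have "((\<lambda>n. \<bar>Im (\<tau> (c n))\<bar>) \<longlongrightarrow> \<bar>Im (ttr \<Q> \<lbrakk>c\<rbrakk>)\<bar>) U" by (intro tendsto_intros tr_Q cB)
    from le0[where N = 0, OF this ev(3)] have "\<bar>Im (ttr \<Q> \<lbrakk>c\<rbrakk>)\<bar> \<le> 0" .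
    ultimately show "ttr \<Q> \<lbrakk>c\<rbrakk> = 0" by (simp add: complex_eq_iff)
  next
    fix k Y assume Y: "Y \<in> tcarrier \<Q>" "tnorm \<Q> Y \<le> 1"
    obtain y where y: "y \<in> \<B>" "Y = \<lbrakk>y\<rbrakk>" "\<And>n. \<nu> (y n) \<le> tnorm \<Q> Y" using norm_rep[OF Y(1)] by blast
    have "(n2 \<Q> (tcomm \<Q> \<lbrakk>c\<rbrakk> \<lbrakk>y\<rbrakk>))\<^sup>2 - 1 / Suc k - K k * (\<Sum>i<K k. (n2 \<Q> (tcomm \<Q> \<lbrakk>y\<rbrakk> (a i)))\<^sup>2) \<le> 0"
    proof (rule le0[OF G_lim[OF cB y(1)], of "Suc k"])
      fix m assume m: "Suc k \<le> m"
      have "y n \<in> ?D" for n using y(1) y(3)[of n] Y(2) by simp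
      thus "\<forall>\<^sub>F n in U. G k n (c n) (y n) < 1 / Suc m"
        using c(2)[of m] m by (elim eventually_mono) (meson Suc_le_lessD)
    qed
    thus "(n2 \<Q> (tcomm \<Q> \<lbrakk>c\<rbrakk> Y))\<^sup>2 \<le> 1 / Suc k + K k * (\<Sum>i<K k. (n2 \<Q> (tcomm \<Q> Y (a i)))\<^sup>2)"
      unfolding y(2) by simp
  qed (use cB in simp)
qed

lemma mem_relcomm_if_commute_dense:
  assumes "x \<in> tcarrier \<Q>" "S \<subseteq> tcarrier \<Q>" "\<And>i. d i \<in> S" "\<And>i. tmul \<Q> x (d i) = tmul \<Q> (d i) x"
    and "\<And>s \<epsilon>. s \<in> S \<Longrightarrow> \<epsilon> > 0 \<Longrightarrow> \<exists>i. n2 \<Q> (tsub \<Q> s (d i)) < \<epsilon>"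
  shows "x \<in> relcomm \<Q> S"
proof -
  have "tmul \<Q> x s = tmul \<Q> s x" if "s \<in> S" for s
    by (rule T.commute_if_commute_dense[of x s d]) (use assms that in auto)
  thus ?thesis using assms(1) by (simp add: relcomm_def)
qed

text \<open>Elementarity is used twice: below the quantifiers over the tuple, to know that the inner formula
  vanishes on tuples from \<open>M\<close> (where \<open>x\<close> is a witness), and for the quantified formula, to transfer this
  to the tuple \<open>b\<close> from \<open>N\<close>.\<close>
lemma transfer_witness:
  fixes a b :: "nat \<Rightarrow> (nat \<Rightarrow> 'a) set" and K :: "nat \<Rightarrow> nat"
  assumes M: "M \<subseteq> tcarrier \<Q>" "tzero \<Q> \<in> M" and el: "elementary M \<Q>" and a: "\<And>i. a i \<in> M"
    and b: "\<And>i. b i \<in> tcarrier \<Q>" and x: "x \<in> relcomm \<Q> M" "ttr \<Q> x = 0"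
    and K: "\<And>k y. y \<in> tcarrier \<Q> \<Longrightarrow> tnorm \<Q> y \<le> 1 \<Longrightarrow>
      (n2 \<Q> (tcomm \<Q> x y))\<^sup>2 \<le> 1 / Suc k + K k * (\<Sum>i<K k. (n2 \<Q> (tcomm \<Q> y (a i)))\<^sup>2)"
  defines "R \<equiv> tnorm \<Q> x" and "s \<equiv> (n2 \<Q> x)\<^sup>2"
  obtains \<beta> where "\<And>j. \<beta> j \<in> tcarrier \<Q>" "\<And>i. \<beta> (2 * i + 2) = a i" "\<And>i. i < m \<Longrightarrow> \<beta> (2 * i + 3) = b i"
    "feval (F_main R s K m) \<Q> \<beta> \<le> 0"
proof -
  let ?\<phi> = "F_main R s K m" and ?r = "\<lambda>i. tnorm \<Q> (b i)"
  \<comment> \<open>Every variable receives some element of \<open>M\<close>, as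
    \<open>elementary\<close> demands; what matters is that variable \<open>2 * i + 2\<close>
    receives \<open>a i\<close>. Truncated subtraction sends variables 0 and 1 to
    \<open>a 0\<close>.\<close>
  define \<alpha> where "\<alpha> j = a ((j - 2) div 2)" for j :: nat
  have \<alpha>: "\<alpha> j \<in> M" "\<alpha> (2 * i + 2) = a i" for i j using a by (simp_all add: \<alpha>_def)
  have xC: "x \<in> tcarrier \<Q>" using x(1) by (simp add: relcomm_def)
  have R: "R \<ge> 0" using xC by (simp add: R_def)
  have inner: "feval ?\<phi> (restr \<Q> M) \<beta> \<le> 0" if \<beta>: "\<And>j. \<beta> j \<in> M" "\<And>i. \<beta> (2 * i + 2) = a i" for \<beta>
  proof -
    let ?\<beta> = "\<beta>(0 := x)" and ?L = "F_comm m # F_low s # F_rest K m"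
    have c: "?\<beta> j \<in> tcarrier \<Q>" for j using \<beta>(1)[of j] M(1) xC by auto
    have "tcomm \<Q> x (\<beta> j) = tzero \<Q>" for j
      using \<beta>(1)[of j] x(1) M(1) xC by (auto simp: relcomm_def tcomm_def)
    hence "feval (F_comm m) \<Q> ?\<beta> = 0" unfolding T.feval_F_comm[of ?\<beta>, OF c] by simp
    moreover have "feval (F_low s) \<Q> ?\<beta> = 0" unfolding T.feval_F_low[of ?\<beta>, OF c] by (simp add: s_def)
    moreover have "feval \<psi> \<Q> ?\<beta> \<le> 0" if "\<psi> \<in> set (F_rest K m)" for \<psi>
      by (rule T.F_rest_nonpos[of ?\<beta>, OF c _ _ that]) (use x(2) K \<beta>(2) in simp_all)
    ultimately have "feval (FAnd ?L) \<Q> ?\<beta> = 0" by (intro feval_FAnd_zero) auto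
    moreover have "feval ?\<phi> \<Q> \<beta> \<le> feval (FAnd ?L) \<Q> ?\<beta>"
      by (rule T.feval_F_main_le[OF xC]) (simp add: R_def)
    moreover have "feval ?\<phi> (restr \<Q> M) \<beta> = feval ?\<phi> \<Q> \<beta>"
      using el adm_F_main \<beta>(1) unfolding elementary_def by blast
    ultimately show ?thesis by simp
  qed
  have "feval (FSups ?r m ?\<phi>) (restr \<Q> M) \<alpha> \<le> 0"
  proof (rule feval_FSups_least[where z = "tzero \<Q>" and a = a])
    show "feval ?\<phi> (restr \<Q> M) \<beta> \<le> 0"
      if "\<And>j. \<beta> j \<in> tcarrier (restr \<Q> M)" "\<And>i. \<beta> (2 * i + 2) = a i" for \<beta> using inner that by simp
  qed (use \<alpha> M b in simp_all)
  moreover have "feval (FSups ?r m ?\<phi>) (restr \<Q> M) \<alpha> = feval (FSups ?r m ?\<phi>) \<Q> \<alpha>"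
    using el adm_FSups[OF adm_F_main] \<alpha>(1) unfolding elementary_def by blast
  \<comment> \<open>The radii are the norms of the \<open>b i\<close>, so this tuple is admissible
    for the suprema.\<close>
  moreover have "feval ?\<phi> \<Q> (upd \<alpha> b m) \<le> feval (FSups ?r m ?\<phi>) \<Q> \<alpha>"
    by (rule feval_FSups_upper[where B = s, THEN conjunct2])
      (use T.F_main_bounded R b \<alpha>(1) M(1) in \<open>auto simp: s_def\<close>)
  ultimately have "feval ?\<phi> \<Q> (upd \<alpha> b m) \<le> 0" by simp
  moreover have "upd \<alpha> b m j \<in> tcarrier \<Q>" for j using \<alpha>(1) M(1) b by (intro upd_mem) auto
  ultimately show ?thesis using that[of "upd \<alpha> b m"] \<alpha>(2) upd_even upd_tuple by metis
qed

lemma central_trace_zero: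
  assumes MN: "M \<subseteq> N" and M: "vsub \<Q> M" and N: "vsub \<Q> N"
    and sM: "separable (restr \<Q> M)" and sN: "separable (restr \<Q> N)"
    and el: "elementary M \<Q>" and fac: "factor (restr \<Q> (relcomm \<Q> N))"
    and x: "x \<in> relcomm \<Q> M" "ttr \<Q> x = 0" and central: "\<And>y. y \<in> relcomm \<Q> M \<Longrightarrow> tmul \<Q> x y = tmul \<Q> y x"
  shows "x = tzero \<Q>"
proof (rule ccontr)
  assume nz: "x \<noteq> tzero \<Q>"
  have MC: "M \<subseteq> tcarrier \<Q>" and NC: "N \<subseteq> tcarrier \<Q>" using M N by (simp_all add: vsub_def)
  have zM: "tzero \<Q> \<in> M"
    using M tracial_algebra.zero_closed[of "restr \<Q> M"] by (simp add: vsub_def tvna_iff_tracial_algebra)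
  have xC: "x \<in> tcarrier \<Q>" using x(1) by (simp add: relcomm_def)
  obtain a where a: "\<And>i::nat. a i \<in> M" "\<And>s \<epsilon>. s \<in> M \<Longrightarrow> \<epsilon> > 0 \<Longrightarrow> \<exists>i. n2 \<Q> (tsub \<Q> s (a i)) < \<epsilon>"
    by (rule dense_sequence[OF sM zM]) (rule that; assumption)
  have zN: "tzero \<Q> \<in> N" using zM MN by blast
  obtain b where b: "\<And>i::nat. b i \<in> N" "\<And>s \<epsilon>. s \<in> N \<Longrightarrow> \<epsilon> > 0 \<Longrightarrow> \<exists>i. n2 \<Q> (tsub \<Q> s (b i)) < \<epsilon>"
    by (rule dense_sequence[OF sN zN]) (rule that; assumption)
  have aC: "a i \<in> tcarrier \<Q>" and bC: "b i \<in> tcarrier \<Q>" for i using a(1)[of i] b(1)[of i] MC NC by auto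
  \<comment> \<open>Density makes commuting with all \<open>a i\<close> the same as lying in the
    relative commutant of \<open>M\<close>, where \<open>central\<close> applies; the error is
    \<open>1 / Suc k\<close>.\<close>
  have "\<exists>K::nat. \<forall>y\<in>tcarrier \<Q>. tnorm \<Q> y \<le> 1 \<longrightarrow>
    (n2 \<Q> (tcomm \<Q> x y))\<^sup>2 \<le> 1 / Suc k + K * (\<Sum>i<K. (n2 \<Q> (tcomm \<Q> y (a i)))\<^sup>2)" for k :: nat
    by (rule central_modulus[OF aC xC]) (use central mem_relcomm_if_commute_dense[OF _ MC a(1) _ a(2)] in auto)
  then obtain K :: "nat \<Rightarrow> nat" where K: "\<And>k y. y \<in> tcarrier \<Q> \<Longrightarrow> tnorm \<Q> y \<le> 1 \<Longrightarrow>
      (n2 \<Q> (tcomm \<Q> x y))\<^sup>2 \<le> 1 / Suc k + K k * (\<Sum>i<K k. (n2 \<Q> (tcomm \<Q> y (a i)))\<^sup>2)" by metis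
  define R s where "R = tnorm \<Q> x" and "s = (n2 \<Q> x)\<^sup>2"
  have R: "R \<ge> 0" using xC by (simp add: R_def)
  have "\<exists>X\<in>tcarrier \<Q>. tnorm \<Q> X \<le> R \<and> (\<forall>i<m. (n2 \<Q> (tcomm \<Q> X (b i)))\<^sup>2 < 1 / Suc m)
      \<and> s - (n2 \<Q> X)\<^sup>2 < 1 / Suc m \<and> \<bar>Re (ttr \<Q> X)\<bar> < 1 / Suc m \<and> \<bar>Im (ttr \<Q> X)\<bar> < 1 / Suc m
      \<and> (\<forall>k<m. \<forall>y\<in>tcarrier \<Q>. tnorm \<Q> y \<le> 1 \<longrightarrow> (n2 \<Q> (tcomm \<Q> X y))\<^sup>2 - 1 / Suc k
          - K k * (\<Sum>i<K k. (n2 \<Q> (tcomm \<Q> y (a i)))\<^sup>2) < 1 / Suc m)" for m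
  proof -
    obtain \<beta> where \<beta>: "\<And>j. \<beta> j \<in> tcarrier \<Q>" "\<And>i. \<beta> (2 * i + 2) = a i" "\<And>i. i < m \<Longrightarrow> \<beta> (2 * i + 3) = b i"
      and le: "feval (F_main R s K m) \<Q> \<beta> \<le> 0"
      by (rule transfer_witness[where a = a and b = b and m = m, OF MC zM el a(1) bC x K, folded R_def s_def])
        (assumption | (rule that; assumption))+
    have "feval (F_main R s K m) \<Q> \<beta> < 1 / Suc m" by (rule le_less_trans[OF le]) simp
    thus ?thesis
    proof (rule T.F_main_witness[OF \<beta>(1) R])
      fix X assume X: "X \<in> tcarrier \<Q>" "tnorm \<Q> X \<le> R" "s - (n2 \<Q> X)\<^sup>2 < 1 / Suc m"
          "\<bar>Re (ttr \<Q> X)\<bar> < 1 / Suc m" "\<bar>Im (ttr \<Q> X)\<bar> < 1 / Suc m"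
        and X1: "\<And>i. i < m \<Longrightarrow> (n2 \<Q> (tcomm \<Q> X (\<beta> (2 * i + 3))))\<^sup>2 < 1 / Suc m"
        and X2: "\<And>k y. k < m \<Longrightarrow> y \<in> tcarrier \<Q> \<Longrightarrow> tnorm \<Q> y \<le> 1 \<Longrightarrow> (n2 \<Q> (tcomm \<Q> X y))\<^sup>2 - 1 / Suc k
          - K k * (\<Sum>i<K k. (n2 \<Q> (tcomm \<Q> y (\<beta> (2 * i + 2))))\<^sup>2) < 1 / Suc m"
      have "(n2 \<Q> (tcomm \<Q> X (b i)))\<^sup>2 < 1 / Suc m" if "i < m" for i using X1[OF that] \<beta>(3)[OF that] by simp
      thus ?thesis using X X2[unfolded \<beta>(2)] by blast
    qed
  qed
  from saturated_central_witness[of a b, OF aC bC R this]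
  obtain X where X: "X \<in> tcarrier \<Q>" "\<forall>i. tmul \<Q> X (b i) = tmul \<Q> (b i) X" "s \<le> (n2 \<Q> X)\<^sup>2" "ttr \<Q> X = 0"
    "\<forall>k. \<forall>y\<in>tcarrier \<Q>. tnorm \<Q> y \<le> 1 \<longrightarrow> (n2 \<Q> (tcomm \<Q> X y))\<^sup>2
          \<le> 1 / Suc k + K k * (\<Sum>i<K k. (n2 \<Q> (tcomm \<Q> y (a i)))\<^sup>2)" by blast
  have XN: "X \<in> relcomm \<Q> N" by (rule mem_relcomm_if_commute_dense[OF X(1) NC b(1) _ b(2)]) (use X(2) in auto)
  have "tmul \<Q> X Y = tmul \<Q> Y X" if Y: "Y \<in> relcomm \<Q> N" for Y
  proof -
    have YC: "Y \<in> tcarrier \<Q>" using Y by (simp add: relcomm_def)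
    \<comment> \<open>The inequality for \<open>X\<close> speaks about the unit ball, so
      \<open>Y\<close> is scaled into it; the summand 1 keeps \<open>t\<close> positive.\<close>
    define t where "t = tnorm \<Q> Y + 1"
    have t: "t > 0" using T.norm_nonneg[OF YC] unfolding t_def by linarith
    define Z where "Z = tsmult \<Q> (of_real (1 / t)) Y"
    have Z: "Z \<in> tcarrier \<Q>" using YC by (simp add: Z_def)
    have "tnorm \<Q> Z = tnorm \<Q> Y / t" using YC t by (simp add: Z_def T.norm_laws norm_divide)
    also have "\<dots> \<le> 1" using t by (simp add: t_def)
    finally have Z1: "tnorm \<Q> Z \<le> 1" .
    have "tcomm \<Q> Z (a i) = tzero \<Q>" for i
    proof -
      have "tmul \<Q> Y (a i) = tmul \<Q> (a i) Y" using Y a(1)[of i] MN by (auto simp: relcomm_def)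
      thus ?thesis using YC aC[of i] by (simp add: tcomm_def Z_def T.mul_laws)
    qed
    \<comment> \<open>The penalty vanishes because \<open>Z\<close> commutes with the
      \<open>a i\<close>, which lie in \<open>M\<close> and so in \<open>N\<close>.\<close>
    hence bound: "(n2 \<Q> (tcomm \<Q> X Z))\<^sup>2 \<le> 1 / Suc k" for k
      using X(5)[rule_format, OF Z Z1, of k] by simp
    have "(n2 \<Q> (tcomm \<Q> X Z))\<^sup>2 \<le> 0"
      by (rule LIMSEQ_le_const[of "\<lambda>k. 1 / real (Suc k)"])
        (use bound LIMSEQ_Suc[OF lim_const_over_n[of "1::real"]] in auto)
    hence "n2 \<Q> (tcomm \<Q> X Z) = 0" by simp
    hence "tmul \<Q> X Z = tmul \<Q> Z X" using T.tcomm_eq_zero[OF X(1) Z] by simp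
    moreover have "Y = tsmult \<Q> (of_real t) Z" using YC t by (simp add: Z_def)
    ultimately show ?thesis using X(1) Z by (simp add: T.mul_laws)
  qed
  hence "X \<in> center (restr \<Q> (relcomm \<Q> N))" using XN by (simp add: center_def)
  then obtain c where c: "X = tsmult \<Q> c (tone \<Q>)" using fac by (auto simp: factor_def)
  \<comment> \<open>A scalar equals its own trace, so \<open>X\<close> is 0, against the lower bound
    \<open>s\<close>, which is positive.\<close>
  hence "c = 0" using X(4) by (simp add: T.tr_laws)
  hence "s \<le> 0" using c X(3) by simp
  moreover have "s > 0" using nz T.n2_zero_iff[OF xC] by (simp add: s_def)
  ultimately show False by simp
qed

text \<open>Subtracting its trace from a central element leaves a central element of trace zero,
  which \<open>central_trace_zero\<close> shows to vanish; so the central element is a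
  scalar.\<close>

theorem factor_relcomm:
  assumes MN: "M \<subseteq> N" and M: "vsub \<Q> M" and N: "vsub \<Q> N"
    and sM: "separable (restr \<Q> M)" and sN: "separable (restr \<Q> N)"
    and el: "elementary M \<Q>" and fac: "factor (restr \<Q> (relcomm \<Q> N))"
  shows "factor (restr \<Q> (relcomm \<Q> M))"
proof -
  have MC: "M \<subseteq> tcarrier \<Q>" using M by (simp add: vsub_def)
  have "tstar \<Q> y \<in> M" if "y \<in> M" for y
    using M tracial_algebra.star_closed_ax[of "restr \<Q> M"] that by (simp add: vsub_def tvna_iff_tracial_algebra)
  hence R: "tracial_algebra (restr \<Q> (relcomm \<Q> M))" by (rule T.tracial_algebra_relcomm[OF MC])
  have scal: "tsmult \<Q> c (tone \<Q>) \<in> relcomm \<Q> M" for c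
    using MC by (auto simp: relcomm_def T.mul_laws)
  have "center (restr \<Q> (relcomm \<Q> M)) = {tsmult \<Q> c (tone \<Q>) | c. True}"
  proof (intro equalityI subsetI)
    fix x assume "x \<in> center (restr \<Q> (relcomm \<Q> M))"
    hence x: "x \<in> relcomm \<Q> M" and c: "\<And>y. y \<in> relcomm \<Q> M \<Longrightarrow> tmul \<Q> x y = tmul \<Q> y x"
      by (simp_all add: center_def)
    have xC: "x \<in> tcarrier \<Q>" using x by (simp add: relcomm_def)
    let ?t = "tsmult \<Q> (ttr \<Q> x) (tone \<Q>)"
    have "tsub \<Q> x ?t = tzero \<Q>"
    proof (rule central_trace_zero[OF assms])
      show "tsub \<Q> x ?t \<in> relcomm \<Q> M"
        using x scal[of "ttr \<Q> x"] MC by (auto simp: relcomm_def T.mul_laws(6,7))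
      show "ttr \<Q> (tsub \<Q> x ?t) = 0" using xC by (simp add: T.tr_laws)
      fix y assume y: "y \<in> relcomm \<Q> M"
      hence "y \<in> tcarrier \<Q>" by (simp add: relcomm_def)
      thus "tmul \<Q> (tsub \<Q> x ?t) y = tmul \<Q> y (tsub \<Q> x ?t)" using xC c[OF y] by (simp add: T.mul_laws)
    qed
    hence "x = ?t" by (rule T.diff_eq_zero[OF xC, rotated]) simp
    thus "x \<in> {tsmult \<Q> c (tone \<Q>) | c. True}" by blast
  next
    fix x assume "x \<in> {tsmult \<Q> c (tone \<Q>) | c. True}"
    then obtain c where x: "x = tsmult \<Q> c (tone \<Q>)" by blast
    have "tmul \<Q> x y = tmul \<Q> y x" if "y \<in> relcomm \<Q> M" for y
      using that unfolding x by (simp add: relcomm_def T.mul_laws)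
    thus "x \<in> center (restr \<Q> (relcomm \<Q> M))" using scal x by (simp add: center_def)
  qed
  thus ?thesis using R by (simp add: factor_def tvna_iff_tracial_algebra)
qed

end

theorem mainTheorem4:
  fixes P :: "'a tralg" and U :: "nat filter"
    and M N :: "(nat \<Rightarrow> 'a) set set"
  assumes "CH"
    and "nonprincipal_ultrafilter U"
    and "tvna P" and "II1_factor P" and "separable P"
    and "M \<subseteq> N"
    and "vsub (ultrapower P U) M" and "vsub (ultrapower P U) N"
    and "II1_factor (restr (ultrapower P U) M)" and "separable (restr (ultrapower P U) M)"
    and "II1_factor (restr (ultrapower P U) N)" and "separable (restr (ultrapower P U) N)"
    and "elementary M (ultrapower P U)"
    and "factor (restr (ultrapower P U) (relcomm (ultrapower P U) N))"
  shows "factor (restr (ultrapower P U) (relcomm (ultrapower P U) M))"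
proof -
  have "tracial_ultrapower P U"
    using assms(2,3) by (simp add: tracial_ultrapower_def tracial_ultrapower_axioms_def tvna_iff_tracial_algebra)
  thus ?thesis by (rule tracial_ultrapower.factor_relcomm) (fact assms)+
qed

end
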